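(* Let $\Gamma$ be a smooth embedded connected nonclosed curve in $\mathbb{R}^N$ with total curvature $\le 2\pi$. Then no nontrivial (i.e. nonzero) rectifiable $2$-dimensional varifold $M$ in $\mathbb{R}^N$ with bounded support and with density $\ge 1$ throughout $(\mathrm{support}\,M)\setminus\Gamma$ is strongly stationary with respect to $\Gamma$.
   Context: Nonclosed means that the curve is not a closed loop (it is an embedded interval rather than an embedded circle). The total curvature of a polygonal curve is the sum of the exterior angles at its (interior) vertices; the total curvature of an arbitrary continuous curve is the supremum of the total curvatures of inscribed polygonal curves (for a smooth curve it is the integral of the norm of the curvature vector with respect to arclength). A compactly supported rectifiable varifold $M$ is strongly stationary with respect to a rectifiable curve $\Gamma$ if $$\left(\frac{d}{dt}\right)_{t=0}\Big(\mathrm{area}(\phi(t,M))+\mathrm{area}(\phi([0,t]\times\Gamma))\Big)\ge 0$$ for every smooth map $\phi:\mathbb{R}\times\mathbb{R}^N\to\mathbb{R}^N$ with $\phi(0,x)\equiv x$. Equivalently: $\int_M \mathrm{div}_M X\le\int_\Gamma |X^\perp|\,ds$ for all smooth vectorfields $X$ on $\mathbb{R}^N$, where $X^\perp$ is the component of $X$ normal to $\Gamma$ and $ds$ is arclength. The density of $M$ at $p$ is $\Theta(M,p)=\lim_{r\to0}\frac{\mathrm{area}(M\cap\mathbf{B}(p,r))}{\pi r^2}$, where $\mathbf{B}(p,r)$ is the ball of radius $r$ about $p$ and area means varifold mass. *)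

theory Defs
  imports "HOL-Analysis.Analysis"
begin

section \<open>Smooth maps and smooth embedded arcs\<close>

primrec C_k :: "nat \<Rightarrow> ('a::euclidean_space \<Rightarrow> 'b::real_normed_vector) \<Rightarrow> bool" where
  "C_k 0 f \<longleftrightarrow> continuous_on UNIV f"
| "C_k (Suc k) f \<longleftrightarrow>
     (\<forall>x. f differentiable (at x)) \<and> (\<forall>v. C_k k (\<lambda>x. frechet_derivative f (at x) v))"

definition smooth :: "('a::euclidean_space \<Rightarrow> 'b::real_normed_vector) \<Rightarrow> bool" where
  "smooth f \<longleftrightarrow> (\<forall>k. C_k k f)"

text \<open>\<open>D k\<close> is the \<open>k\<close>-th derivative of \<open>\<gamma>\<close>; it is one-sided at the end points.\<close>

definition smooth_path :: "(real \<Rightarrow> 'a::real_normed_vector) \<Rightarrow> bool" where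
  "smooth_path \<gamma> \<longleftrightarrow>
     (\<exists>D :: nat \<Rightarrow> real \<Rightarrow> 'a. D 0 = \<gamma> \<and>
        (\<forall>k. \<forall>t\<in>{0..1}. (D k has_vector_derivative D (Suc k) t) (at t within {0..1})))"

definition velocity :: "(real \<Rightarrow> 'a::real_normed_vector) \<Rightarrow> real \<Rightarrow> 'a" where
  "velocity \<gamma> t = vector_derivative \<gamma> (at t within {0..1})"

text \<open>A connected nonclosed embedded curve is an embedded compact interval; it is given by a
  regular parametrization, and the curve itself is \<open>path_image \<gamma>\<close>.\<close>

definition smooth_embedded_arc :: "(real \<Rightarrow> 'a::real_normed_vector) \<Rightarrow> bool" where
  "smooth_embedded_arc \<gamma> \<longleftrightarrow>
     arc \<gamma> \<and> smooth_path \<gamma> \<and> (\<forall>t\<in>{0..1}. velocity \<gamma> t \<noteq> 0)"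

section \<open>Total curvature\<close>

definition vector_angle :: "'a::real_inner \<Rightarrow> 'a \<Rightarrow> real" where
  "vector_angle u v = arccos (u \<bullet> v / (norm u * norm v))"

text \<open>Sum of the exterior angles at the interior vertices of the polygonal curve through the
  listed points.\<close>

fun polygon_curvature :: "'a::real_inner list \<Rightarrow> real" where
  "polygon_curvature (x # y # z # ps) = vector_angle (y - x) (z - y) + polygon_curvature (y # z # ps)"
| "polygon_curvature _ = 0"

text \<open>Consecutive vertices are required to be distinct, so that every exterior angle is defined;
  this is automatic when \<open>\<gamma>\<close> is injective.\<close>

definition total_curvature :: "(real \<Rightarrow> 'a::real_inner) \<Rightarrow> ereal" where
  "total_curvature \<gamma> =
     (SUP ts \<in> {ts. sorted_wrt (<) ts \<and> set ts \<subseteq> {0..1} \<and> distinct_adj (map \<gamma> ts)}.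
        ereal (polygon_curvature (map \<gamma> ts)))"

section \<open>Two-dimensional Hausdorff measure\<close>

text \<open>The factor \<open>pi / 4\<close> makes this agree with area on planes. Boundedness of the covering sets
  is demanded explicitly because \<open>diameter\<close> is real-valued.\<close>

definition hausdorff2_delta :: "real \<Rightarrow> 'a::metric_space set \<Rightarrow> ennreal" where
  "hausdorff2_delta \<delta> A =
     (INF C \<in> {C :: nat \<Rightarrow> 'a set. A \<subseteq> (\<Union>i. C i) \<and> (\<forall>i. bounded (C i) \<and> diameter (C i) \<le> \<delta>)}.
        \<Sum>i. ennreal (pi / 4 * (diameter (C i))\<^sup>2))"

definition hausdorff2_outer :: "'a::metric_space set \<Rightarrow> ennreal" where
  "hausdorff2_outer A = (SUP \<delta> \<in> {0<..}. hausdorff2_delta \<delta> A)"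

text \<open>The \<open>\<sigma>\<close>-algebra consists of all sets measurable in the sense of Caratheodory.\<close>

definition hausdorff2 :: "'a::metric_space measure" where
  "hausdorff2 = measure_of UNIV (lambda_system UNIV UNIV hausdorff2_outer) hausdorff2_outer"

section \<open>Rectifiable two-dimensional varifolds\<close>

text \<open>A plane through the origin is represented by the matrix of the orthogonal projection onto
  it. The plane is \<open>range ((*v) P)\<close>.\<close>

definition planes :: "(real^'n^'n) set" where
  "planes = {P. transpose P = P \<and> P ** P = P \<and> rank P = 2}"

text \<open>A varifold is a Radon measure on the product of space and Grassmannian; here it is a
  measure on the product with the space of all matrices, concentrated on \<open>planes\<close>.\<close>

type_synonym 'n varifold = "((real^'n) \<times> (real^'n^'n)) measure"

definition varifold2 :: "('n::finite) varifold \<Rightarrow> bool" where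
  "varifold2 V \<longleftrightarrow>
     sets V = sets borel \<and>
     (AE (x, P) in V. P \<in> planes) \<and>
     (\<forall>K. compact K \<longrightarrow> emeasure V (K \<times> UNIV) < \<infinity>)"

definition weight :: "('n::finite) varifold \<Rightarrow> (real^'n) measure" where
  "weight V = distr V borel fst"

definition support :: "('n::finite) varifold \<Rightarrow> (real^'n) set" where
  "support V = {x. \<forall>r>0. emeasure (weight V) (ball x r) > 0}"

definition has_density :: "('n::finite) varifold \<Rightarrow> real^'n \<Rightarrow> real \<Rightarrow> bool" where
  "has_density V p d \<longleftrightarrow>
     ((\<lambda>r. measure (weight V) (cball p r) / (pi * r\<^sup>2)) \<longlongrightarrow> d) (at_right 0)"

definition countably_rectifiable2 :: "(real^'n) set \<Rightarrow> bool" where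
  "countably_rectifiable2 S \<longleftrightarrow>
     (\<exists>(Z :: (real^'n) set) (F :: nat \<Rightarrow> real^2 \<Rightarrow> real^'n).
        hausdorff2_outer Z = 0 \<and> (\<forall>j. \<exists>L. L-lipschitz_on UNIV (F j)) \<and>
        S \<subseteq> Z \<union> (\<Union>j. range (F j)))"

text \<open>The plane of \<open>P\<close> is the approximate tangent plane at \<open>x\<close>, with multiplicity \<open>c\<close>: the
  blow-ups of \<open>\<mu>\<close> at \<open>x\<close> converge, as Radon measures, to \<open>c\<close> times area on the plane.\<close>

definition approx_tangent_plane ::
    "(real^'n) measure \<Rightarrow> real^'n \<Rightarrow> real^'n^'n \<Rightarrow> real \<Rightarrow> bool" where
  "approx_tangent_plane \<mu> x P c \<longleftrightarrow>
     (\<forall>f :: real^'n \<Rightarrow> real. continuous_on UNIV f \<and> bounded {y. f y \<noteq> 0} \<longrightarrow>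
        ((\<lambda>r. (\<integral>y. f ((y - x) /\<^sub>R r) \<partial>\<mu>) / r\<^sup>2)
           \<longlongrightarrow> c * (\<integral>y. indicator (range ((*v) P)) y * f y \<partial>hausdorff2)) (at_right 0))"

text \<open>\<open>V\<close> is the varifold of a countably rectifiable set \<open>S\<close> with positive multiplicity function
  \<open>\<theta>\<close>, whose plane component is the approximate tangent plane \<open>T x\<close>. Such a \<open>T\<close> exists, and is
  unique almost everywhere on \<open>S\<close>, for every countably rectifiable \<open>S\<close> and every locally
  integrable \<open>\<theta>\<close>; local integrability of \<open>\<theta>\<close> is local finiteness of \<open>V\<close>.\<close>

definition rectifiable_varifold2 :: "('n::finite) varifold \<Rightarrow> bool" where
  "rectifiable_varifold2 V \<longleftrightarrow>
     varifold2 V \<and>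
     (\<exists>S \<theta> T. S \<in> sets hausdorff2 \<and> countably_rectifiable2 S \<and>
        \<theta> \<in> borel_measurable hausdorff2 \<and> (\<forall>x\<in>S. \<theta> x > (0::real)) \<and>
        T \<in> borel_measurable hausdorff2 \<and>
        (let \<mu> = density hausdorff2 (\<lambda>x. ennreal (\<theta> x * indicator S x)) in
           (AE x in hausdorff2. x \<in> S \<longrightarrow>
              T x \<in> planes \<and> approx_tangent_plane \<mu> x (T x) (\<theta> x)) \<and>
           V = distr \<mu> borel (\<lambda>x. (x, T x))))"

section \<open>Area and strong stationarity\<close>

definition parallelogram_area :: "'a::real_inner \<Rightarrow> 'a \<Rightarrow> real" where
  "parallelogram_area u v = sqrt ((norm u)\<^sup>2 * (norm v)\<^sup>2 - (u \<bullet> v)\<^sup>2)"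

text \<open>The factor by which the linear map \<open>L\<close> changes area on the plane of \<open>P\<close>; the value does not
  depend on the orthonormal basis of the plane.\<close>

definition plane_jacobian :: "real^'n^'n \<Rightarrow> (real^'n \<Rightarrow> real^'n) \<Rightarrow> real" where
  "plane_jacobian P L =
     (THE a. \<exists>u v. norm u = 1 \<and> norm v = 1 \<and> u \<bullet> v = 0 \<and> span {u, v} = range ((*v) P) \<and>
        a = parallelogram_area (L u) (L v))"

text \<open>The mass of the push-forward of \<open>V\<close> under \<open>f\<close>.\<close>

definition image_area :: "('n::finite) varifold \<Rightarrow> (real^'n \<Rightarrow> real^'n) \<Rightarrow> real" where
  "image_area V f = (\<integral>(x, P). plane_jacobian P (frechet_derivative f (at x)) \<partial>V)"

text \<open>The area, counted with multiplicity, of the image under \<open>\<phi>\<close> of the product of \<open>{0..t}\<close> with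
  the curve.\<close>

definition swept_area :: "(real \<Rightarrow> real^'n) \<Rightarrow> (real \<times> (real^'n) \<Rightarrow> real^'n) \<Rightarrow> real \<Rightarrow> real" where
  "swept_area \<gamma> \<phi> t =
     integral {0..t} (\<lambda>s. integral {0..1} (\<lambda>\<tau>.
       parallelogram_area (vector_derivative (\<lambda>s'. \<phi> (s', \<gamma> \<tau>)) (at s))
                          (velocity (\<lambda>\<tau>'. \<phi> (s, \<gamma> \<tau>')) \<tau>)))"

text \<open>The derivative at \<open>0\<close> is the right derivative, since \<open>{0..t}\<close> is swept out for \<open>t \<ge> 0\<close>.
  For varifolds of bounded support and smooth arcs it always exists.\<close>

definition strongly_stationary :: "('n::finite) varifold \<Rightarrow> (real \<Rightarrow> real^'n) \<Rightarrow> bool" where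
  "strongly_stationary V \<gamma> \<longleftrightarrow>
     (\<forall>\<phi> :: real \<times> (real^'n) \<Rightarrow> real^'n. smooth \<phi> \<and> (\<forall>x. \<phi> (0, x) = x) \<longrightarrow>
        (\<exists>D\<ge>0. ((\<lambda>t. image_area V (\<lambda>x. \<phi> (t, x)) + swept_area \<gamma> \<phi> t)
                  has_real_derivative D) (at 0 within {0..})))"

end

theory Submission imports Defs begin

lemma C_k_SucI:
  assumes "\<And>x. (f has_derivative f' x) (at x)" "\<And>v. C_k k (\<lambda>x. f' x v)"
  shows "C_k (Suc k) f"
proof -
  have "frechet_derivative f (at x) = f' x" for x
    using assms(1) by (metis frechet_derivative_at)
  then show ?thesis using assms by (auto simp: differentiable_def)
qed

lemma C_k_SucD:
  assumes "C_k (Suc k) f"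
  shows "(f has_derivative frechet_derivative f (at x)) (at x)"
    and "C_k k (\<lambda>x. frechet_derivative f (at x) v)"
  using assms by (auto simp: frechet_derivative_works)

lemma C_k_Suc_imp: "C_k (Suc k) f \<Longrightarrow> C_k k f"
proof (induction k arbitrary: f)
  case 0
  then show ?case
    by (auto intro!: continuous_at_imp_continuous_on differentiable_imp_continuous_within)
next
  case (Suc k)
  then show ?case by (auto simp del: C_k.simps(1))
qed

lemma C_k_const: "C_k k (\<lambda>x. c)"
proof (induction k arbitrary: c)
  case (Suc k)
  show ?case by (rule C_k_SucI[where f'="\<lambda>x v. 0"]) (use Suc in auto)
qed auto

lemma C_k_bounded_linear: "bounded_linear f \<Longrightarrow> C_k k f"
proof (cases k)
  case (Suc k)
  assume "bounded_linear f"
  then show ?thesis unfolding Suc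
    by (intro C_k_SucI[where f'="\<lambda>x. f"]) (auto intro: bounded_linear_imp_has_derivative C_k_const)
qed (auto intro: linear_continuous_on)

lemma C_k_add: "C_k k f \<Longrightarrow> C_k k g \<Longrightarrow> C_k k (\<lambda>x. f x + g x)"
proof (induction k arbitrary: f g)
  case 0
  then show ?case by (auto intro: continuous_intros)
next
  case (Suc k)
  show ?case
    by (rule C_k_SucI[OF has_derivative_add[OF C_k_SucD(1)[OF Suc(2)] C_k_SucD(1)[OF Suc(3)]]])
       (intro Suc.IH C_k_SucD(2) Suc.prems)
qed

lemma C_k_bilinear:
  assumes "bounded_bilinear bop"
  shows "C_k k f \<Longrightarrow> C_k k g \<Longrightarrow> C_k k (\<lambda>x. bop (f x) (g x))"
proof (induction k arbitrary: f g)
  case 0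
  then show ?case by (auto intro: bounded_bilinear.continuous_on[OF assms])
next
  case (Suc k)
  show ?case
    by (rule C_k_SucI[OF bounded_bilinear.FDERIV[OF assms C_k_SucD(1)[OF Suc(2)] C_k_SucD(1)[OF Suc(3)]]])
       (intro C_k_add Suc.IH C_k_SucD(2) C_k_Suc_imp[OF Suc.prems(1)] C_k_Suc_imp[OF Suc.prems(2)] Suc.prems)
qed

lemma C_k_inverse:
  fixes f :: "'a::euclidean_space \<Rightarrow> real"
  assumes "\<And>x. f x \<noteq> 0"
  shows "C_k k f \<Longrightarrow> C_k k (\<lambda>x. inverse (f x))"
proof (induction k)
  case 0
  then show ?case using assms by (auto intro!: continuous_intros)
next
  case (Suc k)
  have d: "((\<lambda>x. inverse (f x)) has_derivative
        (\<lambda>h. (inverse (f x) * inverse (f x)) * (- 1 * frechet_derivative f (at x) h))) (at x)" for x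
    by (rule has_derivative_eq_rhs[OF Deriv.has_derivative_inverse[OF assms C_k_SucD(1)[OF Suc.prems]]])
       (auto simp: algebra_simps)
  show ?case
    by (rule C_k_SucI[OF d])
       (intro C_k_bilinear[OF bounded_bilinear_mult] Suc.IH C_k_SucD(2) C_k_Suc_imp[OF Suc.prems] Suc.prems C_k_const)
qed

lemma C_k_sqrt:
  fixes f :: "'a::euclidean_space \<Rightarrow> real"
  assumes "\<And>x. f x > 0"
  shows "C_k k f \<Longrightarrow> C_k k (\<lambda>x. sqrt (f x))"
proof (induction k)
  case 0
  then show ?case by (auto intro!: continuous_intros)
next
  case (Suc k)
  have d: "((\<lambda>x. sqrt (f x)) has_derivative
        (\<lambda>h. (1/2 * inverse (sqrt (f x))) * frechet_derivative f (at x) h)) (at x)" for x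
    by (rule has_derivative_eq_rhs[OF has_derivative_real_sqrt[OF assms C_k_SucD(1)[OF Suc.prems]]])
       (auto simp: field_simps)
  have "sqrt (f x) \<noteq> 0" for x using assms[of x] by simp
  then show ?case
    by (intro C_k_SucI[OF d])
       (intro C_k_bilinear[OF bounded_bilinear_mult] C_k_inverse Suc.IH C_k_SucD(2) C_k_Suc_imp[OF Suc.prems] Suc.prems C_k_const)
qed

lemma C_k_compose_linear:
  assumes L: "bounded_linear L"
  shows "C_k k f \<Longrightarrow> C_k k (\<lambda>x. f (L x))"
proof (induction k arbitrary: f)
  case 0
  then show ?case
    using linear_continuous_on[OF L] continuous_on_compose2[of UNIV f UNIV L] by auto
next
  case (Suc k)
  have d: "((\<lambda>x. f (L x)) has_derivative (\<lambda>h. frechet_derivative f (at (L x)) (L h))) (at x)" for x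
    by (rule has_derivative_compose[OF bounded_linear_imp_has_derivative[OF L] C_k_SucD(1)[OF Suc.prems]])
  show ?case
    by (rule C_k_SucI[OF d]) (intro Suc.IH C_k_SucD(2) Suc.prems)
qed

named_theorems smooth_intros

lemma smooth_const [smooth_intros]: "smooth (\<lambda>x. c)"
  by (simp add: smooth_def C_k_const)

lemma smooth_linear: "bounded_linear f \<Longrightarrow> smooth f"
  by (simp add: smooth_def C_k_bounded_linear)

lemma smooth_ident [smooth_intros]: "smooth (\<lambda>x. x)"
  by (simp add: smooth_linear bounded_linear_ident)

lemma smooth_add [smooth_intros]: "smooth f \<Longrightarrow> smooth g \<Longrightarrow> smooth (\<lambda>x. f x + g x)"
  by (simp add: smooth_def C_k_add)

lemma smooth_scaleR [smooth_intros]: "smooth f \<Longrightarrow> smooth g \<Longrightarrow> smooth (\<lambda>x. f x *\<^sub>R g x)"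
  by (simp add: smooth_def C_k_bilinear[OF bounded_bilinear_scaleR])

lemma smooth_mult [smooth_intros]:
  fixes f g :: "'a::euclidean_space \<Rightarrow> real"
  shows "smooth f \<Longrightarrow> smooth g \<Longrightarrow> smooth (\<lambda>x. f x * g x)"
  by (simp add: smooth_def C_k_bilinear[OF bounded_bilinear_mult])

lemma smooth_inner [smooth_intros]:
  fixes f g :: "'a::euclidean_space \<Rightarrow> 'b::euclidean_space"
  shows "smooth f \<Longrightarrow> smooth g \<Longrightarrow> smooth (\<lambda>x. f x \<bullet> g x)"
  by (simp add: smooth_def C_k_bilinear[OF bounded_bilinear_inner])

lemma smooth_minus [smooth_intros]: "smooth f \<Longrightarrow> smooth (\<lambda>x. - f x)"
  using smooth_scaleR[OF smooth_const[of "-1"], of f] by simp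

lemma smooth_diff [smooth_intros]: "smooth f \<Longrightarrow> smooth g \<Longrightarrow> smooth (\<lambda>x. f x - g x)"
  using smooth_add[of f "\<lambda>x. - g x"] smooth_minus[of g] by simp

lemma smooth_power [smooth_intros]:
  fixes f :: "'a::euclidean_space \<Rightarrow> real"
  shows "smooth f \<Longrightarrow> smooth (\<lambda>x. f x ^ n)"
  by (induction n) (auto intro: smooth_intros)

lemma smooth_norm_sq [smooth_intros]:
  fixes f :: "'a::euclidean_space \<Rightarrow> 'b::euclidean_space"
  shows "smooth f \<Longrightarrow> smooth (\<lambda>x. (norm (f x))\<^sup>2)"
  unfolding power2_norm_eq_inner by (intro smooth_intros)

lemma smooth_divide [smooth_intros]:
  fixes f g :: "'a::euclidean_space \<Rightarrow> real"
  shows "smooth f \<Longrightarrow> smooth g \<Longrightarrow> (\<And>x. g x \<noteq> 0) \<Longrightarrow> smooth (\<lambda>x. f x / g x)"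
  unfolding divide_inverse by (intro smooth_mult) (auto simp: smooth_def C_k_inverse)

lemma smooth_sqrt [smooth_intros]:
  fixes f :: "'a::euclidean_space \<Rightarrow> real"
  shows "smooth f \<Longrightarrow> (\<And>x. f x > 0) \<Longrightarrow> smooth (\<lambda>x. sqrt (f x))"
  by (simp add: smooth_def C_k_sqrt)

lemma smooth_sum [smooth_intros]:
  "(\<And>i. i \<in> I \<Longrightarrow> smooth (f i)) \<Longrightarrow> smooth (\<lambda>x. \<Sum>i\<in>I. f i x)"
  by (induction I rule: infinite_finite_induct) (auto intro: smooth_intros)

lemma smooth_compose_linear: "bounded_linear L \<Longrightarrow> smooth f \<Longrightarrow> smooth (\<lambda>x. f (L x))"
  by (simp add: smooth_def C_k_compose_linear)

lemma smooth_has_derivative: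
  "smooth f \<Longrightarrow> (f has_derivative frechet_derivative f (at x)) (at x)"
  unfolding smooth_def using C_k_SucD(1) by blast

lemma smooth_continuous: "smooth f \<Longrightarrow> continuous_on UNIV f"
  unfolding smooth_def by (metis C_k.simps(1))

lemma smooth_continuous_derivative:
  "smooth f \<Longrightarrow> continuous_on UNIV (\<lambda>x. frechet_derivative f (at x) v)"
  unfolding smooth_def using C_k_SucD(2)[of 0 f v] by (metis C_k.simps(1))

section \<open>planes\<close>

definition tangential_div :: "real^'n^'n \<Rightarrow> (real^'n \<Rightarrow> real^'n) \<Rightarrow> real" where
  "tangential_div P A = (\<Sum>b\<in>Basis. (P *v b) \<bullet> A b)"

lemma plane_frame:
  fixes P :: "real^'n^'n"
  assumes "P \<in> planes"
  obtains u v where "norm u = 1" "norm v = 1" "u \<bullet> v = 0" "span {u, v} = range ((*v) P)"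
    "\<And>h. P *v h = (u \<bullet> h) *\<^sub>R u + (v \<bullet> h) *\<^sub>R v"
proof -
  have tr: "transpose P = P" and id: "P ** P = P" and rk: "rank P = 2"
    using assms by (auto simp: planes_def)
  let ?S = "range ((*v) P)"
  have sub: "subspace ?S" by (simp add: linear_subspace_image)
  have dim: "dim ?S = 2" using rk by (simp add: rank_dim_range)
  obtain B where B: "B \<subseteq> ?S" "pairwise orthogonal B" "\<And>x. x \<in> B \<Longrightarrow> norm x = 1"
    "independent B" "card B = dim ?S" "span B = ?S"
    using orthonormal_basis_subspace[OF sub] by metis
  obtain u v where uv: "B = {u, v}" "u \<noteq> v" using B(5) dim card_2_iff by metis
  have n: "norm u = 1" "norm v = 1" using B(3) uv by auto
  have o: "u \<bullet> v = 0" using B(2) uv by (auto simp: pairwise_def orthogonal_def)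
  have fixp: "P *v w = w" if "w \<in> ?S" for w
    using that id by (auto simp: matrix_vector_mul_assoc)
  have sym: "w \<bullet> (P *v h) = (P *v w) \<bullet> h" for w h
    using dot_lmul_matrix[of w P h] tr by (metis vector_transpose_matrix transpose_transpose)
  have "P *v h = (u \<bullet> h) *\<^sub>R u + (v \<bullet> h) *\<^sub>R v" for h
  proof -
    have "P *v h \<in> span {u,v}" using B(6) uv by auto
    then obtain a b where ab: "P *v h = a *\<^sub>R u + b *\<^sub>R v"
      by (auto simp: span_breakdown_eq) (metis add_diff_cancel_left' diff_add_cancel diff_eq_eq)
    have "u \<bullet> h = u \<bullet> (P *v h)" "v \<bullet> h = v \<bullet> (P *v h)"
      using sym[of u h] sym[of v h] fixp[of u] fixp[of v] B(1) uv by auto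
    then have "u \<bullet> h = a" "v \<bullet> h = b"
      using n o by (auto simp: ab inner_add_right inner_commute[of v u] power2_norm_eq_inner[symmetric])
    then show ?thesis using ab by simp
  qed
  then show thesis using that n o B(6) uv by blast
qed

lemma tangential_div_frame:
  fixes A :: "real^'n \<Rightarrow> real^'n"
  assumes A: "linear A" and P: "\<And>h. P *v h = (u \<bullet> h) *\<^sub>R u + (v \<bullet> h) *\<^sub>R v"
  shows "tangential_div P A = u \<bullet> A u + v \<bullet> A v"
proof -
  have *: "(\<Sum>b\<in>Basis. (w \<bullet> b) * (w \<bullet> A b)) = w \<bullet> A w" for w
  proof -
    have "A w = (\<Sum>b\<in>Basis. (w \<bullet> b) *\<^sub>R A b)"
      by (subst euclidean_representation[of w, symmetric])
         (simp add: linear_sum[OF A] linear_scale[OF A] del: euclidean_representation)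
    then show ?thesis by (simp add: inner_sum_right)
  qed
  show ?thesis unfolding tangential_div_def P
    by (simp add: inner_add_left sum.distrib *)
qed

lemma tangential_div_add: "tangential_div P (\<lambda>h. A h + B h) = tangential_div P A + tangential_div P B"
  by (simp add: tangential_div_def inner_add_right sum.distrib)

lemma tangential_div_scaleR: "tangential_div P (\<lambda>h. c *\<^sub>R A h) = c * tangential_div P A"
  by (simp add: tangential_div_def sum_distrib_left)

lemma tangential_div_rank1: "tangential_div P (\<lambda>h. (w \<bullet> h) *\<^sub>R y) = w \<bullet> (P *v y)" if P: "P \<in> planes"
proof -
  obtain u v where *: "\<And>h. P *v h = (u \<bullet> h) *\<^sub>R u + (v \<bullet> h) *\<^sub>R v" using plane_frame[OF P] by metis
  have "linear (\<lambda>h. (w \<bullet> h) *\<^sub>R y)" by (intro linearI) (auto simp: algebra_simps)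
  from tangential_div_frame[OF this *] show ?thesis
    by (simp add: * inner_add_right inner_commute algebra_simps)
qed

lemma tangential_div_ident: "tangential_div P (\<lambda>h. h) = 2" if P: "P \<in> planes"
proof -
  obtain u v where uv: "norm u = 1" "norm v = 1" and *: "\<And>h. P *v h = (u \<bullet> h) *\<^sub>R u + (v \<bullet> h) *\<^sub>R v"
    using plane_frame[OF P] by metis
  from tangential_div_frame[OF linear_ident *] show ?thesis
    using uv by (simp add: power2_norm_eq_inner[symmetric])
qed

lemma plane_sym: "P \<in> planes \<Longrightarrow> w \<bullet> (P *v h) = (P *v w) \<bullet> h"
  by (erule plane_frame) (simp add: inner_add_left inner_add_right algebra_simps inner_commute)

lemma plane_idem: "P \<in> planes \<Longrightarrow> P *v (P *v h) = P *v h"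
  by (simp add: planes_def matrix_vector_mul_assoc)

lemma plane_perp_sq: "P \<in> planes \<Longrightarrow> (norm (y - P *v y))\<^sup>2 = (norm y)\<^sup>2 - y \<bullet> (P *v y)"
  using plane_sym[of P y "P *v y"] plane_idem[of P y]
  by (simp add: power2_norm_eq_inner inner_diff_left inner_diff_right inner_commute)

lemma plane_norm_le: "P \<in> planes \<Longrightarrow> norm (P *v y) \<le> norm y"
proof -
  assume P: "P \<in> planes"
  have "(norm (P *v y))\<^sup>2 = y \<bullet> (P *v y)"
    using plane_sym[OF P, of y "P *v y"] plane_idem[OF P, of y] by (simp add: power2_norm_eq_inner)
  also have "\<dots> \<le> (norm y)\<^sup>2" using plane_perp_sq[OF P, of y] by (metis diff_ge_0_iff_ge zero_le_power2)
  finally show ?thesis by (simp add: power2_le_iff_abs_le)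
qed

lemma plane_perp_le: "P \<in> planes \<Longrightarrow> norm (y - P *v y) \<le> norm y"
proof -
  assume P: "P \<in> planes"
  have "0 \<le> y \<bullet> (P *v y)"
    using plane_sym[OF P, of y "P *v y"] plane_idem[OF P, of y] by (metis inner_ge_zero)
  then have "(norm (y - P *v y))\<^sup>2 \<le> (norm y)\<^sup>2" using plane_perp_sq[OF P, of y] by simp
  then show ?thesis by (simp add: power2_le_iff_abs_le)
qed

lemma tangential_div_skew:
  assumes P: "P \<in> planes"
  shows "tangential_div P (\<lambda>h. (e \<bullet> h) *\<^sub>R q - (q \<bullet> h) *\<^sub>R e) = 0"
proof -
  have "tangential_div P (\<lambda>h. (e \<bullet> h) *\<^sub>R q - (q \<bullet> h) *\<^sub>R e)
      = tangential_div P (\<lambda>h. (e \<bullet> h) *\<^sub>R q) - tangential_div P (\<lambda>h. (q \<bullet> h) *\<^sub>R e)"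
    by (simp add: tangential_div_def inner_diff_right sum_subtractf)
  also have "\<dots> = 0"
    unfolding tangential_div_rank1[OF P] using plane_sym[OF P, of e q] by (simp add: inner_commute)
  finally show ?thesis .
qed

lemma parallelogram_area_sq_nonneg: "0 \<le> (norm u)\<^sup>2 * (norm v)\<^sup>2 - (u \<bullet> v)\<^sup>2"
  using Cauchy_Schwarz_ineq[of u v] by (simp add: power2_norm_eq_inner)

lemma parallelogram_area_le_half:
  "parallelogram_area u v \<le> ((norm u)\<^sup>2 + (norm v)\<^sup>2) / 2"
proof -
  have "sqrt ((norm u)\<^sup>2 * (norm v)\<^sup>2 - (u \<bullet> v)\<^sup>2) \<le> sqrt ((norm u * norm v)\<^sup>2)"
    by (intro real_sqrt_le_mono) (simp add: power_mult_distrib)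
  also have "\<dots> = norm u * norm v" by simp
  also have "\<dots> \<le> ((norm u)\<^sup>2 + (norm v)\<^sup>2) / 2"
    using sum_squares_bound[of "norm u" "norm v"] by simp
  finally show ?thesis by (simp add: parallelogram_area_def)
qed

lemma plane_jacobian_frame:
  fixes P :: "real^'n^'n"
  assumes P: "P \<in> planes" and L: "linear L"
  shows "\<exists>u v. norm u = 1 \<and> norm v = 1 \<and> u \<bullet> v = 0 \<and> (\<forall>h. P *v h = (u \<bullet> h) *\<^sub>R u + (v \<bullet> h) *\<^sub>R v) \<and>
     plane_jacobian P L = parallelogram_area (L u) (L v)"
proof -
  obtain u v where uv: "norm u = 1" "norm v = 1" "u \<bullet> v = 0" "span {u, v} = range ((*v) P)"
    and Ph: "\<And>h. P *v h = (u \<bullet> h) *\<^sub>R u + (v \<bullet> h) *\<^sub>R v" using plane_frame[OF P] by metis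
  have "plane_jacobian P L = parallelogram_area (L u) (L v)"
    unfolding plane_jacobian_def
  proof (rule the_equality)
    show "\<exists>u' v'. norm u' = 1 \<and> norm v' = 1 \<and> u' \<bullet> v' = 0 \<and> span {u', v'} = range ((*v) P) \<and>
        parallelogram_area (L u) (L v) = parallelogram_area (L u') (L v')"
      using uv by blast
  next
    fix r assume "\<exists>u' v'. norm u' = 1 \<and> norm v' = 1 \<and> u' \<bullet> v' = 0 \<and> span {u', v'} = range ((*v) P) \<and>
        r = parallelogram_area (L u') (L v')"
    then obtain u' v' where *: "norm u' = 1" "norm v' = 1" "u' \<bullet> v' = 0" "span {u', v'} = range ((*v) P)"
      and r: "r = parallelogram_area (L u') (L v')" by blast
    have fixp: "P *v w = w" if "w \<in> range ((*v) P)" for w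
      using that P plane_idem by blast
    have "u' \<in> range ((*v) P)" "v' \<in> range ((*v) P)"
      unfolding *(4)[symmetric] by (auto intro: span_base)
    then have u'0: "u' = P *v u'" and v'0: "v' = P *v v'" using fixp[symmetric] by blast+
    define a b c d where abcd: "a = u \<bullet> u'" "b = v \<bullet> u'" "c = u \<bullet> v'" "d = v \<bullet> v'"
    have u': "u' = a *\<^sub>R u + b *\<^sub>R v" and v': "v' = c *\<^sub>R u + d *\<^sub>R v"
      unfolding abcd by (rule trans[OF u'0 Ph], rule trans[OF v'0 Ph])
    have uu: "u \<bullet> u = 1" "v \<bullet> v = 1" "v \<bullet> u = 0"
      using uv by (auto simp: power2_norm_eq_inner[symmetric] inner_commute)
    have "u' \<bullet> u' = 1" "v' \<bullet> v' = 1" using * by (auto simp: power2_norm_eq_inner[symmetric])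
    then have e: "a\<^sup>2 + b\<^sup>2 = 1" "c\<^sup>2 + d\<^sup>2 = 1" "a * c + b * d = 0"
      using *(3) unfolding u' v' by (auto simp: inner_add_left inner_add_right uu uv power2_eq_square algebra_simps)
    have det: "(a * d - b * c)\<^sup>2 = 1"
    proof -
      have "(a * d - b * c)\<^sup>2 = (a\<^sup>2 + b\<^sup>2) * (c\<^sup>2 + d\<^sup>2) - (a * c + b * d)\<^sup>2"
        by (simp add: power2_eq_square algebra_simps)
      then show ?thesis using e by simp
    qed
    have Lu: "L u' = a *\<^sub>R L u + b *\<^sub>R L v" "L v' = c *\<^sub>R L u + d *\<^sub>R L v"
      unfolding u' v' by (simp_all add: linear_add[OF L] linear_scale[OF L])
    have "(norm (L u'))\<^sup>2 * (norm (L v'))\<^sup>2 - (L u' \<bullet> L v')\<^sup>2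
        = (a * d - b * c)\<^sup>2 * ((norm (L u))\<^sup>2 * (norm (L v))\<^sup>2 - (L u \<bullet> L v)\<^sup>2)"
      unfolding Lu power2_norm_eq_inner
      by (simp add: inner_add_left inner_add_right inner_commute[of "L v" "L u"] power2_eq_square algebra_simps)
    then show "r = parallelogram_area (L u) (L v)" by (simp add: r parallelogram_area_def det)
  qed
  then show ?thesis using uv Ph by blast
qed

lemma parallelogram_area_commute: "parallelogram_area u v = parallelogram_area v u"
  by (simp add: parallelogram_area_def inner_commute mult.commute)

lemma parallelogram_area_le:
  "parallelogram_area u v \<le> norm (u - c *\<^sub>R v) * norm v"
proof -
  have "(norm u)\<^sup>2 * (norm v)\<^sup>2 - (u \<bullet> v)\<^sup>2
      = (norm (u - c *\<^sub>R v))\<^sup>2 * (norm v)\<^sup>2 - ((u - c *\<^sub>R v) \<bullet> v)\<^sup>2"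
    unfolding power2_norm_eq_inner
    by (simp add: inner_diff_left inner_diff_right inner_commute[of v u] power2_eq_square algebra_simps)
  also have "\<dots> \<le> (norm (u - c *\<^sub>R v) * norm v)\<^sup>2" by (simp add: power_mult_distrib)
  finally have "parallelogram_area u v \<le> sqrt ((norm (u - c *\<^sub>R v) * norm v)\<^sup>2)"
    unfolding parallelogram_area_def by (rule real_sqrt_le_mono)
  then show ?thesis by simp
qed

lemma parallelogram_area_attained:
  obtains c where "parallelogram_area u v = norm (u - c *\<^sub>R v) * norm v"
proof (cases "v = 0")
  case True
  then have "parallelogram_area u v = norm (u - 0 *\<^sub>R v) * norm v" by (simp add: parallelogram_area_def)
  then show ?thesis using that by blast
next
  case False
  define c where "c = (u \<bullet> v) / (v \<bullet> v)"
  have "v \<bullet> v \<noteq> 0" using False by simp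
  then have *: "(u - c *\<^sub>R v) \<bullet> v = 0" by (simp add: c_def inner_diff_left)
  have "(norm u)\<^sup>2 * (norm v)\<^sup>2 - (u \<bullet> v)\<^sup>2
      = (norm (u - c *\<^sub>R v))\<^sup>2 * (norm v)\<^sup>2 - ((u - c *\<^sub>R v) \<bullet> v)\<^sup>2"
    unfolding power2_norm_eq_inner
    by (simp add: inner_diff_left inner_diff_right inner_commute[of v u] power2_eq_square algebra_simps)
  also have "\<dots> = (norm (u - c *\<^sub>R v) * norm v)\<^sup>2" by (simp add: power_mult_distrib *)
  finally have "parallelogram_area u v = norm (u - c *\<^sub>R v) * norm v"
    unfolding parallelogram_area_def by simp
  then show ?thesis using that by blast
qed

lemma parallelogram_area_le_norm: "parallelogram_area u v \<le> norm u * norm v"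
  using parallelogram_area_le[of u v 0] by simp

lemma parallelogram_area_nonneg [simp]: "0 \<le> parallelogram_area u v"
  using parallelogram_area_sq_nonneg by (simp add: parallelogram_area_def)

lemma parallelogram_area_add_left:
  "parallelogram_area (u + w) v \<le> parallelogram_area u v + parallelogram_area w v"
proof -
  obtain c d where c: "parallelogram_area u v = norm (u - c *\<^sub>R v) * norm v"
    and d: "parallelogram_area w v = norm (w - d *\<^sub>R v) * norm v"
    using parallelogram_area_attained by metis
  have "parallelogram_area (u + w) v \<le> norm ((u + w) - (c + d) *\<^sub>R v) * norm v"
    by (rule parallelogram_area_le)
  also have "(u + w) - (c + d) *\<^sub>R v = (u - c *\<^sub>R v) + (w - d *\<^sub>R v)" by (simp add: algebra_simps)
  also have "norm \<dots> * norm v \<le> (norm (u - c *\<^sub>R v) + norm (w - d *\<^sub>R v)) * norm v"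
    by (intro mult_right_mono norm_triangle_ineq) simp
  finally show ?thesis by (simp add: c d algebra_simps)
qed

lemma parallelogram_area_scale_left: "parallelogram_area (c *\<^sub>R u) v = \<bar>c\<bar> * parallelogram_area u v"
proof -
  have "(norm (c *\<^sub>R u))\<^sup>2 * (norm v)\<^sup>2 - ((c *\<^sub>R u) \<bullet> v)\<^sup>2 = c\<^sup>2 * ((norm u)\<^sup>2 * (norm v)\<^sup>2 - (u \<bullet> v)\<^sup>2)"
    by (simp add: power_mult_distrib algebra_simps)
  then show ?thesis by (simp add: parallelogram_area_def real_sqrt_mult)
qed

lemma continuous_on_parallelogram_area [continuous_intros]:
  "continuous_on S f \<Longrightarrow> continuous_on S g \<Longrightarrow> continuous_on S (\<lambda>x. parallelogram_area (f x) (g x))"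
  unfolding parallelogram_area_def by (intro continuous_intros)

lemma integral_le_nonneg:
  fixes f g :: "'a::euclidean_space \<Rightarrow> real"
  assumes "g integrable_on S" "\<And>x. x \<in> S \<Longrightarrow> f x \<le> g x" "\<And>x. x \<in> S \<Longrightarrow> 0 \<le> g x"
  shows "integral S f \<le> integral S g"
proof (cases "f integrable_on S")
  case True
  then show ?thesis using assms by (intro integral_le) auto
next
  case False
  then show ?thesis using assms by (simp add: not_integrable_integral integral_nonneg)
qed

lemma continuous_on_mult_vec [continuous_intros]:
  fixes f :: "'a::topological_space \<Rightarrow> real^'n^'m"
  assumes "continuous_on S f" "continuous_on S g"
  shows "continuous_on S (\<lambda>x. f x *v g x)"
proof -
  have "bounded_bilinear (\<lambda>(P::real^'n^'m) x. P *v x)"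
    by (simp add: bilinear_conv_bounded_bilinear[symmetric] bilinear_def linear_iff
        matrix_vector_mult_add_rdistrib matrix_vector_right_distrib
        scaleR_matrix_vector_assoc matrix_vector_mult_scaleR)
  from bounded_bilinear.continuous_on[OF this assms] show ?thesis .
qed

lemma smooth_derivative_bound:
  fixes X :: "'a::euclidean_space \<Rightarrow> 'b::euclidean_space"
  assumes "smooth X" "compact S"
  obtains K where "K > 0" "\<And>x h. x \<in> S \<Longrightarrow> norm (frechet_derivative X (at x) h) \<le> K * norm h"
proof -
  have "\<exists>K. \<forall>x\<in>S. norm (frechet_derivative X (at x) b) \<le> K" for b
  proof -
    have "compact ((\<lambda>x. frechet_derivative X (at x) b) ` S)"
      by (intro compact_continuous_image continuous_on_subset[OF smooth_continuous_derivative[OF assms(1)]] assms(2)) auto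
    then have "bounded ((\<lambda>x. frechet_derivative X (at x) b) ` S)" by (rule compact_imp_bounded)
    then show ?thesis by (auto simp: bounded_iff)
  qed
  then obtain K where K: "\<And>b x. x \<in> S \<Longrightarrow> norm (frechet_derivative X (at x) b) \<le> K b" by metis
  define C where "C = (\<Sum>b\<in>(Basis::'a set). \<bar>K b\<bar>) + 1"
  have "norm (frechet_derivative X (at x) h) \<le> C * norm h" if x: "x \<in> S" for x h
  proof -
    have lin: "linear (frechet_derivative X (at x))"
      using smooth_has_derivative[OF assms(1)] has_derivative_linear by blast
    have "frechet_derivative X (at x) h = (\<Sum>b\<in>Basis. (h \<bullet> b) *\<^sub>R frechet_derivative X (at x) b)"
      by (subst euclidean_representation[of h, symmetric])
         (simp add: linear_sum[OF lin] linear_scale[OF lin] del: euclidean_representation)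
    also have "norm \<dots> \<le> (\<Sum>b\<in>Basis. norm h * \<bar>K b\<bar>)"
    proof (rule order_trans[OF norm_sum sum_mono])
      fix b :: 'a assume "b \<in> Basis"
      then show "norm ((h \<bullet> b) *\<^sub>R frechet_derivative X (at x) b) \<le> norm h * \<bar>K b\<bar>"
        using K[OF x, of b] Basis_le_norm[of b h] by (auto intro!: mult_mono)
    qed
    also have "\<dots> \<le> C * norm h" by (simp add: C_def sum_distrib_left[symmetric] algebra_simps)
    finally show ?thesis .
  qed
  moreover have "C > 0" unfolding C_def by (intro add_nonneg_pos sum_nonneg) auto
  ultimately show thesis using that by blast
qed

lemma measurable_tangential_div:
  fixes V :: "'n::finite varifold"
  assumes "sets V = sets borel" "smooth X"
  shows "(\<lambda>z. tangential_div (snd z) (frechet_derivative X (at (fst z)))) \<in> borel_measurable V"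
proof -
  have "continuous_on UNIV (\<lambda>z::(real^'n) \<times> (real^'n^'n). frechet_derivative X (at (fst z)) b)" for b
    by (rule continuous_on_compose2[OF smooth_continuous_derivative[OF assms(2)]]) (auto intro: continuous_intros)
  then have "continuous_on UNIV (\<lambda>z::(real^'n) \<times> (real^'n^'n). tangential_div (snd z) (frechet_derivative X (at (fst z))))"
    unfolding tangential_div_def by (intro continuous_intros)
  then show ?thesis
    by (simp add: borel_measurable_continuous_onI measurable_cong_sets[OF assms(1) refl])
qed

lemma tangential_div_bound:
  assumes P: "P \<in> planes" and A: "linear A" and K: "\<And>h. norm (A h) \<le> K * norm h"
  shows "\<bar>tangential_div P A\<bar> \<le> 2 * K"
proof -
  obtain u v where uv: "norm u = 1" "norm v = 1" and *: "\<And>h. P *v h = (u \<bullet> h) *\<^sub>R u + (v \<bullet> h) *\<^sub>R v"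
    using plane_frame[OF P] by metis
  have "\<bar>u \<bullet> A u\<bar> \<le> K" "\<bar>v \<bullet> A v\<bar> \<le> K"
    using Cauchy_Schwarz_ineq2[of u "A u"] Cauchy_Schwarz_ineq2[of v "A v"] K[of u] K[of v] uv by auto
  then show ?thesis using tangential_div_frame[OF A *] by linarith
qed

lemma plane_jacobian_bound:
  fixes P :: "real^'n^'n"
  assumes P: "P \<in> planes" and A: "linear A" and K: "\<And>h. norm (A h) \<le> K * norm h"
  shows "plane_jacobian P (\<lambda>h. h + t *\<^sub>R A h) \<le> 1 + t * tangential_div P A + K\<^sup>2 * t\<^sup>2"
proof -
  have L: "linear (\<lambda>h. h + t *\<^sub>R A h)"
    by (intro linearI) (simp_all add: linear_add[OF A] linear_scale[OF A] algebra_simps)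
  obtain u v where uv: "norm u = 1" "norm v = 1" and *: "\<And>h. P *v h = (u \<bullet> h) *\<^sub>R u + (v \<bullet> h) *\<^sub>R v"
    and J: "plane_jacobian P (\<lambda>h. h + t *\<^sub>R A h) = parallelogram_area (u + t *\<^sub>R A u) (v + t *\<^sub>R A v)"
    using plane_jacobian_frame[OF P L] by metis
  have sq: "(norm (w + t *\<^sub>R A w))\<^sup>2 \<le> 1 + 2 * t * (w \<bullet> A w) + K\<^sup>2 * t\<^sup>2" if "norm w = 1" for w
  proof -
    have "(norm (w + t *\<^sub>R A w))\<^sup>2 = (norm w)\<^sup>2 + 2 * t * (w \<bullet> A w) + t\<^sup>2 * (norm (A w))\<^sup>2"
      unfolding power2_norm_eq_inner
      by (simp add: inner_add_left inner_add_right inner_commute[of "A w" w] power2_eq_square algebra_simps)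
    moreover have "(norm (A w))\<^sup>2 \<le> K\<^sup>2" using K[of w] that by (intro power_mono) auto
    then have "t\<^sup>2 * (norm (A w))\<^sup>2 \<le> t\<^sup>2 * K\<^sup>2" by (intro mult_left_mono) auto
    ultimately show ?thesis using that by (simp add: mult.commute)
  qed
  have "plane_jacobian P (\<lambda>h. h + t *\<^sub>R A h) \<le> ((norm (u + t *\<^sub>R A u))\<^sup>2 + (norm (v + t *\<^sub>R A v))\<^sup>2) / 2"
    unfolding J by (rule parallelogram_area_le_half)
  also have "\<dots> \<le> 1 + t * (u \<bullet> A u + v \<bullet> A v) + K\<^sup>2 * t\<^sup>2"
    using sq[OF uv(1)] sq[OF uv(2)] by (simp add: algebra_simps)
  finally show ?thesis using tangential_div_frame[OF A *] by simp
qed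

lemma plane_jacobian_ident:
  assumes P: "P \<in> planes"
  shows "plane_jacobian P (\<lambda>h. h) = 1"
proof -
  have *: "parallelogram_area u v = 1" if "norm u = 1" "norm v = 1" "u \<bullet> v = 0" for u v :: "real^'n"
    using that by (simp add: parallelogram_area_def)
  show ?thesis
    using plane_jacobian_frame[OF P linear_ident] * by (elim exE conjE) (simp add: *)
qed

text \<open>x\<close>

definition plane_like :: "(real^'n^'n) set" where
  "plane_like = {P. \<exists>u v. norm u = 1 \<and> norm v = 1 \<and> u \<bullet> v = 0 \<and> span {u, v} = range ((*v) P)}"

lemma plane_like_iff:
  fixes P :: "real^'n^'n"
  shows "P \<in> plane_like \<longleftrightarrow>
    (\<exists>z\<in>{z. norm (fst z) = 1 \<and> norm (snd z) = 1 \<and> fst z \<bullet> snd z = 0}.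
        \<forall>h. P *v h = (fst z \<bullet> (P *v h)) *\<^sub>R fst z + (snd z \<bullet> (P *v h)) *\<^sub>R snd z) \<and>
    \<not> (\<exists>w\<in>sphere 0 1. \<forall>h. P *v h = (w \<bullet> (P *v h)) *\<^sub>R w)" (is "_ \<longleftrightarrow> ?A \<and> \<not> ?B")
proof
  assume "P \<in> plane_like"
  then obtain u v where uv: "norm u = 1" "norm v = 1" "u \<bullet> v = 0" "span {u, v} = range ((*v) P)"
    by (auto simp: plane_like_def)
  have uu: "u \<bullet> u = 1" "v \<bullet> v = 1" "v \<bullet> u = 0"
    using uv by (auto simp: power2_norm_eq_inner[symmetric] inner_commute)
  have "w = (u \<bullet> w) *\<^sub>R u + (v \<bullet> w) *\<^sub>R v" if w: "w \<in> span {u, v}" for w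
  proof -
    obtain a where "w - a *\<^sub>R u \<in> span {v}" using w by (metis span_breakdown_eq)
    then obtain b where "w - a *\<^sub>R u = b *\<^sub>R v" by (auto simp: span_singleton)
    then have "w = a *\<^sub>R u + b *\<^sub>R v" by (simp add: algebra_simps)
    then show ?thesis using uv(3) uu by (simp add: inner_add_right)
  qed
  then have 1: ?A using uv by (intro bexI[of _ "(u, v)"]) auto
  have 2: "\<not> ?B"
  proof
    assume ?B
    then obtain w where w: "\<And>h. P *v h = (w \<bullet> (P *v h)) *\<^sub>R w" by blast
    have "u \<in> range ((*v) P)" "v \<in> range ((*v) P)" using uv(4) by (auto intro: span_base)
    then have "u = (w \<bullet> u) *\<^sub>R w" "v = (w \<bullet> v) *\<^sub>R w" using w by auto
    then obtain a b where ab: "u = a *\<^sub>R w" "v = b *\<^sub>R w" by blast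
    have "u \<bullet> v = a * b * (w \<bullet> w)" by (simp add: ab)
    moreover have "a \<noteq> 0" "b \<noteq> 0" "w \<noteq> 0" using uv(1,2) ab by auto
    ultimately show False using uv(3) by simp
  qed
  show "?A \<and> \<not> ?B" using 1 2 by blast
next
  assume *: "?A \<and> \<not> ?B"
  then obtain u v where uv: "norm u = 1" "norm v = 1" "u \<bullet> v = 0"
    and Ph: "\<And>h. P *v h = (u \<bullet> (P *v h)) *\<^sub>R u + (v \<bullet> (P *v h)) *\<^sub>R v" by auto
  let ?S = "range ((*v) P)"
  have sub: "subspace ?S" by (simp add: linear_subspace_image)
  have "P *v h \<in> span {u, v}" for h
    by (subst Ph) (intro span_add span_scale span_base; simp)
  then have le: "?S \<subseteq> span {u, v}" by auto
  obtain B where B: "B \<subseteq> ?S" "pairwise orthogonal B" "\<And>x. x \<in> B \<Longrightarrow> norm x = 1"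
    "independent B" "card B = dim ?S" "span B = ?S"
    using orthonormal_basis_subspace[OF sub] by metis
  have "dim (span {u, v}) \<le> dim ?S"
  proof (rule ccontr)
    assume "\<not> ?thesis"
    moreover have "dim (span {u, v}) \<le> 2"
      using dim_le_card'[of "{u,v}"] card_insert_le_m1[of 2 "{v}" u] by (simp add: card_insert_if split: if_splits)
    ultimately have "card B \<le> 1" using B(5) by simp
    then obtain w where "B \<subseteq> {w}" "norm w = 1"
      using B(3,4) uv(1) by (metis card_1_singletonE card_0_eq empty_subsetI independent_imp_finite insertI1 le_neq_implies_less less_one subset_refl)
    then have "?S \<subseteq> span {w}" using B(6) span_mono by metis
    then have "P *v h = (w \<bullet> (P *v h)) *\<^sub>R w" for h
    proof -
      obtain k where "P *v h = k *\<^sub>R w" using \<open>?S \<subseteq> span {w}\<close> by (auto simp: span_singleton)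
      then show ?thesis using \<open>norm w = 1\<close> by (simp add: power2_norm_eq_inner[symmetric])
    qed
    then have ?B using \<open>norm w = 1\<close> by (intro bexI[of _ w]) auto
    then show False using * by blast
  qed
  then have "?S = span {u, v}" using subspace_dim_equal[OF sub subspace_span le] by blast
  then show "P \<in> plane_like" using uv by (auto simp: plane_like_def)
qed

lemma borel_plane_like: "(plane_like :: (real^'n^'n) set) \<in> sets borel"
proof -
  have O: "compact {z::(real^'n) \<times> (real^'n). norm (fst z) = 1 \<and> norm (snd z) = 1 \<and> fst z \<bullet> snd z = 0}" (is "compact ?O")
    unfolding compact_eq_bounded_closed
  proof
    show "closed ?O"
      by (intro closed_Collect_conj closed_Collect_eq continuous_intros)
    have "?O \<subseteq> cball 0 1 \<times> cball 0 1" by auto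
    then show "bounded ?O" by (rule bounded_subset[OF bounded_Times[OF bounded_cball bounded_cball]])
  qed
  have "closed {P::real^'n^'n. \<exists>z\<in>?O. \<forall>h. P *v h = (fst z \<bullet> (P *v h)) *\<^sub>R fst z + (snd z \<bullet> (P *v h)) *\<^sub>R snd z}"
    using closed_compact_projection[OF O, of "{x. \<forall>h. snd x *v h = (fst (fst x) \<bullet> (snd x *v h)) *\<^sub>R fst (fst x)
        + (snd (fst x) \<bullet> (snd x *v h)) *\<^sub>R snd (fst x)}"]
    by (simp add: Bex_def closed_Collect_all closed_Collect_eq continuous_intros)
  moreover have "closed {P::real^'n^'n. \<exists>w\<in>sphere 0 1. \<forall>h. P *v h = (w \<bullet> (P *v h)) *\<^sub>R w}"
    using closed_compact_projection[OF compact_sphere[of "0::real^'n" 1],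
        of "{x. \<forall>h. snd x *v h = (fst x \<bullet> (snd x *v h)) *\<^sub>R fst x}"]
    by (simp add: Bex_def closed_Collect_all closed_Collect_eq continuous_intros)
  ultimately have "{P::real^'n^'n. \<exists>z\<in>?O. \<forall>h. P *v h = (fst z \<bullet> (P *v h)) *\<^sub>R fst z + (snd z \<bullet> (P *v h)) *\<^sub>R snd z} -
     {P. \<exists>w\<in>sphere 0 1. \<forall>h. P *v h = (w \<bullet> (P *v h)) *\<^sub>R w} \<in> sets borel"
    by (intro sets.Diff borel_closed)
  moreover have "plane_like = {P::real^'n^'n. \<exists>z\<in>?O. \<forall>h. P *v h = (fst z \<bullet> (P *v h)) *\<^sub>R fst z + (snd z \<bullet> (P *v h)) *\<^sub>R snd z} -
     {P. \<exists>w\<in>sphere 0 1. \<forall>h. P *v h = (w \<bullet> (P *v h)) *\<^sub>R w}"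
    unfolding set_eq_iff plane_like_iff by blast
  ultimately show ?thesis by simp
qed

lemma measurable_plane_jacobian_ident:
  "(\<lambda>P::real^'n^'n. plane_jacobian P (\<lambda>h. h)) \<in> borel_measurable borel"
proof -
  have "plane_jacobian P (\<lambda>h. h) = (if P \<in> plane_like then 1 else (THE a::real. False))" for P :: "real^'n^'n"
  proof (cases "P \<in> plane_like")
    case True
    have 1: "parallelogram_area u v = 1" if "norm u = 1" "norm v = 1" "u \<bullet> v = 0" for u v :: "real^'n"
      using that by (simp add: parallelogram_area_def)
    have "plane_jacobian P (\<lambda>h. h) = 1"
      unfolding plane_jacobian_def
    proof (rule the_equality)
      show "\<exists>u v. norm u = 1 \<and> norm v = 1 \<and> u \<bullet> v = 0 \<and> span {u, v} = range ((*v) P) \<and> 1 = parallelogram_area u v"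
        using True 1 unfolding plane_like_def mem_Collect_eq by metis
    qed (use 1 in auto)
    then show ?thesis using True by simp
  next
    case False
    then have "(\<lambda>a. \<exists>u v. norm u = 1 \<and> norm v = 1 \<and> u \<bullet> v = 0 \<and> span {u, v} = range ((*v) P) \<and>
        a = parallelogram_area u v) = (\<lambda>a::real. False)"
      by (auto simp: plane_like_def)
    then show ?thesis using False unfolding plane_jacobian_def by simp
  qed
  then show ?thesis using borel_plane_like by (auto intro!: measurable_If_set)
qed

lemma swept_area_bound:
  fixes \<gamma> :: "real \<Rightarrow> real^'n"
  assumes X: "smooth X"
    and c: "\<And>\<tau>. \<tau> \<in> {0..1} \<Longrightarrow> (\<gamma> has_vector_derivative c \<tau>) (at \<tau> within {0..1})"
    and cont: "continuous_on {0..1} c"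
  obtains K where "K \<ge> 0" "\<And>t. 0 \<le> t \<Longrightarrow> swept_area \<gamma> (\<lambda>z. snd z + fst z *\<^sub>R X (snd z)) t
    \<le> t * integral {0..1} (\<lambda>\<tau>. parallelogram_area (X (\<gamma> \<tau>)) (c \<tau>)) + K * t\<^sup>2"
proof -
  have g: "continuous_on {0..1} \<gamma>"
    using c by (meson continuous_on_eq_continuous_within has_vector_derivative_continuous)
  have Xg: "continuous_on {0..1} (\<lambda>\<tau>. X (\<gamma> \<tau>))"
    by (rule continuous_on_compose2[OF smooth_continuous[OF X] g]) auto
  obtain K0 where K0: "K0 > 0" "\<And>x h. x \<in> \<gamma> ` {0..1} \<Longrightarrow> norm (frechet_derivative X (at x) h) \<le> K0 * norm h"
    using smooth_derivative_bound[OF X compact_continuous_image[OF g]] by auto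
  obtain K1 where K1: "\<And>\<tau>. \<tau> \<in> {0..1} \<Longrightarrow> norm (X (\<gamma> \<tau>)) \<le> K1"
    using compact_imp_bounded[OF compact_continuous_image[OF Xg]] unfolding bounded_iff by (metis compact_Icc imageI)
  obtain K2 where K2: "\<And>\<tau>. \<tau> \<in> {0..1} \<Longrightarrow> norm (c \<tau>) \<le> K2"
    using compact_imp_bounded[OF compact_continuous_image[OF cont]] unfolding bounded_iff by (metis compact_Icc imageI)
  define K where "K = K1 * (K0 * K2)"
  have "0 \<le> K1" "0 \<le> K2" using order_trans[OF norm_ge_zero K1[of 0]] order_trans[OF norm_ge_zero K2[of 0]] by auto
  then have K: "K \<ge> 0" using K0(1) by (simp add: K_def)
  let ?f = "\<lambda>\<tau>. parallelogram_area (X (\<gamma> \<tau>)) (c \<tau>)"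
  let ?\<phi> = "\<lambda>z. snd z + fst z *\<^sub>R X (snd z)"
  have fint: "?f integrable_on {0..1}" by (intro integrable_continuous_interval continuous_intros Xg cont)
  have inner: "integral {0..1} (\<lambda>\<tau>. parallelogram_area (vector_derivative (\<lambda>s'. ?\<phi> (s', \<gamma> \<tau>)) (at s))
                          (velocity (\<lambda>\<tau>'. ?\<phi> (s, \<gamma> \<tau>')) \<tau>)) \<le> integral {0..1} ?f + K * s" if s: "0 \<le> s" for s
  proof -
    have "integral {0..1} (\<lambda>\<tau>. parallelogram_area (vector_derivative (\<lambda>s'. ?\<phi> (s', \<gamma> \<tau>)) (at s))
                          (velocity (\<lambda>\<tau>'. ?\<phi> (s, \<gamma> \<tau>')) \<tau>)) \<le> integral {0..1} (\<lambda>\<tau>. ?f \<tau> + K * s)"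
    proof (rule integral_le_nonneg)
      show "(\<lambda>\<tau>. ?f \<tau> + K * s) integrable_on {0..1}"
        by (intro integrable_continuous_interval continuous_intros Xg cont)
      fix \<tau> :: real assume \<tau>: "\<tau> \<in> {0..1}"
      show "0 \<le> ?f \<tau> + K * s" using K s by simp
      have v1: "vector_derivative (\<lambda>s'. ?\<phi> (s', \<gamma> \<tau>)) (at s) = X (\<gamma> \<tau>)"
        by (rule vector_derivative_at) (auto intro!: derivative_eq_intros)
      have "((\<lambda>\<tau>'. X (\<gamma> \<tau>')) has_vector_derivative frechet_derivative X (at (\<gamma> \<tau>)) (c \<tau>)) (at \<tau> within {0..1})"
        using vector_derivative_diff_chain_within[OF c[OF \<tau>], of X "frechet_derivative X (at (\<gamma> \<tau>))"]
          has_derivative_at_withinI[OF smooth_has_derivative[OF X, of "\<gamma> \<tau>"]] by (simp add: o_def)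
      then have "((\<lambda>\<tau>'. ?\<phi> (s, \<gamma> \<tau>')) has_vector_derivative
          (c \<tau> + s *\<^sub>R frechet_derivative X (at (\<gamma> \<tau>)) (c \<tau>))) (at \<tau> within {0..1})"
        using c[OF \<tau>] by (auto intro!: derivative_eq_intros)
      then have v2: "velocity (\<lambda>\<tau>'. ?\<phi> (s, \<gamma> \<tau>')) \<tau> = c \<tau> + s *\<^sub>R frechet_derivative X (at (\<gamma> \<tau>)) (c \<tau>)"
        unfolding velocity_def using \<tau> by (intro vector_derivative_within_cbox[of 0 1, simplified]) auto
      let ?w = "s *\<^sub>R frechet_derivative X (at (\<gamma> \<tau>)) (c \<tau>)"
      have "norm (frechet_derivative X (at (\<gamma> \<tau>)) (c \<tau>)) \<le> K0 * norm (c \<tau>)" using K0(2) \<tau> by blast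
      also have "\<dots> \<le> K0 * K2" using K0(1) K2[OF \<tau>] by simp
      finally have w: "norm ?w \<le> s * (K0 * K2)" using s by (simp add: mult_left_mono)
      have "parallelogram_area (X (\<gamma> \<tau>)) (c \<tau> + ?w) \<le> ?f \<tau> + parallelogram_area ?w (X (\<gamma> \<tau>))"
        using parallelogram_area_add_left[of "c \<tau>" ?w "X (\<gamma> \<tau>)"] by (simp add: parallelogram_area_commute)
      also have "parallelogram_area ?w (X (\<gamma> \<tau>)) \<le> (s * (K0 * K2)) * K1"
        using parallelogram_area_le_norm[of ?w "X (\<gamma> \<tau>)"] mult_mono[OF w K1[OF \<tau>]] s K0 \<open>0 \<le> K2\<close> by simp
      finally show "parallelogram_area (vector_derivative (\<lambda>s'. ?\<phi> (s', \<gamma> \<tau>)) (at s))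
          (velocity (\<lambda>\<tau>'. ?\<phi> (s, \<gamma> \<tau>')) \<tau>) \<le> ?f \<tau> + K * s"
        unfolding v1 v2 by (simp add: K_def algebra_simps)
    qed
    also have "\<dots> = integral {0..1} ?f + K * s"
      by (subst Henstock_Kurzweil_Integration.integral_add[OF fint]) auto
    finally show ?thesis .
  qed
  have B: "0 \<le> integral {0..1} ?f" by (intro integral_nonneg fint) auto
  have "swept_area \<gamma> ?\<phi> t \<le> t * integral {0..1} ?f + K * t\<^sup>2" if t: "0 \<le> t" for t
  proof -
    have "swept_area \<gamma> ?\<phi> t \<le> integral {0..t} (\<lambda>s. integral {0..1} ?f + K * t)"
      unfolding swept_area_def
    proof (rule integral_le_nonneg)
      fix s assume s: "s \<in> {0..t}"
      then have "K * s \<le> K * t" using K by (simp add: mult_left_mono)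
      then show "integral {0..1} (\<lambda>\<tau>. parallelogram_area (vector_derivative (\<lambda>s'. ?\<phi> (s', \<gamma> \<tau>)) (at s))
                          (velocity (\<lambda>\<tau>'. ?\<phi> (s, \<gamma> \<tau>')) \<tau>)) \<le> integral {0..1} ?f + K * t"
        using inner[of s] s by auto
    qed (use B K t in auto)
    also have "\<dots> = t * integral {0..1} ?f + K * t\<^sup>2" using t by (simp add: power2_eq_square algebra_simps)
    finally show ?thesis .
  qed
  then show thesis using that K by blast
qed

lemma first_variation_nonneg:
  fixes V :: "'n::finite varifold" and \<gamma> :: "real \<Rightarrow> real^'n"
  assumes fin: "finite_measure V" and sets: "sets V = sets borel"
    and pl: "AE z in V. snd z \<in> planes" and bd: "AE z in V. norm (fst z) \<le> R"
    and pos: "measure V UNIV > 0"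
    and c: "\<And>\<tau>. \<tau> \<in> {0..1} \<Longrightarrow> (\<gamma> has_vector_derivative c \<tau>) (at \<tau> within {0..1})"
    and cont: "continuous_on {0..1} c"
    and st: "strongly_stationary V \<gamma>" and X: "smooth X"
  shows "0 \<le> (\<integral>z. tangential_div (snd z) (frechet_derivative X (at (fst z))) \<partial>V)
     + integral {0..1} (\<lambda>\<tau>. parallelogram_area (X (\<gamma> \<tau>)) (c \<tau>))"
proof -
  interpret finite_measure V by (rule fin)
  have space: "space V = UNIV" using sets_eq_imp_space_eq[OF sets] by simp
  let ?\<phi> = "\<lambda>z. snd z + fst z *\<^sub>R X (snd z)"
  let ?D = "\<lambda>x. frechet_derivative X (at x)"
  let ?d = "\<lambda>z. tangential_div (snd z) (?D (fst z))"
  let ?I = "\<integral>z. ?d z \<partial>V" and ?B = "integral {0..1} (\<lambda>\<tau>. parallelogram_area (X (\<gamma> \<tau>)) (c \<tau>))"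
  let ?m = "measure V UNIV"
  have lin: "linear (?D x)" for x
    using smooth_has_derivative[OF X] has_derivative_linear by blast
  obtain K where K: "K > 0" "\<And>x h. norm x \<le> R \<Longrightarrow> norm (?D x h) \<le> K * norm h"
    using smooth_derivative_bound[OF X compact_cball[of 0 R]] by (auto simp: mem_cball dist_norm)
  have int: "integrable V ?d"
  proof (rule integrable_const_bound[of _ "2 * K"])
    show "AE z in V. norm (?d z) \<le> 2 * K"
      using pl bd
    proof eventually_elim
      case (elim z)
      show ?case using tangential_div_bound[OF elim(1) lin K(2)[OF elim(2)]] by simp
    qed
  qed (rule measurable_tangential_div[OF sets X])
  have smooth: "smooth ?\<phi>"
    by (intro smooth_intros smooth_linear smooth_compose_linear[OF _ X] bounded_linear_fst bounded_linear_snd)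
  have fd: "frechet_derivative (\<lambda>x. ?\<phi> (t, x)) (at x) = (\<lambda>h. h + t *\<^sub>R ?D x h)" for t x
    by (rule frechet_derivative_at[symmetric])
       (auto intro!: derivative_eq_intros smooth_has_derivative[OF X])
  let ?F = "\<lambda>t. image_area V (\<lambda>x. ?\<phi> (t, x)) + swept_area \<gamma> ?\<phi> t"
  obtain D where D: "D \<ge> 0" "(?F has_real_derivative D) (at 0 within {0..})"
    using st smooth unfolding strongly_stationary_def by force
  have ia: "image_area V (\<lambda>x. ?\<phi> (t, x)) \<le> ?m + t * ?I + K\<^sup>2 * t\<^sup>2 * ?m"
    if nn: "0 \<le> ?m + t * ?I + K\<^sup>2 * t\<^sup>2 * ?m" for t
  proof -
    let ?j = "\<lambda>z. plane_jacobian (snd z) (\<lambda>h. h + t *\<^sub>R ?D (fst z) h)"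
    have ia: "image_area V (\<lambda>x. ?\<phi> (t, x)) = (\<integral>z. ?j z \<partial>V)"
      unfolding image_area_def fd by (simp add: case_prod_unfold)
    show ?thesis
    proof (cases "integrable V ?j")
      case False
      then show ?thesis unfolding ia using nn by (simp add: not_integrable_integral_eq)
    next
      case True
      have "(\<integral>z. ?j z \<partial>V) \<le> (\<integral>z. 1 + t * ?d z + K\<^sup>2 * t\<^sup>2 \<partial>V)"
      proof (rule integral_mono_AE[OF True])
        show "AE z in V. ?j z \<le> 1 + t * ?d z + K\<^sup>2 * t\<^sup>2"
          using pl bd
        proof eventually_elim
          case (elim z)
          show ?case using plane_jacobian_bound[OF elim(1) lin K(2)[OF elim(2)]] by simp
        qed
      qed (use int in auto)
      also have "\<dots> = ?m + t * ?I + K\<^sup>2 * t\<^sup>2 * ?m" using int by (simp add: space algebra_simps)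
      finally show ?thesis unfolding ia .
    qed
  qed
  have F0: "?F 0 = ?m"
  proof -
    have "image_area V (\<lambda>x. ?\<phi> (0, x)) = (\<integral>z. plane_jacobian (snd z) (\<lambda>h. h) \<partial>V)"
      unfolding image_area_def fd by (simp add: case_prod_unfold)
    also have "\<dots> = (\<integral>z. 1 \<partial>V)"
    proof (rule integral_cong_AE)
      have "(\<lambda>z. plane_jacobian (snd z) (\<lambda>h. h)) \<in> borel_measurable (borel :: ((real^'n) \<times> (real^'n^'n)) measure)"
        by (rule measurable_compose[OF _ measurable_plane_jacobian_ident]) (simp add: borel_measurable_continuous_onI continuous_on_snd)
      then show "(\<lambda>z. plane_jacobian (snd z) (\<lambda>h. h)) \<in> borel_measurable V"
        by (simp add: measurable_cong_sets[OF sets refl])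
    qed (use pl in \<open>auto elim!: eventually_mono simp: plane_jacobian_ident\<close>)
    also have "\<dots> = ?m" by (simp add: space)
    finally show ?thesis by (simp add: swept_area_def)
  qed
  obtain C where C: "C \<ge> 0" "\<And>t. 0 \<le> t \<Longrightarrow> swept_area \<gamma> ?\<phi> t \<le> t * ?B + C * t\<^sup>2"
    using swept_area_bound[OF X c cont] by blast
  have lim: "((\<lambda>t. (?F t - ?F 0) / (t - 0)) \<longlongrightarrow> D) (at_right 0)"
  proof -
    have "((\<lambda>t. (?F t - ?F 0) / (t - 0)) \<longlongrightarrow> D) (at 0 within {0..})"
      using D(2) unfolding has_field_derivative_iff by simp
    then show ?thesis by (rule tendsto_within_subset) auto
  qed
  have "eventually (\<lambda>t. 0 < ?m + t * ?I + K\<^sup>2 * t\<^sup>2 * ?m) (at_right 0)"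
  proof -
    have "((\<lambda>t. ?m + t * ?I + K\<^sup>2 * t\<^sup>2 * ?m) \<longlongrightarrow> ?m + 0 * ?I + K\<^sup>2 * 0\<^sup>2 * ?m) (at_right 0)"
      by (intro tendsto_intros)
    then show ?thesis using pos by (intro order_tendstoD(1)[where a=0]) auto
  qed
  then have ev: "eventually (\<lambda>t. (?F t - ?F 0) / (t - 0) \<le> ?I + ?B + (K\<^sup>2 * ?m + C) * t) (at_right 0)"
    using eventually_at_right_less[of 0]
  proof eventually_elim
    case (elim t)
    have "?F t \<le> ?m + t * ?I + K\<^sup>2 * t\<^sup>2 * ?m + (t * ?B + C * t\<^sup>2)"
      using ia[of t] C(2)[of t] elim by auto
    then have "?F t - ?F 0 \<le> (?I + ?B + (K\<^sup>2 * ?m + C) * t) * t"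
      unfolding F0 by (simp add: algebra_simps power2_eq_square)
    then show ?case using elim by (simp add: pos_divide_le_eq)
  qed
  have "((\<lambda>t. ?I + ?B + (K\<^sup>2 * ?m + C) * t) \<longlongrightarrow> ?I + ?B + (K\<^sup>2 * ?m + C) * 0) (at_right 0)"
    by (intro tendsto_intros)
  from tendsto_le[OF _ this lim ev] show ?thesis using D(1) by simp
qed

section \<open>angles\<close>

lemma inner_sgn_bounds: "- 1 \<le> sgn u \<bullet> sgn v" "sgn u \<bullet> sgn v \<le> 1"
proof -
  have "\<bar>sgn u \<bullet> sgn v\<bar> \<le> norm (sgn u) * norm (sgn v)" by (rule Cauchy_Schwarz_ineq2)
  also have "\<dots> \<le> 1" by (simp add: norm_sgn)
  finally show "- 1 \<le> sgn u \<bullet> sgn v" "sgn u \<bullet> sgn v \<le> 1" by auto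
qed

lemma vector_angle_sgn: "vector_angle u v = arccos (sgn u \<bullet> sgn v)"
  by (simp add: vector_angle_def sgn_div_norm divide_inverse mult_ac)

lemma vector_angle_nonneg: "0 \<le> vector_angle u v"
  and vector_angle_le_pi: "vector_angle u v \<le> pi"
  and cos_vector_angle: "cos (vector_angle u v) = sgn u \<bullet> sgn v"
  unfolding vector_angle_sgn using inner_sgn_bounds[of u v]
  by (auto intro: arccos_lbound arccos_ubound cos_arccos)

lemma vector_angle_commute: "vector_angle u v = vector_angle v u"
  by (simp add: vector_angle_sgn inner_commute)

lemma sin_vector_angle: "sin (vector_angle u v) = sqrt (1 - (sgn u \<bullet> sgn v)\<^sup>2)"
  unfolding vector_angle_sgn using inner_sgn_bounds[of u v] by (simp add: sin_arccos)

lemma vector_angle_triangle: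
  assumes "v \<noteq> 0"
  shows "vector_angle u w \<le> vector_angle u v + vector_angle v w"
proof (cases "vector_angle u v + vector_angle v w \<le> pi")
  case False
  then show ?thesis using vector_angle_le_pi[of u w] by linarith
next
  case True
  define a b where "a = sgn u \<bullet> sgn v" "b = sgn v \<bullet> sgn w"
  have vv: "sgn v \<bullet> sgn v = 1" using assms by (simp add: power2_norm_eq_inner[symmetric] norm_sgn)
  have au: "norm (sgn u - a *\<^sub>R sgn v) \<le> sqrt (1 - a\<^sup>2)"
  proof (rule real_le_rsqrt)
    have "(norm (sgn u - a *\<^sub>R sgn v))\<^sup>2 = (norm (sgn u))\<^sup>2 - a\<^sup>2"
      unfolding power2_norm_eq_inner
      by (simp add: inner_diff_left inner_diff_right vv a_b_def inner_commute[of "sgn v" "sgn u"] power2_eq_square)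
    also have "\<dots> \<le> 1 - a\<^sup>2" by (simp add: norm_sgn)
    finally show "(norm (sgn u - a *\<^sub>R sgn v))\<^sup>2 \<le> 1 - a\<^sup>2" .
  qed
  have bw: "norm (sgn w - b *\<^sub>R sgn v) \<le> sqrt (1 - b\<^sup>2)"
  proof (rule real_le_rsqrt)
    have "(norm (sgn w - b *\<^sub>R sgn v))\<^sup>2 = (norm (sgn w))\<^sup>2 - b\<^sup>2"
      unfolding power2_norm_eq_inner
      by (simp add: inner_diff_left inner_diff_right vv a_b_def inner_commute[of "sgn w" "sgn v"] power2_eq_square)
    also have "\<dots> \<le> 1 - b\<^sup>2" by (simp add: norm_sgn)
    finally show "(norm (sgn w - b *\<^sub>R sgn v))\<^sup>2 \<le> 1 - b\<^sup>2" .
  qed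
  have "sgn u \<bullet> sgn w = a * b + (sgn u - a *\<^sub>R sgn v) \<bullet> (sgn w - b *\<^sub>R sgn v)"
    by (simp add: inner_diff_left inner_diff_right vv a_b_def)
  moreover have "\<bar>(sgn u - a *\<^sub>R sgn v) \<bullet> (sgn w - b *\<^sub>R sgn v)\<bar> \<le> sqrt (1 - a\<^sup>2) * sqrt (1 - b\<^sup>2)"
    using Cauchy_Schwarz_ineq2[of "sgn u - a *\<^sub>R sgn v" "sgn w - b *\<^sub>R sgn v"] mult_mono[OF au bw]
      norm_ge_zero[THEN order_trans, OF au] by (auto intro: order_trans)
  moreover have "cos (vector_angle u v + vector_angle v w) = a * b - sqrt (1 - a\<^sup>2) * sqrt (1 - b\<^sup>2)"
    by (simp add: cos_add cos_vector_angle sin_vector_angle a_b_def)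
  ultimately have "cos (vector_angle u v + vector_angle v w) \<le> cos (vector_angle u w)"
    by (simp add: cos_vector_angle)
  then show ?thesis
    using True by (subst (asm) cos_mono_le_eq) (auto simp: vector_angle_nonneg vector_angle_le_pi)
qed

lemma sin_vector_angle_area:
  assumes "u \<noteq> 0" "v \<noteq> 0"
  shows "sin (vector_angle u v) = parallelogram_area u v / (norm u * norm v)"
proof -
  have "1 - (sgn u \<bullet> sgn v)\<^sup>2 = ((norm u)\<^sup>2 * (norm v)\<^sup>2 - (u \<bullet> v)\<^sup>2) / (norm u * norm v)\<^sup>2"
    using assms by (simp add: sgn_div_norm field_simps power_mult_distrib)
  then show ?thesis unfolding sin_vector_angle parallelogram_area_def
    by (simp add: real_sqrt_divide)
qed

lemma vector_angle_split:
  assumes "y \<noteq> 0" "z \<noteq> 0" "y \<noteq> z"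
  shows "vector_angle y z + vector_angle z (z - y) = vector_angle y (z - y)"
proof -
  define w where "w = z - y"
  have w: "w \<noteq> 0" using assms by (simp add: w_def)
  let ?A = "vector_angle y z" and ?B = "vector_angle z w" and ?p = "parallelogram_area y z"
  have p: "parallelogram_area z w = ?p"
    unfolding parallelogram_area_def w_def power2_norm_eq_inner
    by (simp add: inner_diff_left inner_diff_right inner_commute[of z y] power2_eq_square algebra_simps)
  have p2: "?p * ?p = (norm y)\<^sup>2 * (norm z)\<^sup>2 - (y \<bullet> z)\<^sup>2"
    using parallelogram_area_sq_nonneg[of y z] by (simp add: parallelogram_area_def)
  have cA: "cos ?A = (y \<bullet> z) / (norm y * norm z)" and cB: "cos ?B = (z \<bullet> w) / (norm z * norm w)"
    by (simp_all add: cos_vector_angle sgn_div_norm divide_inverse mult_ac)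
  have sA: "sin ?A = ?p / (norm y * norm z)" and sB: "sin ?B = ?p / (norm z * norm w)"
    using sin_vector_angle_area[OF assms(1,2)] sin_vector_angle_area[OF assms(2) w] p by auto
  have num: "(y \<bullet> z) * (z \<bullet> w) - ?p * ?p = (z \<bullet> z) * (y \<bullet> w)"
    unfolding p2 w_def power2_norm_eq_inner
    by (simp add: inner_diff_left inner_diff_right inner_commute[of z y] power2_eq_square algebra_simps)
  have "cos (?A + ?B) = ((y \<bullet> z) * (z \<bullet> w) - ?p * ?p) / (norm y * norm z * (norm z * norm w))"
    unfolding cos_add cA cB sA sB by (simp add: diff_divide_distrib)
  also have "\<dots> = (y \<bullet> w) / (norm y * norm w)"
    unfolding num using assms(2) by (simp add: power2_norm_eq_inner[symmetric] power2_eq_square)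
  also have "\<dots> = cos (vector_angle y w)"
    by (simp add: cos_vector_angle sgn_div_norm divide_inverse mult_ac)
  finally have c: "cos (?A + ?B) = cos (vector_angle y w)" .
  have "(z \<bullet> w) + (y \<bullet> z) = z \<bullet> z" by (simp add: w_def inner_diff_right inner_commute)
  then have s: "sin (?A + ?B) = ?p * (z \<bullet> z) / (norm y * norm z * (norm z * norm w))"
    unfolding sin_add cA cB sA sB by (simp add: add_divide_distrib[symmetric] algebra_simps flip: distrib_left)
  then have s0: "0 \<le> sin (?A + ?B)" by simp
  have "?A + ?B \<le> pi"
  proof (rule ccontr)
    assume *: "\<not> ?A + ?B \<le> pi"
    have le2: "?A + ?B \<le> 2 * pi" using vector_angle_le_pi[of y z] vector_angle_le_pi[of z w] by linarith
    have "?A + ?B = 2 * pi"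
    proof (rule ccontr)
      assume "?A + ?B \<noteq> 2 * pi"
      then have "sin (?A + ?B) < 0" using * le2 by (intro sin_lt_zero) auto
      then show False using s0 by simp
    qed
    then have "?A = pi" "?B = pi" using vector_angle_le_pi[of y z] vector_angle_le_pi[of z w] by linarith+
    then have "(y \<bullet> z) = - (norm y * norm z)" "(z \<bullet> w) = - (norm z * norm w)"
      using cA cB assms w by (simp_all add: field_simps)
    then have "z \<bullet> z \<le> 0" using \<open>(z \<bullet> w) + (y \<bullet> z) = z \<bullet> z\<close> by (smt (verit) mult_nonneg_nonneg norm_ge_zero)
    then show False using assms(2) inner_gt_zero_iff[of z] by linarith
  qed
  then have "?A + ?B = vector_angle y w"
    by (intro cos_inj_pi[OF _ _ _ _ c] add_nonneg_nonneg vector_angle_nonneg vector_angle_le_pi)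
  then show ?thesis by (simp add: w_def)
qed

lemma sgn_chord_le_angle:
  assumes "u \<noteq> 0" "v \<noteq> 0"
  shows "norm (sgn u - sgn v) \<le> vector_angle u v"
proof -
  let ?t = "vector_angle u v"
  have "(norm (sgn u - sgn v))\<^sup>2 = 2 - 2 * cos ?t"
    using dot_norm_neg[of "sgn u" "sgn v"] assms by (simp add: cos_vector_angle norm_sgn)
  also have "\<dots> = (2 * sin (?t / 2))\<^sup>2" using cos_double_sin[of "?t / 2"] by (simp add: power_mult_distrib)
  also have "\<dots> \<le> ?t\<^sup>2"
  proof -
    have "0 \<le> sin (?t / 2)" using vector_angle_nonneg[of u v] vector_angle_le_pi[of u v] by (intro sin_ge_zero) auto
    moreover have "sin (?t / 2) \<le> ?t / 2" using vector_angle_nonneg[of u v] by (intro sin_x_le_x) auto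
    ultimately show ?thesis by (intro power_mono) auto
  qed
  finally show ?thesis using vector_angle_nonneg[of u v] by (simp add: power2_le_iff_abs_le)
qed

section \<open>polygons\<close>

lemma polygon_curvature_Cons: "polygon_curvature ps \<le> polygon_curvature (x # ps)"
  by (cases ps rule: polygon_curvature.cases) (auto simp: vector_angle_nonneg)

lemma polygon_curvature_append:
  "polygon_curvature ps + polygon_curvature rs \<le> polygon_curvature (ps @ rs)"
proof (induction ps rule: polygon_curvature.induct)
  case ("2_1")
  then show ?case by simp
next
  case ("2_2" v)
  then show ?case by (simp add: polygon_curvature_Cons)
next
  case ("2_3" v w)
  have "polygon_curvature rs \<le> polygon_curvature (v # w # rs)"
    using polygon_curvature_Cons order_trans by metis
  then show ?case by simp
qed simp

lemma distinct_imp_distinct_adj: "distinct xs \<Longrightarrow> distinct_adj xs"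
  by (induction xs) (auto simp: distinct_adj_Cons)

fun visual_angle :: "'a::real_inner \<Rightarrow> 'a list \<Rightarrow> real" where
  "visual_angle q (x # y # ps) = vector_angle (x - q) (y - q) + visual_angle q (y # ps)"
| "visual_angle q _ = 0"

lemma visual_angle_le:
  assumes "distinct_adj (x # y # ps)" "q \<notin> set (x # y # ps)"
  shows "visual_angle q (x # y # ps) \<le> vector_angle (x - q) (y - x) + polygon_curvature (x # y # ps)"
  using assms
proof (induction ps arbitrary: x y)
  case Nil
  then have "vector_angle (x - q) (y - q) + vector_angle (y - q) (y - x) = vector_angle (x - q) (y - x)"
    using vector_angle_split[of "x - q" "y - q"] by auto
  then show ?case using vector_angle_nonneg[of "y - q" "y - x"] by simp
next
  case (Cons z ps)
  have "vector_angle (x - q) (y - q) + vector_angle (y - q) (y - x) = vector_angle (x - q) (y - x)"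
    using vector_angle_split[of "x - q" "y - q"] Cons.prems by auto
  moreover have "vector_angle (y - q) (z - y) \<le> vector_angle (y - q) (y - x) + vector_angle (y - x) (z - y)"
    using Cons.prems by (intro vector_angle_triangle) auto
  moreover have "visual_angle q (y # z # ps) \<le> vector_angle (y - q) (z - y) + polygon_curvature (y # z # ps)"
    using Cons.prems by (intro Cons.IH) auto
  ultimately show ?case by simp
qed

lemma visual_angle_upt:
  "visual_angle q (map f [k..<Suc (k + n)]) = (\<Sum>i<n. vector_angle (f (k + i) - q) (f (Suc (k + i)) - q))"
proof (induction n arbitrary: k)
  case (Suc n)
  have 1: "map f [k..<Suc (k + Suc n)] = f k # f (Suc k) # map f [Suc (Suc k)..<Suc (Suc k + n)]"
    by (simp add: upt_conv_Cons del: upt_Suc)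
  have 2: "f (Suc k) # map f [Suc (Suc k)..<Suc (Suc k + n)] = map f [Suc k..<Suc (Suc k + n)]"
    by (simp add: upt_conv_Cons del: upt_Suc)
  have "visual_angle q (map f [k..<Suc (k + Suc n)])
      = vector_angle (f k - q) (f (Suc k) - q) + visual_angle q (map f [Suc k..<Suc (Suc k + n)])"
    unfolding 1 unfolding visual_angle.simps(1) unfolding 2 ..
  also have "\<dots> = (\<Sum>i<Suc n. vector_angle (f (k + i) - q) (f (Suc (k + i)) - q))"
    unfolding Suc.IH by (subst sum.lessThan_Suc_shift) simp
  finally show ?case .
qed simp

lemma vector_differentiable_bound:
  fixes f :: "real \<Rightarrow> 'a::euclidean_space"
  assumes "convex S" "\<And>s. s \<in> S \<Longrightarrow> (f has_vector_derivative f' s) (at s within S)"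
    and "\<And>s. s \<in> S \<Longrightarrow> norm (f' s) \<le> B" "x \<in> S" "y \<in> S"
  shows "norm (f x - f y) \<le> B * norm (x - y)"
  using assms(1,2,4,5) unfolding has_vector_derivative_def
  by (intro differentiable_bound[where S=S and f'="\<lambda>s h. h *\<^sub>R f' s"])
     (auto intro!: onorm_le mult_left_mono assms(3) simp: mult.commute[of B])

lemma integral_speed_le_inscribed:
  fixes e :: "real \<Rightarrow> 'a::euclidean_space"
  assumes ab: "\<alpha> < \<beta>"
    and e: "\<And>t. t \<in> {\<alpha>..\<beta>} \<Longrightarrow> (e has_vector_derivative e' t) (at t within {\<alpha>..\<beta>})"
    and cont: "continuous_on {\<alpha>..\<beta>} e'"
    and B: "\<And>n. n > 0 \<Longrightarrow> (\<Sum>i<n. norm (e (\<alpha> + real (Suc i) * ((\<beta> - \<alpha>) / n)) - e (\<alpha> + real i * ((\<beta> - \<alpha>) / n)))) \<le> B"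
  shows "integral {\<alpha>..\<beta>} (\<lambda>t. norm (e' t)) \<le> B"
proof (rule field_le_epsilon)
  fix \<epsilon> :: real assume "\<epsilon> > 0"
  define \<epsilon>' where "\<epsilon>' = \<epsilon> / (2 * (\<beta> - \<alpha>))"
  have \<epsilon>': "\<epsilon>' > 0" using \<open>\<epsilon> > 0\<close> ab by (simp add: \<epsilon>'_def)
  have "uniformly_continuous_on {\<alpha>..\<beta>} e'" using compact_uniformly_continuous[OF cont] by simp
  then obtain d where d: "d > 0" "\<And>s t. s \<in> {\<alpha>..\<beta>} \<Longrightarrow> t \<in> {\<alpha>..\<beta>} \<Longrightarrow> \<bar>s - t\<bar> < d \<Longrightarrow> norm (e' s - e' t) < \<epsilon>'"
    using \<epsilon>' unfolding uniformly_continuous_on_def dist_norm by (metis real_norm_def)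
  obtain n :: nat where n: "(\<beta> - \<alpha>) / d < n" using reals_Archimedean2 by blast
  then have n0: "n > 0" using ab d by (metis divide_pos_pos diff_gt_0_iff_gt less_trans of_nat_0_less_iff)
  define h where "h = (\<beta> - \<alpha>) / n"
  have h: "0 < h" "h < d" using n0 n ab d by (auto simp: h_def field_simps)
  define t where "t i = \<alpha> + real i * h" for i
  have ti: "t i \<in> {\<alpha>..\<beta>}" if "i \<le> n" for i
  proof -
    have "real i * h \<le> real n * h" using that h by (intro mult_right_mono) auto
    moreover have "real n * h = \<beta> - \<alpha>" using n0 by (simp add: h_def)
    ultimately show ?thesis using h by (auto simp: t_def)
  qed
  have st: "t (Suc i) = t i + h" for i by (simp add: t_def algebra_simps)
  have ic: "(\<lambda>t. norm (e' t)) integrable_on {a..b}" if "\<alpha> \<le> a" "b \<le> \<beta>" for a b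
    using that by (intro integrable_continuous_interval continuous_intros continuous_on_subset[OF cont]) auto
  have step: "integral {t i..t (Suc i)} (\<lambda>t. norm (e' t)) \<le> norm (e (t (Suc i)) - e (t i)) + 2 * \<epsilon>' * h"
    if i: "i < n" for i
  proof -
    have sub: "{t i..t (Suc i)} \<subseteq> {\<alpha>..\<beta>}" using ti[of i] ti[of "Suc i"] i by auto
    have near: "norm (e' s - e' (t i)) \<le> \<epsilon>'" if "s \<in> {t i..t (Suc i)}" for s
      using d(2)[of s "t i"] that sub st[of i] h ti[of i] i by (auto intro!: less_imp_le)
    have "norm ((e (t (Suc i)) - t (Suc i) *\<^sub>R e' (t i)) - (e (t i) - t i *\<^sub>R e' (t i))) \<le> \<epsilon>' * norm (t (Suc i) - t i)"
    proof (rule vector_differentiable_bound[where S="{t i..t (Suc i)}" and f'="\<lambda>s. e' s - e' (t i)"])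
      fix s assume s: "s \<in> {t i..t (Suc i)}"
      have "(e has_vector_derivative e' s) (at s within {t i..t (Suc i)})"
        using has_vector_derivative_within_subset[OF e sub] s sub by blast
      then show "((\<lambda>s. e s - s *\<^sub>R e' (t i)) has_vector_derivative e' s - e' (t i)) (at s within {t i..t (Suc i)})"
        by (auto intro!: derivative_eq_intros)
    qed (use near st[of i] h in \<open>auto intro: less_imp_le\<close>)
    then have "norm ((e (t (Suc i)) - e (t i)) - h *\<^sub>R e' (t i)) \<le> \<epsilon>' * h"
      using h by (simp add: st algebra_simps)
    then have "norm (h *\<^sub>R e' (t i)) \<le> norm (e (t (Suc i)) - e (t i)) + \<epsilon>' * h"
      using norm_triangle_sub[of "h *\<^sub>R e' (t i)" "e (t (Suc i)) - e (t i)"] by (simp add: norm_minus_commute)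
    moreover have "integral {t i..t (Suc i)} (\<lambda>t. norm (e' t)) \<le> integral {t i..t (Suc i)} (\<lambda>s. norm (e' (t i)) + \<epsilon>')"
    proof (rule integral_le)
      show "(\<lambda>t. norm (e' t)) integrable_on {t i..t (Suc i)}" using sub st[of i] h by (intro ic) auto
      fix s assume "s \<in> {t i..t (Suc i)}"
      from near[OF this] show "norm (e' s) \<le> norm (e' (t i)) + \<epsilon>'"
        using norm_triangle_sub[of "e' s" "e' (t i)"] by simp
    qed auto
    moreover have "\<dots> = h * norm (e' (t i)) + \<epsilon>' * h" using h by (simp add: st algebra_simps)
    ultimately show ?thesis using h by simp
  qed
  have "integral {\<alpha>..t k} (\<lambda>t. norm (e' t)) \<le> (\<Sum>i<k. norm (e (t (Suc i)) - e (t i))) + 2 * \<epsilon>' * h * k"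
    if "k \<le> n" for k
    using that
  proof (induction k)
    case 0
    then show ?case by (simp add: t_def)
  next
    case (Suc k)
    have "integral {\<alpha>..t (Suc k)} (\<lambda>t. norm (e' t)) = integral {\<alpha>..t k} (\<lambda>t. norm (e' t)) + integral {t k..t (Suc k)} (\<lambda>t. norm (e' t))"
      using ti[of k] ti[of "Suc k"] st[of k] h Suc.prems
      by (intro Henstock_Kurzweil_Integration.integral_combine[symmetric] ic) auto
    then show ?case using Suc step[of k] by (simp add: algebra_simps)
  qed
  from this[of n] have "integral {\<alpha>..t n} (\<lambda>t. norm (e' t)) \<le> B + 2 * \<epsilon>' * h * n"
    using B[OF n0] by (simp add: t_def h_def)
  moreover have "t n = \<beta>" using n0 by (simp add: t_def h_def)
  moreover have "2 * \<epsilon>' * h * n = \<epsilon>" using n0 ab by (simp add: h_def \<epsilon>'_def field_simps)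
  ultimately show "integral {\<alpha>..\<beta>} (\<lambda>t. norm (e' t)) \<le> B + \<epsilon>" by simp
qed

section \<open>arcs\<close>

locale regular_arc =
  fixes \<gamma> c :: "real \<Rightarrow> 'a::euclidean_space" and C K m :: real
  assumes deriv: "\<And>\<tau>. \<tau> \<in> {0..1} \<Longrightarrow> (\<gamma> has_vector_derivative c \<tau>) (at \<tau> within {0..1})"
    and lip: "\<And>\<tau> \<sigma>. \<tau> \<in> {0..1} \<Longrightarrow> \<sigma> \<in> {0..1} \<Longrightarrow> norm (c \<tau> - c \<sigma>) \<le> C * \<bar>\<tau> - \<sigma>\<bar>"
    and C0: "0 \<le> C"
    and speed: "\<And>\<tau>. \<tau> \<in> {0..1} \<Longrightarrow> norm (c \<tau>) \<le> K"
    and m0: "0 < m"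
    and bilip: "\<And>\<tau> \<sigma>. \<tau> \<in> {0..1} \<Longrightarrow> \<sigma> \<in> {0..1} \<Longrightarrow> m * \<bar>\<tau> - \<sigma>\<bar> \<le> norm (\<gamma> \<tau> - \<gamma> \<sigma>)"

lemma taylor_bound:
  fixes \<gamma> c :: "real \<Rightarrow> 'a::euclidean_space"
  assumes deriv: "\<And>\<tau>. \<tau> \<in> {0..1} \<Longrightarrow> (\<gamma> has_vector_derivative c \<tau>) (at \<tau> within {0..1})"
    and lip: "\<And>\<tau> \<sigma>. \<tau> \<in> {0..1} \<Longrightarrow> \<sigma> \<in> {0..1} \<Longrightarrow> norm (c \<tau> - c \<sigma>) \<le> C * \<bar>\<tau> - \<sigma>\<bar>"
    and C0: "0 \<le> C" and \<tau>: "\<tau> \<in> {0..1}" and \<sigma>: "\<sigma> \<in> {0..1}"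
  shows "norm (\<gamma> \<tau> - \<gamma> \<sigma> - (\<tau> - \<sigma>) *\<^sub>R c \<sigma>) \<le> C * (\<tau> - \<sigma>)\<^sup>2"
proof -
  let ?S = "closed_segment \<sigma> \<tau>"
  have sub: "?S \<subseteq> {0..1}" using \<tau> \<sigma> by (auto simp: closed_segment_eq_real_ivl split: if_splits)
  have "norm ((\<gamma> \<tau> - \<tau> *\<^sub>R c \<sigma>) - (\<gamma> \<sigma> - \<sigma> *\<^sub>R c \<sigma>)) \<le> (C * \<bar>\<tau> - \<sigma>\<bar>) * norm (\<tau> - \<sigma>)"
  proof (rule vector_differentiable_bound[where S="?S" and f'="\<lambda>s. c s - c \<sigma>"])
    fix s assume s: "s \<in> ?S"
    have "(\<gamma> has_vector_derivative c s) (at s within ?S)"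
      using has_vector_derivative_within_subset[OF deriv sub] s sub by blast
    then show "((\<lambda>s. \<gamma> s - s *\<^sub>R c \<sigma>) has_vector_derivative c s - c \<sigma>) (at s within ?S)"
      by (auto intro!: derivative_eq_intros)
    have "\<bar>s - \<sigma>\<bar> \<le> \<bar>\<tau> - \<sigma>\<bar>" using s by (auto simp: closed_segment_eq_real_ivl split: if_splits)
    then have "C * \<bar>s - \<sigma>\<bar> \<le> C * \<bar>\<tau> - \<sigma>\<bar>" using C0 by (rule mult_left_mono)
    then show "norm (c s - c \<sigma>) \<le> C * \<bar>\<tau> - \<sigma>\<bar>" using lip[of s \<sigma>] s sub \<sigma> by auto
  qed auto
  then show ?thesis by (simp add: algebra_simps power2_eq_square abs_mult_self_eq)
qed


lemma regular_arc_exists: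
  fixes \<gamma> :: "real \<Rightarrow> 'a::euclidean_space"
  assumes "smooth_embedded_arc \<gamma>"
  shows "\<exists>C K m. regular_arc \<gamma> (velocity \<gamma>) C K m"
proof -
  obtain D where D0: "D 0 = \<gamma>"
    and D: "\<And>k t. t \<in> {0..1} \<Longrightarrow> (D k has_vector_derivative D (Suc k) t) (at t within {0..1})"
    using assms by (auto simp: smooth_embedded_arc_def smooth_path_def)
  have v: "velocity \<gamma> t = D 1 t" if "t \<in> {0..1}" for t
    unfolding velocity_def using that D[of t 0] D0
    by (intro vector_derivative_within_cbox[of 0 1, simplified]) auto
  have contD: "continuous_on {0..1} (D k)" for k
    using D by (meson continuous_on_eq_continuous_within has_vector_derivative_continuous)
  have bd: "\<exists>B. \<forall>t\<in>{0..1}. norm (D k t) \<le> B" for k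
  proof -
    have "bounded (D k ` {0..1})" by (intro compact_imp_bounded compact_continuous_image contD) auto
    then show ?thesis by (auto simp: bounded_iff)
  qed
  obtain C where C: "\<And>t. t \<in> {0..1} \<Longrightarrow> norm (D 2 t) \<le> C" using bd by metis
  obtain K where K: "\<And>t. t \<in> {0..1} \<Longrightarrow> norm (D 1 t) \<le> K" using bd by metis
  have C0: "0 \<le> C" using order_trans[OF norm_ge_zero C[of 0]] by simp
  have deriv: "\<tau> \<in> {0..1} \<Longrightarrow> (\<gamma> has_vector_derivative velocity \<gamma> \<tau>) (at \<tau> within {0..1})" for \<tau>
    using D[of \<tau> 0] D0 v by simp
  have lip: "norm (velocity \<gamma> \<tau> - velocity \<gamma> \<sigma>) \<le> C * \<bar>\<tau> - \<sigma>\<bar>" if "\<tau> \<in> {0..1}" "\<sigma> \<in> {0..1}" for \<tau> \<sigma>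
    using vector_differentiable_bound[of "{0..1}" "D 1" "D 2" C \<tau> \<sigma>] D[of _ 1] C that v
    by (simp add: numeral_2_eq_2)
  have gcont: "continuous_on {0..1} \<gamma>" using contD[of 0] D0 by simp
  have vcont: "continuous_on {0..1} (velocity \<gamma>)" by (rule continuous_on_eq[OF contD[of 1]]) (simp add: v)
  obtain t0 where t0: "t0 \<in> {0..1}" "\<And>t. t \<in> {0..1} \<Longrightarrow> norm (velocity \<gamma> t0) \<le> norm (velocity \<gamma> t)"
    using continuous_attains_inf[OF compact_Icc _ continuous_on_norm[OF vcont]] by (metis atLeastAtMost_iff empty_iff order_refl zero_le_one)
  define k where "k = norm (velocity \<gamma> t0)"
  have k: "k > 0" using assms t0(1) by (simp add: k_def smooth_embedded_arc_def)
  define d where "d = k / (2 * (C + 1))"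
  have d: "d > 0" using k C0 by (simp add: d_def)
  let ?F = "{z \<in> {0..1} \<times> {0..1}. d \<le> \<bar>fst z - snd z\<bar>}"
  have "\<exists>e>0. \<forall>z\<in>?F. e \<le> norm (\<gamma> (fst z) - \<gamma> (snd z))"
  proof (cases "?F = {}")
    case False
    have "closed {z::real\<times>real. d \<le> \<bar>fst z - snd z\<bar>}" by (intro closed_Collect_le continuous_intros)
    then have "compact (({0..1} \<times> {0..1}) \<inter> {z::real\<times>real. d \<le> \<bar>fst z - snd z\<bar>})"
      by (intro compact_Int_closed compact_Times compact_Icc)
    also have "({0..1} \<times> {0..1}) \<inter> {z::real\<times>real. d \<le> \<bar>fst z - snd z\<bar>} = ?F" by auto
    finally have "compact ?F" .
    moreover have "continuous_on ?F (\<lambda>z. norm (\<gamma> (fst z) - \<gamma> (snd z)))"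
      by (intro continuous_intros continuous_on_compose2[OF gcont]) auto
    ultimately obtain z where z: "z \<in> ?F" "\<And>w. w \<in> ?F \<Longrightarrow> norm (\<gamma> (fst z) - \<gamma> (snd z)) \<le> norm (\<gamma> (fst w) - \<gamma> (snd w))"
      using continuous_attains_inf[of ?F "\<lambda>z. norm (\<gamma> (fst z) - \<gamma> (snd z))"] False by blast
    have "fst z \<noteq> snd z" using z(1) d by auto
    then have "\<gamma> (fst z) \<noteq> \<gamma> (snd z)"
      using assms z(1) unfolding smooth_embedded_arc_def arc_def by (auto dest: inj_onD)
    then show ?thesis using z(2) by (intro exI[of _ "norm (\<gamma> (fst z) - \<gamma> (snd z))"]) auto
  qed (auto intro: exI[of _ 1])
  then obtain e where e: "e > 0" "\<And>z. z \<in> ?F \<Longrightarrow> e \<le> norm (\<gamma> (fst z) - \<gamma> (snd z))" by blast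
  define m where "m = min e (k / 2)"
  have "m * \<bar>\<tau> - \<sigma>\<bar> \<le> norm (\<gamma> \<tau> - \<gamma> \<sigma>)" if ts: "\<tau> \<in> {0..1}" "\<sigma> \<in> {0..1}" for \<tau> \<sigma>
  proof (cases "d \<le> \<bar>\<tau> - \<sigma>\<bar>")
    case True
    have "m * \<bar>\<tau> - \<sigma>\<bar> \<le> e * 1" using ts e(1) k by (intro mult_mono) (auto simp: m_def)
    also have "\<dots> \<le> norm (\<gamma> \<tau> - \<gamma> \<sigma>)" using e(2)[of "(\<tau>, \<sigma>)"] ts True by simp
    finally show ?thesis .
  next
    case False
    have "norm ((\<tau> - \<sigma>) *\<^sub>R velocity \<gamma> \<sigma>) \<le> norm (\<gamma> \<tau> - \<gamma> \<sigma>) + C * (\<tau> - \<sigma>)\<^sup>2"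
      using taylor_bound[OF deriv lip C0 ts]
        norm_triangle_ineq2[of "(\<tau> - \<sigma>) *\<^sub>R velocity \<gamma> \<sigma>" "\<gamma> \<tau> - \<gamma> \<sigma>"] by (simp add: norm_minus_commute)
    moreover have "k * \<bar>\<tau> - \<sigma>\<bar> \<le> norm ((\<tau> - \<sigma>) *\<^sub>R velocity \<gamma> \<sigma>)"
      using t0(2)[OF ts(2)] by (simp add: k_def mult_left_mono mult.commute)
    moreover have "C * (\<tau> - \<sigma>)\<^sup>2 \<le> k / 2 * \<bar>\<tau> - \<sigma>\<bar>"
    proof -
      have "C * \<bar>\<tau> - \<sigma>\<bar> \<le> (C + 1) * d" using False C0 by (intro mult_mono) auto
      also have "\<dots> = k / 2" using C0 by (simp add: d_def field_simps)
      finally have "C * \<bar>\<tau> - \<sigma>\<bar> * \<bar>\<tau> - \<sigma>\<bar> \<le> k / 2 * \<bar>\<tau> - \<sigma>\<bar>" by (rule mult_right_mono) simp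
      then show ?thesis by (simp add: power2_eq_square mult.assoc abs_mult_self_eq)
    qed
    moreover have "m * \<bar>\<tau> - \<sigma>\<bar> \<le> k / 2 * \<bar>\<tau> - \<sigma>\<bar>" by (intro mult_right_mono) (auto simp: m_def)
    ultimately show ?thesis by simp
  qed
  moreover have "m > 0" using e k by (simp add: m_def)
  ultimately have "regular_arc \<gamma> (velocity \<gamma>) C K m"
    using deriv lip C0 K v by unfold_locales auto
  then show ?thesis by blast
qed

context regular_arc begin

lemma \<gamma>_cont: "continuous_on {0..1} \<gamma>"
  using deriv by (meson continuous_on_eq_continuous_within has_vector_derivative_continuous)

lemma c_cont: "continuous_on {0..1} c"
proof (rule lipschitz_on_continuous_on)
  show "C-lipschitz_on {0..1} c"
    using lip C0 by (auto simp: lipschitz_on_def dist_norm)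
qed

lemma taylor: "\<tau> \<in> {0..1} \<Longrightarrow> \<sigma> \<in> {0..1} \<Longrightarrow> norm (\<gamma> \<tau> - \<gamma> \<sigma> - (\<tau> - \<sigma>) *\<^sub>R c \<sigma>) \<le> C * (\<tau> - \<sigma>)\<^sup>2"
  by (rule taylor_bound[OF deriv lip C0])

lemma K0: "0 \<le> K" using order_trans[OF norm_ge_zero speed[of 0]] by simp

lemma inj_gamma: "\<tau> \<in> {0..1} \<Longrightarrow> \<sigma> \<in> {0..1} \<Longrightarrow> \<gamma> \<tau> = \<gamma> \<sigma> \<longleftrightarrow> \<tau> = \<sigma>"
  using bilip[of \<tau> \<sigma>] m0 by (auto simp: mult_le_0_iff)

lemma area_quadratic:
  assumes "\<tau> \<in> {0..1}" "\<sigma> \<in> {0..1}"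
  shows "parallelogram_area (\<gamma> \<tau> - \<gamma> \<sigma>) (c \<tau>) \<le> C * K * (\<tau> - \<sigma>)\<^sup>2"
proof -
  have "parallelogram_area (\<gamma> \<tau> - \<gamma> \<sigma>) (c \<tau>) \<le> norm (\<gamma> \<tau> - \<gamma> \<sigma> - (\<tau> - \<sigma>) *\<^sub>R c \<tau>) * norm (c \<tau>)"
    by (rule parallelogram_area_le)
  also have "norm (\<gamma> \<tau> - \<gamma> \<sigma> - (\<tau> - \<sigma>) *\<^sub>R c \<tau>) \<le> C * (\<tau> - \<sigma>)\<^sup>2"
    using taylor[OF assms(2,1)] norm_minus_cancel[of "\<gamma> \<sigma> - \<gamma> \<tau> - (\<sigma> - \<tau>) *\<^sub>R c \<tau>"]
    by (simp add: algebra_simps power2_commute)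
  finally show ?thesis using speed[OF assms(1)] C0
    by (smt (verit) mult.assoc mult.commute mult_left_mono mult_right_mono norm_ge_zero zero_le_mult_iff zero_le_power2)
qed

lemma area_over_sq:
  assumes "\<tau> \<in> {0..1}" "\<sigma> \<in> {0..1}"
  shows "parallelogram_area (\<gamma> \<tau> - \<gamma> \<sigma>) (c \<tau>) / (norm (\<gamma> \<tau> - \<gamma> \<sigma>))\<^sup>2 \<le> C * K / m\<^sup>2"
proof (cases "\<tau> = \<sigma>")
  case True
  then show ?thesis using C0 K0 by simp
next
  case False
  have "(m * \<bar>\<tau> - \<sigma>\<bar>)\<^sup>2 \<le> (norm (\<gamma> \<tau> - \<gamma> \<sigma>))\<^sup>2" using bilip[OF assms] m0 by (intro power_mono) auto
  then have "parallelogram_area (\<gamma> \<tau> - \<gamma> \<sigma>) (c \<tau>) / (norm (\<gamma> \<tau> - \<gamma> \<sigma>))\<^sup>2 \<le> (C * K * (\<tau> - \<sigma>)\<^sup>2) / (m * \<bar>\<tau> - \<sigma>\<bar>)\<^sup>2"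
    using area_quadratic[OF assms] False m0 C0 K0 by (intro frac_le) auto
  also have "\<dots> = C * K / m\<^sup>2" using False by (simp add: power_mult_distrib)
  finally show ?thesis .
qed

lemma seen_length_le:
  assumes ab: "0 \<le> \<alpha>" "\<alpha> < \<beta>" "\<beta> \<le> 1" and q: "q \<notin> \<gamma> ` {\<alpha>..\<beta>}"
    and B: "\<And>t t' ts. sorted_wrt (<) (t # t' # ts) \<Longrightarrow> set (t # t' # ts) \<subseteq> {\<alpha>..\<beta>} \<Longrightarrow>
        vector_angle (\<gamma> t - q) (\<gamma> t' - \<gamma> t) + polygon_curvature (map \<gamma> (t # t' # ts)) \<le> B"
  shows "integral {\<alpha>..\<beta>} (\<lambda>\<tau>. parallelogram_area (\<gamma> \<tau> - q) (c \<tau>) / (norm (\<gamma> \<tau> - q))\<^sup>2) \<le> B"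
proof -
  have sub: "{\<alpha>..\<beta>} \<subseteq> {0..1}" using ab by auto
  have nz: "\<gamma> t - q \<noteq> 0" if "t \<in> {\<alpha>..\<beta>}" for t using q that by auto
  define e' where "e' t = (1 / norm (\<gamma> t - q)) *\<^sub>R c t
      - (((\<gamma> t - q) \<bullet> c t) / norm (\<gamma> t - q) ^ 3) *\<^sub>R (\<gamma> t - q)" for t
  have dg: "(\<gamma> has_vector_derivative c t) (at t within {\<alpha>..\<beta>})" if "t \<in> {\<alpha>..\<beta>}" for t
    using has_vector_derivative_within_subset[OF deriv sub] that sub by blast
  have de: "((\<lambda>t. sgn (\<gamma> t - q)) has_vector_derivative e' t) (at t within {\<alpha>..\<beta>})" if t: "t \<in> {\<alpha>..\<beta>}" for t
  proof -
    have y: "((\<lambda>t. \<gamma> t - q) has_vector_derivative c t) (at t within {\<alpha>..\<beta>})"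
      using dg[OF t] by (auto intro!: derivative_eq_intros)
    have n: "((\<lambda>t. norm (\<gamma> t - q)) has_derivative (\<lambda>h. sgn (\<gamma> t - q) \<bullet> (h *\<^sub>R c t))) (at t within {\<alpha>..\<beta>})"
      using has_derivative_compose[OF y[unfolded has_vector_derivative_def] has_derivative_norm[OF nz[OF t]]]
      by (simp add: o_def inner_commute)
    have "((\<lambda>t. inverse (norm (\<gamma> t - q)) *\<^sub>R (\<gamma> t - q)) has_derivative (\<lambda>h. h *\<^sub>R e' t)) (at t within {\<alpha>..\<beta>})"
      by (rule has_derivative_eq_rhs[OF has_derivative_scaleR[OF Deriv.has_derivative_inverse[OF _ n] y[unfolded has_vector_derivative_def]]])
         (use nz[OF t] in \<open>auto simp: e'_def sgn_div_norm fun_eq_iff algebra_simps power3_eq_cube divide_inverse\<close>)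
    then show ?thesis by (simp add: has_vector_derivative_def sgn_div_norm)
  qed
  have ne: "norm (e' t) = parallelogram_area (\<gamma> t - q) (c t) / (norm (\<gamma> t - q))\<^sup>2" if t: "t \<in> {\<alpha>..\<beta>}" for t
  proof -
    let ?y = "\<gamma> t - q"
    have y: "norm ?y > 0" using nz[OF t] by simp
    have sq: "(norm (a *\<^sub>R w - b *\<^sub>R y))\<^sup>2 = a\<^sup>2 * (norm w)\<^sup>2 - 2 * a * b * (y \<bullet> w) + b\<^sup>2 * (norm y)\<^sup>2"
      for a b and w y :: 'a
      unfolding power2_norm_eq_inner
      by (simp add: inner_diff_left inner_diff_right inner_commute[of w y] power2_eq_square algebra_simps)
    have "(norm (e' t))\<^sup>2 = ((norm ?y)\<^sup>2 * (norm (c t))\<^sup>2 - (?y \<bullet> c t)\<^sup>2) / (norm ?y)^4"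
      unfolding e'_def sq using y
      by (simp add: field_simps power2_eq_square power3_eq_cube power4_eq_xxxx)
    also have "\<dots> = (parallelogram_area ?y (c t) / (norm ?y)\<^sup>2)\<^sup>2"
      using parallelogram_area_sq_nonneg[of ?y "c t"]
      by (simp add: parallelogram_area_def power_divide flip: power_mult)
    finally show ?thesis by (simp add: power2_eq_iff_nonneg)
  qed
  have cont: "continuous_on {\<alpha>..\<beta>} e'"
    unfolding e'_def using nz
    by (intro continuous_intros continuous_on_subset[OF \<gamma>_cont sub] continuous_on_subset[OF c_cont sub]) auto
  have "integral {\<alpha>..\<beta>} (\<lambda>t. norm (e' t)) \<le> B"
  proof (rule integral_speed_le_inscribed[OF ab(2) de cont])
    fix n :: nat assume n: "n > 0"
    define h where "h = (\<beta> - \<alpha>) / n"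
    define t where "t i = \<alpha> + real i * h" for i
    have h: "h > 0" using n ab by (simp add: h_def)
    have tin: "t i \<in> {\<alpha>..\<beta>}" if "i \<le> n" for i
    proof -
      have "real i * h \<le> real n * h" using that h by (intro mult_right_mono) auto
      moreover have "real n * h = \<beta> - \<alpha>" using n by (simp add: h_def)
      ultimately show ?thesis using h by (auto simp: t_def)
    qed
    have tmono: "t i < t j" if "i < j" for i j using that h by (simp add: t_def)
    define ts where "ts = map t [0..<Suc n]"
    have srt: "sorted_wrt (<) ts" unfolding ts_def sorted_wrt_map
      by (rule sorted_wrt_mono_rel[OF _ sorted_wrt_upt]) (use tmono in auto)
    have set: "set ts \<subseteq> {\<alpha>..\<beta>}" using tin by (auto simp: ts_def less_Suc_eq_le)
    obtain ts' where ts: "ts = t 0 # t 1 # ts'"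
      using n by (cases n) (auto simp: ts_def upt_conv_Cons simp del: upt_Suc)
    have dist: "distinct_adj (map \<gamma> ts)"
    proof -
      have "distinct ts" using srt strict_sorted_iff by blast
      moreover have "inj_on \<gamma> (set ts)" using inj_gamma set sub by (meson inj_onI subsetD)
      ultimately have "distinct (map \<gamma> ts)" by (simp add: distinct_map)
      then show ?thesis by (rule distinct_imp_distinct_adj)
    qed
    have "(\<Sum>i<n. norm (sgn (\<gamma> (t (Suc i)) - q) - sgn (\<gamma> (t i) - q)))
        \<le> (\<Sum>i<n. vector_angle (\<gamma> (t i) - q) (\<gamma> (t (Suc i)) - q))"
      using nz tin by (intro sum_mono) (subst norm_minus_commute, intro sgn_chord_le_angle, auto)
    also have "\<dots> = visual_angle q (map \<gamma> ts)"
      using visual_angle_upt[of q "\<gamma> \<circ> t" 0 n] by (simp add: ts_def del: upt_Suc)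
    also have "\<dots> \<le> vector_angle (\<gamma> (t 0) - q) (\<gamma> (t 1) - \<gamma> (t 0)) + polygon_curvature (map \<gamma> ts)"
    proof -
      have "q \<notin> set (map \<gamma> ts)" using q set by auto
      then show ?thesis using visual_angle_le[of "\<gamma> (t 0)" "\<gamma> (t 1)" "map \<gamma> ts'" q] dist by (simp add: ts)
    qed
    also have "\<dots> \<le> B" using B[of "t 0" "t 1" ts'] srt set by (simp add: ts)
    finally show "(\<Sum>i<n. norm (sgn (\<gamma> (\<alpha> + real (Suc i) * ((\<beta> - \<alpha>) / n)) - q) - sgn (\<gamma> (\<alpha> + real i * ((\<beta> - \<alpha>) / n)) - q))) \<le> B"
      by (simp add: t_def h_def)
  qed
  also have "integral {\<alpha>..\<beta>} (\<lambda>t. norm (e' t)) = integral {\<alpha>..\<beta>} (\<lambda>\<tau>. parallelogram_area (\<gamma> \<tau> - q) (c \<tau>) / (norm (\<gamma> \<tau> - q))\<^sup>2)"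
    by (intro Henstock_Kurzweil_Integration.integral_cong ne)
  finally show ?thesis .
qed

end

context regular_arc begin

lemma seen_from_start:
  assumes TC: "\<And>ts. sorted_wrt (<) ts \<Longrightarrow> set ts \<subseteq> {0..1} \<Longrightarrow> polygon_curvature (map \<gamma> ts) \<le> B"
    and s: "0 \<le> s" "s < \<alpha>" "\<alpha> < 1"
  shows "integral {\<alpha>..1} (\<lambda>\<tau>. parallelogram_area (\<gamma> \<tau> - \<gamma> s) (c \<tau>) / (norm (\<gamma> \<tau> - \<gamma> s))\<^sup>2) \<le> B"
proof (rule seen_length_le)
  show "\<gamma> s \<notin> \<gamma> ` {\<alpha>..1}" using inj_gamma s by force
  fix t t' ts assume *: "sorted_wrt (<) (t # t' # ts)" "set (t # t' # ts) \<subseteq> {\<alpha>..1}"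
  have "vector_angle (\<gamma> t - \<gamma> s) (\<gamma> t' - \<gamma> t) + polygon_curvature (map \<gamma> (t # t' # ts))
      = polygon_curvature (map \<gamma> (s # t # t' # ts))" by simp
  also have "\<dots> \<le> B" using * s by (intro TC) auto
  finally show "vector_angle (\<gamma> t - \<gamma> s) (\<gamma> t' - \<gamma> t) + polygon_curvature (map \<gamma> (t # t' # ts)) \<le> B" .
qed (use s in auto)

lemma seen_from_outside:
  assumes "0 \<le> \<alpha>" "\<alpha> < \<beta>" "\<beta> \<le> 1" "q \<notin> \<gamma> ` {\<alpha>..\<beta>}"
    and TC: "\<And>ts. sorted_wrt (<) ts \<Longrightarrow> set ts \<subseteq> {\<alpha>..\<beta>} \<Longrightarrow> polygon_curvature (map \<gamma> ts) \<le> \<eta>"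
  shows "integral {\<alpha>..\<beta>} (\<lambda>\<tau>. parallelogram_area (\<gamma> \<tau> - q) (c \<tau>) / (norm (\<gamma> \<tau> - q))\<^sup>2) \<le> pi + \<eta>"
  by (rule seen_length_le[OF assms(1-4)]) (intro add_mono vector_angle_le_pi TC)

lemma small_total_curvature_near:
  assumes TC: "\<And>ts. sorted_wrt (<) ts \<Longrightarrow> set ts \<subseteq> {0..1} \<Longrightarrow> polygon_curvature (map \<gamma> ts) \<le> B"
    and s: "0 \<le> s" "s < 1" and \<eta>: "\<eta> > 0"
  obtains \<epsilon> where "\<epsilon> > 0" "s + \<epsilon> \<le> 1"
    "\<And>ts. sorted_wrt (<) ts \<Longrightarrow> set ts \<subseteq> {s<..s + \<epsilon>} \<Longrightarrow> polygon_curvature (map \<gamma> ts) \<le> \<eta>"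
proof -
  let ?T = "{ts. sorted_wrt (<) ts \<and> set ts \<subseteq> {s<..1}}"
  let ?\<Sigma> = "SUP ts\<in>?T. polygon_curvature (map \<gamma> ts)"
  have bdd: "bdd_above ((\<lambda>ts. polygon_curvature (map \<gamma> ts)) ` ?T)"
  proof (rule bdd_aboveI2[of _ _ B])
    fix ts assume "ts \<in> ?T"
    then show "polygon_curvature (map \<gamma> ts) \<le> B" using s by (intro TC) auto
  qed
  have "[1] \<in> ?T" using s by auto
  then have ne: "?T \<noteq> {}" by blast
  obtain rs where rs: "rs \<in> ?T" "?\<Sigma> - \<eta> < polygon_curvature (map \<gamma> rs)"
    using less_cSUP_iff[OF ne bdd, of "?\<Sigma> - \<eta>"] \<eta> by auto
  define \<epsilon> where "\<epsilon> = (if rs = [] then 1 - s else (hd rs - s) / 2)"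
  have e: "\<epsilon> > 0" "s + \<epsilon> \<le> 1"
  proof -
    have "hd rs \<in> {s<..1}" if "rs \<noteq> []" using rs(1) that hd_in_set by blast
    then show "\<epsilon> > 0" "s + \<epsilon> \<le> 1" using s by (auto simp: \<epsilon>_def field_simps)
  qed
  have "polygon_curvature (map \<gamma> ts) \<le> \<eta>" if ts: "sorted_wrt (<) ts" "set ts \<subseteq> {s<..s + \<epsilon>}" for ts
  proof -
    have lt: "t < r" if "t \<in> set ts" "r \<in> set rs" for t r
    proof -
      have "rs \<noteq> []" using that by auto
      then have "t \<le> s + (hd rs - s) / 2" "s < hd rs" using that ts rs(1) by (auto simp: \<epsilon>_def intro: hd_in_set)
      then have "t < hd rs" by (simp add: field_simps)
      moreover have "hd rs \<le> r" using rs(1) that by (cases rs) (auto intro: less_imp_le)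
      ultimately show ?thesis by simp
    qed
    have "ts @ rs \<in> ?T" using ts rs(1) lt e by (auto simp: sorted_wrt_append)
    then have "polygon_curvature (map \<gamma> (ts @ rs)) \<le> ?\<Sigma>" using cSUP_upper[OF _ bdd] by blast
    then show ?thesis using polygon_curvature_append[of "map \<gamma> ts" "map \<gamma> rs"] rs(2) by simp
  qed
  then show thesis using that e by blast
qed

lemma gamma_lipschitz: "\<tau> \<in> {0..1} \<Longrightarrow> \<sigma> \<in> {0..1} \<Longrightarrow> norm (\<gamma> \<tau> - \<gamma> \<sigma>) \<le> K * \<bar>\<tau> - \<sigma>\<bar>"
  using vector_differentiable_bound[of "{0..1}" \<gamma> c K \<tau> \<sigma>] deriv speed by simp

end

definition arc_measure :: "real \<Rightarrow> real \<Rightarrow> real measure" where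
  "arc_measure \<alpha> \<beta> = restrict_space lborel {\<alpha>..\<beta>}"

lemma space_arc_measure [simp]: "space (arc_measure \<alpha> \<beta>) = {\<alpha>..\<beta>}"
  by (simp add: arc_measure_def space_restrict_space)

lemma finite_arc_measure: "finite_measure (arc_measure \<alpha> \<beta>)"
  by (rule finite_measureI) (simp add: arc_measure_def emeasure_restrict_space space_restrict_space emeasure_lborel_Icc_eq)

lemma measure_arc_measure: "\<alpha> \<le> \<beta> \<Longrightarrow> measure (arc_measure \<alpha> \<beta>) {\<alpha>..\<beta>} = \<beta> - \<alpha>"
  by (simp add: arc_measure_def measure_restrict_space)

lemma integral_arc_measure: "(\<integral>t. f t \<partial>arc_measure \<alpha> \<beta>) = (LINT t:{\<alpha>..\<beta>}|lborel. f t :: real)"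
  by (simp add: arc_measure_def integral_restrict_space set_lebesgue_integral_def)

lemma integrable_arc_measure:
  "integrable (arc_measure \<alpha> \<beta>) f \<longleftrightarrow> set_integrable lborel {\<alpha>..\<beta>} (f :: real \<Rightarrow> real)"
  by (simp add: arc_measure_def integrable_restrict_space set_integrable_def)

lemma integral_arc_measure_continuous:
  fixes f :: "real \<Rightarrow> real"
  assumes "continuous_on {\<alpha>..\<beta>} f"
  shows "(\<integral>t. f t \<partial>arc_measure \<alpha> \<beta>) = integral {\<alpha>..\<beta>} f"
  unfolding integral_arc_measure
  by (rule set_borel_integral_eq_integral(2)[OF borel_integrable_atLeastAtMost'[OF assms]])

lemma measurable_arc_measure_continuous:
  "continuous_on {\<alpha>..\<beta>} f \<Longrightarrow> f \<in> borel_measurable (arc_measure \<alpha> \<beta>)"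
  unfolding arc_measure_def
  by (subst measurable_cong_sets[OF sets_restrict_space_cong[OF sets_lborel] refl])
     (rule borel_measurable_continuous_on_restrict)

lemma AE_arc_measure_iff:
  "(AE t in arc_measure \<alpha> \<beta>. Q t) \<longleftrightarrow> (AE t in lborel. t \<in> {\<alpha>..\<beta>} \<longrightarrow> Q t)"
  unfolding arc_measure_def by (rule AE_restrict_space_iff) simp

lemma AE_arc_measure: "AE t in arc_measure \<alpha> \<beta>. \<alpha> < t \<and> t \<le> \<beta>"
proof -
  have "AE t in lborel. t \<noteq> \<alpha>" by (rule AE_lborel_singleton)
  then show ?thesis unfolding AE_arc_measure_iff by eventually_elim auto
qed

lemma integral_arc_measure_split:
  fixes f :: "real \<Rightarrow> real"
  assumes f: "integrable (arc_measure \<alpha> \<delta>) f" and ab: "\<alpha> \<le> \<beta>" "\<beta> \<le> \<delta>"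
  shows "(\<integral>t. f t \<partial>arc_measure \<alpha> \<delta>) = (\<integral>t. f t \<partial>arc_measure \<alpha> \<beta>) + (\<integral>t. f t \<partial>arc_measure \<beta> \<delta>)"
    and "integrable (arc_measure \<alpha> \<beta>) f" "integrable (arc_measure \<beta> \<delta>) f"
proof -
  have i: "set_integrable lborel {\<alpha>..\<delta>} f" using f by (simp add: integrable_arc_measure)
  have i1: "set_integrable lborel {\<alpha>..\<beta>} f" and i2: "set_integrable lborel {\<beta>..\<delta>} f"
    using ab by (auto intro: set_integrable_subset[OF i])
  then show "integrable (arc_measure \<alpha> \<beta>) f" "integrable (arc_measure \<beta> \<delta>) f"
    by (simp_all add: integrable_arc_measure)
  have "{\<alpha>..\<delta>} = {\<alpha>..\<beta>} \<union> {\<beta>..\<delta>}" using ab by auto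
  moreover have "AE t in lborel. \<not> (t \<in> {\<alpha>..\<beta>} \<and> t \<in> {\<beta>..\<delta>})"
    using AE_lborel_singleton[of \<beta>] by eventually_elim auto
  ultimately show "(\<integral>t. f t \<partial>arc_measure \<alpha> \<delta>) = (\<integral>t. f t \<partial>arc_measure \<alpha> \<beta>) + (\<integral>t. f t \<partial>arc_measure \<beta> \<delta>)"
    unfolding integral_arc_measure using set_integral_Un_AE[OF _ _ _ i1 i2] by auto
qed

lemma integral_le_const_arc:
  fixes f :: "real \<Rightarrow> real"
  assumes "\<alpha> \<le> \<beta>" "integrable (arc_measure \<alpha> \<beta>) f" "AE t in arc_measure \<alpha> \<beta>. f t \<le> B"
  shows "(\<integral>t. f t \<partial>arc_measure \<alpha> \<beta>) \<le> B * (\<beta> - \<alpha>)"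
proof -
  interpret finite_measure "arc_measure \<alpha> \<beta>" by (rule finite_arc_measure)
  have "(\<integral>t. f t \<partial>arc_measure \<alpha> \<beta>) \<le> (\<integral>t. B \<partial>arc_measure \<alpha> \<beta>)"
    using assms by (intro integral_mono_AE) auto
  then show ?thesis using assms(1) by (simp add: measure_arc_measure mult.commute)
qed

lemma integral_arc_limit_le:
  fixes f :: "real \<Rightarrow> real"
  assumes f: "integrable (arc_measure \<alpha> \<beta>) f" "AE t in arc_measure \<alpha> \<beta>. f t \<le> M" and ab: "\<alpha> < \<beta>"
    and B: "\<And>t. \<alpha> < t \<Longrightarrow> t < \<beta> \<Longrightarrow> (\<integral>t. f t \<partial>arc_measure t \<beta>) \<le> B"
  shows "(\<integral>t. f t \<partial>arc_measure \<alpha> \<beta>) \<le> B"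
proof -
  have "(\<integral>t. f t \<partial>arc_measure \<alpha> \<beta>) \<le> M * (t - \<alpha>) + B" if t: "\<alpha> < t" "t < \<beta>" for t
  proof -
    have "AE u in arc_measure \<alpha> t. f u \<le> M"
      using f(2) unfolding AE_arc_measure_iff by eventually_elim (use t in auto)
    then have "(\<integral>t. f t \<partial>arc_measure \<alpha> t) \<le> M * (t - \<alpha>)"
      using t integral_arc_measure_split(2)[OF f(1), of t] by (intro integral_le_const_arc) auto
    then show ?thesis using B[OF t] integral_arc_measure_split(1)[OF f(1), of t] t by simp
  qed
  then have ev: "eventually (\<lambda>t. (\<integral>t. f t \<partial>arc_measure \<alpha> \<beta>) \<le> M * (t - \<alpha>) + B) (at_right \<alpha>)"
    using ab by (auto simp: eventually_at_right_field intro!: exI[of _ \<beta>])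
  have "((\<lambda>t. M * (t - \<alpha>) + B) \<longlongrightarrow> M * (\<alpha> - \<alpha>) + B) (at_right \<alpha>)" by (intro tendsto_intros)
  then show ?thesis using tendsto_lowerbound[OF _ ev] by simp
qed

lemma integrable_limit_nonneg:
  fixes f :: "'a \<Rightarrow> real" and F :: "nat \<Rightarrow> 'a \<Rightarrow> real"
  assumes F: "\<And>k. integrable M (F k)" "\<And>k. AE x in M. 0 \<le> F k x" "\<And>k. (\<integral>x. F k x \<partial>M) \<le> B"
    and f: "f \<in> borel_measurable M" and lim: "AE x in M. (\<lambda>k. F k x) \<longlonglongrightarrow> f x"
  shows "integrable M f" "(\<integral>x. f x \<partial>M) \<le> B"
proof -
  have B: "0 \<le> B" using integral_nonneg_AE[OF F(2)[of 0]] F(3)[of 0] by linarith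
  have "AE x in M. \<forall>k. 0 \<le> F k x" using F(2) by (simp add: AE_all_countable)
  with lim have f0: "AE x in M. 0 \<le> f x"
    by eventually_elim (auto intro: LIMSEQ_le_const)
  have "(\<integral>\<^sup>+x. ennreal (f x) \<partial>M) \<le> (\<integral>\<^sup>+x. liminf (\<lambda>k. ennreal (F k x)) \<partial>M)"
  proof (rule nn_integral_mono_AE)
    show "AE x in M. ennreal (f x) \<le> liminf (\<lambda>k. ennreal (F k x))"
      using lim
    proof eventually_elim
      case (elim x)
      then have "(\<lambda>k. ennreal (F k x)) \<longlonglongrightarrow> ennreal (f x)" by (rule tendsto_ennrealI)
      then show ?case using lim_imp_Liminf by (metis order_refl trivial_limit_sequentially)
    qed
  qed
  also have "\<dots> \<le> liminf (\<lambda>k. \<integral>\<^sup>+x. ennreal (F k x) \<partial>M)"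
    by (rule nn_integral_liminf) (use F(1) in auto)
  also have "\<dots> \<le> ennreal B"
  proof -
    have "(\<integral>\<^sup>+x. ennreal (F k x) \<partial>M) \<le> ennreal B" for k
      using nn_integral_eq_integral[OF F(1) F(2)] F(3)[of k] by (simp add: ennreal_leI)
    then show ?thesis by (intro Liminf_le) (auto intro: always_eventually)
  qed
  finally have le: "(\<integral>\<^sup>+x. ennreal (f x) \<partial>M) \<le> ennreal B" .
  then have "(\<integral>\<^sup>+x. ennreal (f x) \<partial>M) < \<infinity>" using ennreal_less_top[of B] by (auto intro: le_less_trans)
  then show "integrable M f" using integrableI_nonneg[OF f f0] by auto
  then have "ennreal (\<integral>x. f x \<partial>M) \<le> ennreal B" using le nn_integral_eq_integral[OF _ f0] by simp
  then show "(\<integral>x. f x \<partial>M) \<le> B" using B by (simp add: ennreal_le_iff)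
qed

lemma AE_in_support:
  fixes V :: "'n::finite varifold"
  assumes sets: "sets V = sets borel"
  shows "AE z in V. fst z \<in> support V"
proof -
  have fst [measurable]: "fst \<in> measurable V borel"
    by (simp add: measurable_cong_sets[OF sets refl] borel_measurable_continuous_onI continuous_on_fst)
  obtain \<B> :: "(real^'n) set set" where \<B>: "countable \<B>" "topological_basis \<B>"
    using ex_countable_basis by blast
  define \<N> where "\<N> = {B\<in>\<B>. emeasure (weight V) B = 0}"
  have "AE z in V. \<forall>B\<in>\<N>. fst z \<notin> B"
  proof (subst AE_ball_countable)
    show "countable \<N>" using \<B>(1) by (auto simp: \<N>_def intro: countable_subset)
    show "\<forall>B\<in>\<N>. AE z in V. fst z \<notin> B"
    proof
      fix B assume B: "B \<in> \<N>"
      then have "open B" using \<B>(2) topological_basis_open by (auto simp: \<N>_def)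
      then have "emeasure V (fst -` B \<inter> space V) = 0"
        using B by (simp add: \<N>_def weight_def emeasure_distr)
      moreover have "fst -` B \<inter> space V \<in> sets V" using \<open>open B\<close> by measurable
      ultimately have "AE z in V. z \<notin> fst -` B \<inter> space V" by (intro AE_not_in) (auto simp: null_sets_def)
      then show "AE z in V. fst z \<notin> B" by (auto elim!: AE_mp)
    qed
  qed
  then show ?thesis
  proof eventually_elim
    case (elim z)
    show ?case
    proof (rule ccontr)
      assume "fst z \<notin> support V"
      then obtain r where r: "r > 0" "emeasure (weight V) (ball (fst z) r) = 0"
        by (auto simp: support_def not_less)
      obtain B where B: "B \<in> \<B>" "fst z \<in> B" "B \<subseteq> ball (fst z) r"
        using topological_basisE[OF \<B>(2) open_ball, of "fst z" "fst z" r] r(1) by (metis centre_in_ball)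
      have "emeasure (weight V) B \<le> emeasure (weight V) (ball (fst z) r)"
        by (intro emeasure_mono B(3)) (simp add: weight_def)
      then have "B \<in> \<N>" using r(2) B(1) by (simp add: \<N>_def)
      then show False using elim B(2) by blast
    qed
  qed
qed

lemma has_derivative_radial_weight:
  fixes W :: "'a::euclidean_space \<Rightarrow> 'b::real_normed_vector"
  assumes W: "(W has_derivative W') (at x)"
    and \<phi>: "(\<phi> has_real_derivative d) (at ((norm (x - p))\<^sup>2))"
  shows "((\<lambda>x. \<phi> ((norm (x - p))\<^sup>2) *\<^sub>R W x) has_derivative
     (\<lambda>h. (2 * d * ((x - p) \<bullet> h)) *\<^sub>R W x + \<phi> ((norm (x - p))\<^sup>2) *\<^sub>R W' h)) (at x)"
proof -
  have sq: "((\<lambda>x. (norm (x - p))\<^sup>2) has_derivative (\<lambda>h. 2 * ((x - p) \<bullet> h))) (at x)"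
    unfolding power2_norm_eq_inner
    by (auto intro!: derivative_eq_intros simp: inner_commute algebra_simps)
  have "((\<lambda>x. \<phi> ((norm (x - p))\<^sup>2)) has_derivative (\<lambda>h. 2 * d * ((x - p) \<bullet> h))) (at x)"
    using has_derivative_compose[OF sq \<phi>[unfolded has_field_derivative_def]]
    by (simp add: mult_ac)
  from has_derivative_scaleR[OF this W] show ?thesis by (simp add: add.commute)
qed

lemma tangential_div_radial_weight:
  assumes "P \<in> planes"
  shows "tangential_div P (\<lambda>h. (2 * d * (y \<bullet> h)) *\<^sub>R w + f *\<^sub>R A h)
     = f * tangential_div P A + 2 * d * (y \<bullet> (P *v w))"
proof -
  have "tangential_div P (\<lambda>h. (2 * d * (y \<bullet> h)) *\<^sub>R w) = 2 * d * (y \<bullet> (P *v w))"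
    using tangential_div_scaleR[of P "2 * d" "\<lambda>h. (y \<bullet> h) *\<^sub>R w"] tangential_div_rank1[OF assms, of y w] by simp
  then show ?thesis by (simp add: tangential_div_add tangential_div_scaleR)
qed

locale varifold_arc = regular_arc \<gamma> c C K m + V: finite_measure V
  for \<gamma> c :: "real \<Rightarrow> real^'n::finite" and C K m and V :: "'n varifold" +
  fixes R :: real
  assumes sets_V: "sets V = sets borel"
    and planes_AE: "AE z in V. snd z \<in> planes"
    and bounded_AE: "AE z in V. norm (fst z) \<le> R"
begin

abbreviation D :: "real^'n \<Rightarrow> (real^'n) \<times> (real^'n^'n) \<Rightarrow> real" where
  "D p z \<equiv> norm (fst z - p)"

definition perp :: "real^'n \<Rightarrow> (real^'n) \<times> (real^'n^'n) \<Rightarrow> real" where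
  "perp p z = norm ((fst z - p) - snd z *v (fst z - p))"

definition bounded_by_arc :: "real \<Rightarrow> bool" where
  "bounded_by_arc s \<longleftrightarrow> (\<forall>X. smooth X \<longrightarrow>
     (\<integral>z. tangential_div (snd z) (frechet_derivative X (at (fst z))) \<partial>V)
       \<le> (\<integral>\<tau>. parallelogram_area (X (\<gamma> \<tau>)) (c \<tau>) \<partial>arc_measure s 1))"

lemma space_V: "space V = UNIV"
  using sets_eq_imp_space_eq[OF sets_V] by simp

lemma measurable_fst_V [measurable]: "fst \<in> measurable V borel"
  by (simp add: measurable_cong_sets[OF sets_V refl] borel_measurable_continuous_onI continuous_on_fst)

lemma measurable_snd_V: "snd \<in> measurable V borel"
  by (simp add: measurable_cong_sets[OF sets_V refl] borel_measurable_continuous_onI continuous_on_snd)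

lemma measurable_plane_apply [measurable (raw)]:
  assumes "f \<in> measurable V borel"
  shows "(\<lambda>z. snd z *v (f z :: real^'n)) \<in> measurable V borel"
  by (rule borel_measurable_continuous_Pair[OF measurable_snd_V assms])
     (intro continuous_on_mult_vec continuous_intros)

lemma measurable_perp [measurable]: "perp p \<in> borel_measurable V"
  unfolding perp_def by measurable

lemma perp_nonneg [simp]: "0 \<le> perp p z" by (simp add: perp_def)

lemma perp_sq: "snd z \<in> planes \<Longrightarrow> (perp p z)\<^sup>2 = (D p z)\<^sup>2 - (fst z - p) \<bullet> (snd z *v (fst z - p))"
  by (simp add: perp_def plane_perp_sq)

lemma perp_le: "snd z \<in> planes \<Longrightarrow> perp p z \<le> D p z"
  by (simp add: perp_def plane_perp_le)

lemma first_variation: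
  assumes s: "bounded_by_arc s" and X: "smooth X" and X': "\<And>x. (X has_derivative X' x) (at x)"
    and g: "g \<in> borel_measurable V" "\<And>z. snd z \<in> planes \<Longrightarrow> tangential_div (snd z) (X' (fst z)) = g z"
  shows "integrable V g" and "(\<integral>z. g z \<partial>V) \<le> (\<integral>\<tau>. parallelogram_area (X (\<gamma> \<tau>)) (c \<tau>) \<partial>arc_measure s 1)"
proof -
  have fd: "frechet_derivative X (at x) = X' x" for x using frechet_derivative_at[OF X'] by simp
  let ?d = "\<lambda>z. tangential_div (snd z) (frechet_derivative X (at (fst z)))"
  have eq: "AE z in V. ?d z = g z" using planes_AE by eventually_elim (simp add: fd g(2))
  obtain B where B: "B > 0" "\<And>x h. norm x \<le> R \<Longrightarrow> norm (X' x h) \<le> B * norm h"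
    using smooth_derivative_bound[OF X compact_cball[of 0 R]] fd by (auto simp: mem_cball dist_norm)
  have lin: "linear (X' x)" for x using X' has_derivative_linear by blast
  show int: "integrable V g"
  proof (rule V.integrable_const_bound[OF _ g(1), of "2 * B"])
    show "AE z in V. norm (g z) \<le> 2 * B"
      using planes_AE bounded_AE
    proof eventually_elim
      case (elim z)
      show ?case using tangential_div_bound[OF elim(1) lin B(2)[OF elim(2)]] g(2)[OF elim(1)] by simp
    qed
  qed
  have "(\<integral>z. g z \<partial>V) = (\<integral>z. ?d z \<partial>V)"
    by (intro integral_cong_AE g(1) measurable_tangential_div[OF sets_V X]) (use eq in auto)
  also have "\<dots> \<le> (\<integral>\<tau>. parallelogram_area (X (\<gamma> \<tau>)) (c \<tau>) \<partial>arc_measure s 1)"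
    using s X by (simp add: bounded_by_arc_def)
  finally show "(\<integral>z. g z \<partial>V) \<le> (\<integral>\<tau>. parallelogram_area (X (\<gamma> \<tau>)) (c \<tau>) \<partial>arc_measure s 1)" .
qed

lemma measurable_gamma: "0 \<le> s \<Longrightarrow> t \<le> 1 \<Longrightarrow> \<gamma> \<in> borel_measurable (arc_measure s t)"
  by (intro measurable_arc_measure_continuous continuous_on_subset[OF \<gamma>_cont]) auto

lemma measurable_c: "0 \<le> s \<Longrightarrow> t \<le> 1 \<Longrightarrow> c \<in> borel_measurable (arc_measure s t)"
  by (intro measurable_arc_measure_continuous continuous_on_subset[OF c_cont]) auto

lemma measurable_area [measurable (raw)]:
  fixes f g :: "'b \<Rightarrow> real^'n"
  assumes "f \<in> borel_measurable N" "g \<in> borel_measurable N"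
  shows "(\<lambda>x. parallelogram_area (f x) (g x)) \<in> borel_measurable N"
  unfolding parallelogram_area_def using assms by measurable

lemma integrable_arc_bounded:
  fixes f :: "real \<Rightarrow> real"
  assumes "f \<in> borel_measurable (arc_measure s t)" "\<And>\<tau>. s < \<tau> \<Longrightarrow> \<tau> \<le> t \<Longrightarrow> \<bar>f \<tau>\<bar> \<le> B"
  shows "integrable (arc_measure s t) f"
proof -
  interpret N: finite_measure "arc_measure s t" by (rule finite_arc_measure)
  have "AE \<tau> in arc_measure s t. norm (f \<tau>) \<le> B"
    using AE_arc_measure[of s t] by eventually_elim (use assms(2) in auto)
  from N.integrable_const_bound[OF this assms(1)] show ?thesis .
qed

definition newton :: "real^'n \<Rightarrow> real \<Rightarrow> real^'n \<Rightarrow> real^'n" where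
  "newton p \<rho> x = (1 / ((norm (x - p))\<^sup>2 + \<rho>\<^sup>2)) *\<^sub>R (x - p)"

definition newton_deriv :: "real^'n \<Rightarrow> real \<Rightarrow> real^'n \<Rightarrow> real^'n \<Rightarrow> real^'n" where
  "newton_deriv p \<rho> x h = (2 * (- 1 / ((norm (x - p))\<^sup>2 + \<rho>\<^sup>2)\<^sup>2) * ((x - p) \<bullet> h)) *\<^sub>R (x - p)
     + (1 / ((norm (x - p))\<^sup>2 + \<rho>\<^sup>2)) *\<^sub>R h"

lemma smooth_newton: "\<rho> \<noteq> 0 \<Longrightarrow> smooth (newton p \<rho>)"
  unfolding newton_def
  by (intro smooth_scaleR smooth_divide smooth_add smooth_norm_sq smooth_diff smooth_ident smooth_const) auto

lemma has_derivative_newton: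
  assumes "\<rho> \<noteq> 0"
  shows "(newton p \<rho> has_derivative newton_deriv p \<rho> x) (at x)"
proof -
  have "(norm (x - p))\<^sup>2 + \<rho>\<^sup>2 > 0" using assms by (simp add: add_nonneg_pos)
  then show ?thesis unfolding newton_def[abs_def] newton_deriv_def[abs_def]
    by (intro has_derivative_radial_weight)
       (auto intro!: derivative_eq_intros simp: power2_eq_square)
qed

lemma tangential_div_newton:
  assumes z: "snd z \<in> planes" and \<rho>: "\<rho> \<noteq> 0"
  shows "tangential_div (snd z) (newton_deriv p \<rho> (fst z)) = 2 * (\<rho>\<^sup>2 + (perp p z)\<^sup>2) / ((D p z)\<^sup>2 + \<rho>\<^sup>2)\<^sup>2"
proof -
  have nz: "(D p z)\<^sup>2 + \<rho>\<^sup>2 \<noteq> 0" using \<rho> by (simp add: sum_power2_eq_zero_iff)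
  have *: "2 / Q - 2 * (a - n) / Q\<^sup>2 = 2 * (b + n) / Q\<^sup>2" if "Q = a + b" "Q \<noteq> 0" for a b n Q :: real
  proof -
    have "2 / Q = 2 * Q / Q\<^sup>2" using that(2) by (simp add: power2_eq_square)
    then show ?thesis using that(1) by (simp add: diff_divide_distrib[symmetric] algebra_simps)
  qed
  have "tangential_div (snd z) (newton_deriv p \<rho> (fst z)) = 2 / ((D p z)\<^sup>2 + \<rho>\<^sup>2)
     - 2 * ((D p z)\<^sup>2 - (perp p z)\<^sup>2) / ((D p z)\<^sup>2 + \<rho>\<^sup>2)\<^sup>2"
    unfolding newton_deriv_def[abs_def] tangential_div_radial_weight[OF z] tangential_div_ident[OF z] perp_sq[OF z] by simp
  then show ?thesis unfolding *[OF refl nz] .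
qed

lemma area_newton:
  "parallelogram_area (newton p \<rho> x) v = parallelogram_area (x - p) v / ((norm (x - p))\<^sup>2 + \<rho>\<^sup>2)"
  unfolding newton_def parallelogram_area_scale_left by (simp add: abs_of_nonneg)

lemma monotonicity:
  assumes s: "bounded_by_arc s" and \<rho>: "\<rho> > 0"
  shows "integrable V (\<lambda>z. 2 * (\<rho>\<^sup>2 + (perp p z)\<^sup>2) / ((D p z)\<^sup>2 + \<rho>\<^sup>2)\<^sup>2)" (is "integrable V ?g")
    and "(\<integral>z. 2 * (\<rho>\<^sup>2 + (perp p z)\<^sup>2) / ((D p z)\<^sup>2 + \<rho>\<^sup>2)\<^sup>2 \<partial>V)
       \<le> (\<integral>\<tau>. parallelogram_area (\<gamma> \<tau> - p) (c \<tau>) / ((norm (\<gamma> \<tau> - p))\<^sup>2 + \<rho>\<^sup>2) \<partial>arc_measure s 1)"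
proof -
  have nz: "\<rho> \<noteq> 0" using \<rho> by simp
  have meas: "?g \<in> borel_measurable V" by measurable
  show "integrable V ?g"
    by (rule first_variation(1)[OF s smooth_newton[OF nz] has_derivative_newton[OF nz] meas tangential_div_newton[OF _ nz]])
  show "(\<integral>z. ?g z \<partial>V) \<le> (\<integral>\<tau>. parallelogram_area (\<gamma> \<tau> - p) (c \<tau>) / ((norm (\<gamma> \<tau> - p))\<^sup>2 + \<rho>\<^sup>2) \<partial>arc_measure s 1)"
    using first_variation(2)[OF s smooth_newton[OF nz] has_derivative_newton[OF nz] meas tangential_div_newton[OF _ nz]]
    unfolding area_newton .
qed

definition \<Lambda> :: real where "\<Lambda> = C * K / m\<^sup>2"

lemma \<Lambda>_nonneg: "0 \<le> \<Lambda>" using C0 K0 by (simp add: \<Lambda>_def)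

lemma monotonicity_on_arc:
  assumes s: "bounded_by_arc s" "0 \<le> s" "s \<le> 1" and \<rho>: "\<rho> > 0" and \<sigma>: "\<sigma> \<in> {0..1}"
  shows "(\<integral>z. 2 * (\<rho>\<^sup>2 + (perp (\<gamma> \<sigma>) z)\<^sup>2) / ((D (\<gamma> \<sigma>) z)\<^sup>2 + \<rho>\<^sup>2)\<^sup>2 \<partial>V) \<le> \<Lambda>"
proof -
  let ?f = "\<lambda>\<tau>. parallelogram_area (\<gamma> \<tau> - \<gamma> \<sigma>) (c \<tau>) / ((norm (\<gamma> \<tau> - \<gamma> \<sigma>))\<^sup>2 + \<rho>\<^sup>2)"
  note [measurable] = measurable_gamma[OF s(2) order_refl] measurable_c[OF s(2) order_refl]
  have le: "\<bar>?f \<tau>\<bar> \<le> \<Lambda>" if "s < \<tau>" "\<tau> \<le> 1" for \<tau>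
  proof (cases "\<gamma> \<tau> = \<gamma> \<sigma>")
    case True
    then show ?thesis using \<Lambda>_nonneg by (simp add: parallelogram_area_def)
  next
    case False
    then have "?f \<tau> \<le> parallelogram_area (\<gamma> \<tau> - \<gamma> \<sigma>) (c \<tau>) / (norm (\<gamma> \<tau> - \<gamma> \<sigma>))\<^sup>2"
      by (intro divide_left_mono mult_pos_pos add_pos_nonneg) auto
    also have "\<dots> \<le> \<Lambda>" unfolding \<Lambda>_def by (rule area_over_sq) (use that s \<sigma> in auto)
    finally show ?thesis by simp
  qed
  have "?f \<in> borel_measurable (arc_measure s 1)" by measurable
  from integrable_arc_bounded[OF this le] have i: "integrable (arc_measure s 1) ?f" .
  have "(\<integral>\<tau>. ?f \<tau> \<partial>arc_measure s 1) \<le> \<Lambda> * (1 - s)"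
    by (rule integral_le_const_arc[OF s(3) i])
       (use AE_arc_measure[of s 1] in \<open>eventually_elim, use le in fastforce\<close>)
  also have "\<dots> \<le> \<Lambda> * 1" using s \<Lambda>_nonneg by (intro mult_left_mono) auto
  finally show ?thesis using monotonicity(2)[OF s(1) \<rho>, of "\<gamma> \<sigma>"] by simp
qed

lemma perp_energy:
  assumes s: "bounded_by_arc s" "0 \<le> s" "s \<le> 1" and \<sigma>: "\<sigma> \<in> {0..1}"
  shows "integrable V (\<lambda>z. (perp (\<gamma> \<sigma>) z)\<^sup>2 / (D (\<gamma> \<sigma>) z) ^ 4)"
proof -
  let ?p = "\<gamma> \<sigma>" and ?r = "\<lambda>k::nat. 1 / real (Suc k)"
  have "integrable V (\<lambda>z. 2 * (perp ?p z)\<^sup>2 / (D ?p z) ^ 4)"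
  proof (rule integrable_limit_nonneg(1)[where F="\<lambda>k z. 2 * (perp ?p z)\<^sup>2 / ((D ?p z)\<^sup>2 + (?r k)\<^sup>2)\<^sup>2" and B=\<Lambda>])
    fix k
    have r: "?r k > 0" by simp
    have le: "2 * (perp ?p z)\<^sup>2 / ((D ?p z)\<^sup>2 + (?r k)\<^sup>2)\<^sup>2
        \<le> 2 * ((?r k)\<^sup>2 + (perp ?p z)\<^sup>2) / ((D ?p z)\<^sup>2 + (?r k)\<^sup>2)\<^sup>2" for z
      by (intro divide_right_mono) auto
    show i: "integrable V (\<lambda>z. 2 * (perp ?p z)\<^sup>2 / ((D ?p z)\<^sup>2 + (?r k)\<^sup>2)\<^sup>2)"
    proof (rule Bochner_Integration.integrable_bound[OF monotonicity(1)[OF s(1) r, of ?p]])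
      show "AE z in V. norm (2 * (perp ?p z)\<^sup>2 / ((D ?p z)\<^sup>2 + (?r k)\<^sup>2)\<^sup>2)
          \<le> norm (2 * ((?r k)\<^sup>2 + (perp ?p z)\<^sup>2) / ((D ?p z)\<^sup>2 + (?r k)\<^sup>2)\<^sup>2)"
        using le by (intro AE_I2) (subst (1 2) real_norm_def, subst (1 2) abs_of_nonneg, auto)
    qed measurable
    show "(\<integral>z. 2 * (perp ?p z)\<^sup>2 / ((D ?p z)\<^sup>2 + (?r k)\<^sup>2)\<^sup>2 \<partial>V) \<le> \<Lambda>"
      using integral_mono[OF i monotonicity(1)[OF s(1) r, of ?p] le] monotonicity_on_arc[OF s r \<sigma>] by linarith
  next
    have lim0: "(\<lambda>k. (?r k)\<^sup>2) \<longlonglongrightarrow> 0\<^sup>2"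
      by (intro tendsto_intros LIMSEQ_inverse_real_of_nat[unfolded inverse_eq_divide])
    show "AE z in V. (\<lambda>k. 2 * (perp ?p z)\<^sup>2 / ((D ?p z)\<^sup>2 + (?r k)\<^sup>2)\<^sup>2) \<longlonglongrightarrow> 2 * (perp ?p z)\<^sup>2 / (D ?p z) ^ 4"
      using planes_AE
    proof eventually_elim
      case (elim z)
      show ?case
      proof (cases "D ?p z = 0")
        case True
        then have "perp ?p z = 0" using perp_le[OF elim, of ?p] perp_nonneg[of ?p z] by linarith
        then show ?thesis by simp
      next
        case False
        have "(\<lambda>k. 2 * (perp ?p z)\<^sup>2 / ((D ?p z)\<^sup>2 + (?r k)\<^sup>2)\<^sup>2) \<longlonglongrightarrow> 2 * (perp ?p z)\<^sup>2 / ((D ?p z)\<^sup>2 + 0\<^sup>2)\<^sup>2"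
          using False by (intro tendsto_intros lim0) auto
        then show ?thesis by (simp flip: power_mult)
      qed
    qed
  qed auto
  from integrable_mult_right[OF this, of "1/2"] show ?thesis by simp
qed

lemma measure_ball_on_arc:
  assumes s: "bounded_by_arc s" "0 \<le> s" "s \<le> 1" and \<rho>: "\<rho> > 0" and \<sigma>: "\<sigma> \<in> {0..1}"
  shows "measure V {z. D (\<gamma> \<sigma>) z \<le> \<rho>} \<le> 2 * \<Lambda> * \<rho>\<^sup>2"
proof -
  let ?A = "{z. D (\<gamma> \<sigma>) z \<le> \<rho>}"
  have A: "?A \<in> sets V"
  proof -
    have "{z \<in> space V. D (\<gamma> \<sigma>) z \<le> \<rho>} \<in> sets V" by measurable
    then show ?thesis by (simp add: space_V)
  qed
  have "1 / (2 * \<rho>\<^sup>2) * measure V ?A = (\<integral>z. 1 / (2 * \<rho>\<^sup>2) * indicator ?A z \<partial>V)"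
    using A by simp
  also have "\<dots> \<le> (\<integral>z. 2 * (\<rho>\<^sup>2 + (perp (\<gamma> \<sigma>) z)\<^sup>2) / ((D (\<gamma> \<sigma>) z)\<^sup>2 + \<rho>\<^sup>2)\<^sup>2 \<partial>V)"
  proof (rule integral_mono[OF _ monotonicity(1)[OF s(1) \<rho>]])
    show "integrable V (\<lambda>z. 1 / (2 * \<rho>\<^sup>2) * indicator ?A z)"
      using A by (intro integrable_mult_right integrable_real_indicator) (auto simp: V.emeasure_eq_measure)
    fix z
    show "1 / (2 * \<rho>\<^sup>2) * indicator ?A z \<le> 2 * (\<rho>\<^sup>2 + (perp (\<gamma> \<sigma>) z)\<^sup>2) / ((D (\<gamma> \<sigma>) z)\<^sup>2 + \<rho>\<^sup>2)\<^sup>2"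
    proof (cases "z \<in> ?A")
      case True
      then have "(D (\<gamma> \<sigma>) z)\<^sup>2 \<le> \<rho>\<^sup>2" by (intro power_mono) auto
      then have "((D (\<gamma> \<sigma>) z)\<^sup>2 + \<rho>\<^sup>2)\<^sup>2 \<le> (2 * \<rho>\<^sup>2)\<^sup>2" by (intro power_mono) auto
      then have "2 * \<rho>\<^sup>2 / (2 * \<rho>\<^sup>2)\<^sup>2 \<le> 2 * (\<rho>\<^sup>2 + (perp (\<gamma> \<sigma>) z)\<^sup>2) / ((D (\<gamma> \<sigma>) z)\<^sup>2 + \<rho>\<^sup>2)\<^sup>2"
        using \<rho> by (intro frac_le) (auto intro!: zero_less_power add_nonneg_pos)
      moreover have "2 * \<rho>\<^sup>2 / (2 * \<rho>\<^sup>2)\<^sup>2 = 1 / (2 * \<rho>\<^sup>2)" using \<rho> by (simp add: power2_eq_square)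
      ultimately show ?thesis using True by simp
    qed auto
  qed
  also have "\<dots> \<le> \<Lambda>" by (rule monotonicity_on_arc[OF s \<rho> \<sigma>])
  finally show ?thesis using \<rho> by (simp add: field_simps)
qed

lemma arc_null:
  assumes s: "bounded_by_arc s" "0 \<le> s" "s \<le> 1"
  shows "AE z in V. fst z \<notin> \<gamma> ` {0..1}"
proof -
  let ?A = "{z::(real^'n) \<times> (real^'n^'n). fst z \<in> \<gamma> ` {0..1}}"
  have "closed (\<gamma> ` {0..1})" by (intro compact_imp_closed compact_continuous_image \<gamma>_cont) auto
  then have [measurable]: "\<gamma> ` {0..1} \<in> sets borel" by (rule borel_closed)
  have "{z \<in> space V. fst z \<in> \<gamma> ` {0..1}} \<in> sets V" by measurable
  then have A: "?A \<in> sets V" by (simp add: space_V)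
  define L where "L = K + 1"
  have L: "L > 0" using K0 by (simp add: L_def)
  have bound: "measure V ?A \<le> 4 * \<Lambda> * L\<^sup>2 * (1 / real (Suc k))" for k
  proof -
    let ?n = "Suc k"
    let ?B = "\<lambda>i. {z. D (\<gamma> (real i / ?n)) z \<le> L / ?n}"
    have Bs: "?B i \<in> sets V" for i
    proof -
      have "{z \<in> space V. D (\<gamma> (real i / ?n)) z \<le> L / ?n} \<in> sets V" by measurable
      then show ?thesis by (simp add: space_V)
    qed
    have "?A \<subseteq> (\<Union>i\<in>{..?n}. ?B i)"
    proof
      fix z assume "z \<in> ?A"
      then obtain \<tau> where \<tau>: "\<tau> \<in> {0..1}" "fst z = \<gamma> \<tau>" by auto
      define i where "i = nat \<lfloor>\<tau> * ?n\<rfloor>"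
      have i: "real i \<le> \<tau> * ?n" "\<tau> * ?n < real i + 1" using \<tau>(1) by (auto simp: i_def)
      have "\<tau> * ?n \<le> 1 * real ?n" using \<tau>(1) by (intro mult_right_mono) auto
      with i(1) have "real i \<le> 1 * real ?n" by (rule order_trans)
      then have "real i \<le> real ?n" by (simp only: mult_1)
      then have ile: "i \<le> ?n" by (simp only: of_nat_le_iff)
      have "\<bar>t - x / N\<bar> \<le> 1 / N" if "N > 0" "x \<le> t * N" "t * N < x + 1" for t x N :: real
      proof -
        have "t - x / N = (t * N - x) / N" using that(1) by (simp add: diff_divide_distrib)
        then show ?thesis using that by (simp add: abs_of_nonneg divide_right_mono)
      qed
      from this[OF _ i] have "\<bar>\<tau> - real i / ?n\<bar> \<le> 1 / ?n" by simp
      moreover have "norm (\<gamma> \<tau> - \<gamma> (real i / ?n)) \<le> K * \<bar>\<tau> - real i / ?n\<bar>"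
        using \<tau>(1) ile by (intro gamma_lipschitz) auto
      ultimately have "norm (\<gamma> \<tau> - \<gamma> (real i / ?n)) \<le> L * (1 / ?n)"
        using K0 by (smt (verit) L_def mult_mono abs_ge_zero)
      then show "z \<in> (\<Union>i\<in>{..?n}. ?B i)" using \<tau>(2) ile by auto
    qed
    then have "measure V ?A \<le> measure V (\<Union>i\<in>{..?n}. ?B i)" using Bs by (intro V.finite_measure_mono) auto
    also have "\<dots> \<le> (\<Sum>i\<in>{..?n}. measure V (?B i))" using Bs by (intro V.finite_measure_subadditive_finite) auto
    also have "\<dots> \<le> (\<Sum>i\<in>{..?n}. 2 * \<Lambda> * (L / ?n)\<^sup>2)"
      using L by (intro sum_mono measure_ball_on_arc[OF s]) (auto simp: divide_le_eq)
    also have "\<dots> = (real ?n + 1) * (2 * \<Lambda> * (L / ?n)\<^sup>2)" by simp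
    also have "\<dots> \<le> (2 * real ?n) * (2 * \<Lambda> * (L / ?n)\<^sup>2)"
      using \<Lambda>_nonneg by (intro mult_right_mono) auto
    also have "\<dots> = 4 * \<Lambda> * L\<^sup>2 * (1 / real ?n)"
    proof -
      have "(2 * N) * (2 * \<Lambda> * (L / N)\<^sup>2) = 4 * \<Lambda> * L\<^sup>2 * (1 / N)" if "N > 0" for N :: real
        using that by (simp add: power2_eq_square)
      from this[of "real ?n"] show ?thesis by (simp only: of_nat_0_less_iff zero_less_Suc)
    qed
    finally show ?thesis .
  qed
  have "(\<lambda>k. 4 * \<Lambda> * L\<^sup>2 * (1 / real (Suc k))) \<longlonglongrightarrow> 4 * \<Lambda> * L\<^sup>2 * 0"
    by (intro tendsto_intros LIMSEQ_inverse_real_of_nat[unfolded inverse_eq_divide])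
  from LIMSEQ_le_const[OF this] bound have "measure V ?A \<le> 0" by auto
  then have "emeasure V ?A = 0" using measure_nonneg[of V ?A] by (simp add: V.emeasure_eq_measure)
  then have "?A \<in> null_sets V" using A by auto
  from AE_not_in[OF this] show ?thesis by simp
qed

end

lemma DERIV_inverse_shift:
  fixes t r :: real
  assumes "t + r > 0"
  shows "((\<lambda>t. (inverse (t + r))\<^sup>2) has_real_derivative - 2 * inverse (t + r) ^ 3) (at t)"
proof -
  have "((\<lambda>t. inverse (t + r)) has_real_derivative - (inverse (t + r) * 1 * inverse (t + r))) (at t)"
    using assms by (intro DERIV_inverse' derivative_eq_intros) auto
  from DERIV_power[OF this, of 2] show ?thesis by (simp add: power3_eq_cube mult_ac)
qed

lemma DERIV_density_kernel:
  fixes t r :: real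
  assumes "t + r > 0"
  shows "((\<lambda>t. - 2 * r / (t + r)\<^sup>2) has_real_derivative 4 * r / (t + r) ^ 3) (at t)"
    and "((\<lambda>t. 2 * t\<^sup>2 / (t + r)\<^sup>2) has_real_derivative t * (4 * r / (t + r) ^ 3)) (at t)"
proof -
  show "((\<lambda>t. - 2 * r / (t + r)\<^sup>2) has_real_derivative 4 * r / (t + r) ^ 3) (at t)"
    using DERIV_cmult[OF DERIV_inverse_shift[OF assms], of "- 2 * r"]
    by (simp add: divide_inverse power_inverse mult_ac)
  define i where "i = inverse (t + r)"
  have i: "i * (t + r) = 1" using assms by (simp add: i_def)
  have "((\<lambda>t. 2 * t\<^sup>2) has_real_derivative 4 * t) (at t)" by (auto intro!: derivative_eq_intros)
  from DERIV_mult[OF this DERIV_inverse_shift[OF assms]]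
  have "((\<lambda>t. 2 * t\<^sup>2 * (inverse (t + r))\<^sup>2) has_real_derivative 4 * t * i\<^sup>2 - 2 * i ^ 3 * (2 * t\<^sup>2)) (at t)"
    by (simp add: i_def)
  moreover have "4 * t * i\<^sup>2 - 2 * i ^ 3 * (2 * t\<^sup>2) = t * (4 * r * i ^ 3)"
  proof -
    have "4 * t * i\<^sup>2 - 2 * i ^ 3 * (2 * t\<^sup>2) = 4 * t * i\<^sup>2 * (i * (t + r)) - 2 * i ^ 3 * (2 * t\<^sup>2)" by (simp add: i)
    also have "\<dots> = t * (4 * r * i ^ 3)" by (simp add: power2_eq_square power3_eq_cube algebra_simps)
    finally show ?thesis .
  qed
  ultimately show "((\<lambda>t. 2 * t\<^sup>2 / (t + r)\<^sup>2) has_real_derivative t * (4 * r / (t + r) ^ 3)) (at t)"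
    by (simp add: divide_inverse power_inverse i_def)
qed

lemma kernel_bound:
  fixes x \<rho> :: real
  assumes "\<rho> > 0"
  shows "2 * \<rho>\<^sup>2 / (x\<^sup>2 + \<rho>\<^sup>2)\<^sup>2 \<le> 2 / \<rho>\<^sup>2"
proof -
  have "(\<rho>\<^sup>2)\<^sup>2 \<le> (x\<^sup>2 + \<rho>\<^sup>2)\<^sup>2" by (intro power_mono) auto
  then have "2 * \<rho>\<^sup>2 / (x\<^sup>2 + \<rho>\<^sup>2)\<^sup>2 \<le> 2 * \<rho>\<^sup>2 / (\<rho>\<^sup>2)\<^sup>2"
    using assms by (intro divide_left_mono) (auto intro!: mult_pos_pos zero_less_power add_nonneg_pos)
  then show ?thesis using assms by (simp add: power2_eq_square)
qed

context varifold_arc begin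

lemma weight_cball: "measure (weight V) (cball p r) = measure V {z. D p z \<le> r}"
proof -
  have "fst -` cball p r \<inter> space V = {z. D p z \<le> r}"
    by (auto simp: space_V dist_norm norm_minus_commute)
  then show ?thesis unfolding weight_def by (subst measure_distr) auto
qed

lemma sets_ball [measurable]: "{z. D p z \<le> r} \<in> sets V"
proof -
  have "{z \<in> space V. D p z \<le> r} \<in> sets V" by measurable
  then show ?thesis by (simp add: space_V)
qed

lemma integrable_kernel:
  assumes "\<rho> > 0"
  shows "integrable V (\<lambda>z. 2 * \<rho>\<^sup>2 / ((D p z)\<^sup>2 + \<rho>\<^sup>2)\<^sup>2)"
proof (rule V.integrable_const_bound[of _ "2 / \<rho>\<^sup>2"])
  show "AE z in V. norm (2 * \<rho>\<^sup>2 / ((D p z)\<^sup>2 + \<rho>\<^sup>2)\<^sup>2) \<le> 2 / \<rho>\<^sup>2"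
    using kernel_bound[OF assms] by (intro AE_I2) auto
qed measurable

lemma density_kernel_bound:
  assumes dens: "\<And>r. 0 < r \<Longrightarrow> r \<le> \<delta> \<Longrightarrow> b * (pi * r\<^sup>2) \<le> measure V {z. D p z \<le> r}"
    and pos: "0 < \<delta>" "0 < \<rho>" "0 \<le> b"
  shows "b * (2 * pi * (\<delta>\<^sup>2)\<^sup>2 / (\<delta>\<^sup>2 + \<rho>\<^sup>2)\<^sup>2) \<le> (\<integral>z. 2 * \<rho>\<^sup>2 / ((D p z)\<^sup>2 + \<rho>\<^sup>2)\<^sup>2 \<partial>V)"
proof -
  interpret pair_sigma_finite V lborel ..
  have nz: "t + \<rho>\<^sup>2 > 0" if "t \<ge> 0" for t using that pos by (simp add: add_nonneg_pos)
  define h where "h t = 4 * \<rho>\<^sup>2 / (t + \<rho>\<^sup>2) ^ 3" for t :: real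
  have h0: "0 \<le> h t" if "0 \<le> t" for t using nz[OF that] by (simp add: h_def)
  have hm [measurable]: "h \<in> borel_measurable borel" unfolding h_def by measurable
  let ?F = "\<lambda>z t. ennreal (if (D p z)\<^sup>2 \<le> t \<and> t \<le> \<delta>\<^sup>2 then h t else 0)"
  let ?g = "\<lambda>z. 2 * \<rho>\<^sup>2 / ((D p z)\<^sup>2 + \<rho>\<^sup>2)\<^sup>2"
  have meas [measurable]: "case_prod ?F \<in> borel_measurable (V \<Otimes>\<^sub>M lborel)" by measurable
  have inner: "(\<integral>\<^sup>+t. ?F z t \<partial>lborel) \<le> ennreal (?g z)" for z
  proof (cases "(D p z)\<^sup>2 \<le> \<delta>\<^sup>2")
    case True
    have "(\<integral>\<^sup>+t. ?F z t \<partial>lborel) = (\<integral>\<^sup>+t. ennreal (h t) * indicator {(D p z)\<^sup>2..\<delta>\<^sup>2} t \<partial>lborel)"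
      by (intro nn_integral_cong) (auto simp: indicator_def)
    also have "\<dots> = ennreal ((- 2 * \<rho>\<^sup>2 / (\<delta>\<^sup>2 + \<rho>\<^sup>2)\<^sup>2) - (- 2 * \<rho>\<^sup>2 / ((D p z)\<^sup>2 + \<rho>\<^sup>2)\<^sup>2))"
    proof (rule nn_integral_FTC_Icc[where F="\<lambda>t. - 2 * \<rho>\<^sup>2 / (t + \<rho>\<^sup>2)\<^sup>2"])
      fix t assume "t \<in> {(D p z)\<^sup>2..\<delta>\<^sup>2}"
      then have t0: "0 \<le> t" using order_trans[OF zero_le_power2] by auto
      then show "0 \<le> h t" by (rule h0)
      show "((\<lambda>t. - 2 * \<rho>\<^sup>2 / (t + \<rho>\<^sup>2)\<^sup>2) has_real_derivative h t) (at t)"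
        unfolding h_def by (rule DERIV_density_kernel(1)[OF nz[OF t0]])
    qed (use True in auto)
    also have "\<dots> \<le> ennreal (?g z)" by (intro ennreal_leI) simp
    finally show ?thesis .
  next
    case False
    then have "?F z t = 0" for t by auto
    then show ?thesis by simp
  qed
  have outer: "ennreal (b * pi * (t * h t)) * indicator {0..\<delta>\<^sup>2} t \<le> (\<integral>\<^sup>+z. ?F z t \<partial>V)" for t
  proof (cases "0 < t \<and> t \<le> \<delta>\<^sup>2")
    case True
    have sq: "(D p z)\<^sup>2 \<le> t \<longleftrightarrow> D p z \<le> sqrt t" for z
      using real_sqrt_le_iff[of "(D p z)\<^sup>2" t] by simp
    have "(\<integral>\<^sup>+z. ?F z t \<partial>V) = (\<integral>\<^sup>+z. ennreal (h t) * indicator {z. D p z \<le> sqrt t} z \<partial>V)"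
      using True by (intro nn_integral_cong) (auto simp: sq indicator_def)
    also have "\<dots> = ennreal (h t) * emeasure V {z. D p z \<le> sqrt t}"
      by (subst nn_integral_cmult_indicator) auto
    also have "\<dots> = ennreal (h t * measure V {z. D p z \<le> sqrt t})"
      using h0[of t] True by (simp add: V.emeasure_eq_measure ennreal_mult)
    also have "\<dots> \<ge> ennreal (b * pi * (t * h t))"
    proof (rule ennreal_leI)
      have "sqrt t \<le> \<delta>" using True pos by (intro real_le_lsqrt) auto
      then have "b * (pi * (sqrt t)\<^sup>2) \<le> measure V {z. D p z \<le> sqrt t}" using True by (intro dens) auto
      then have "h t * (b * (pi * t)) \<le> h t * measure V {z. D p z \<le> sqrt t}"
        using True h0[of t] by (intro mult_left_mono) auto
      then show "b * pi * (t * h t) \<le> h t * measure V {z. D p z \<le> sqrt t}" by (simp add: mult_ac)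
    qed
    finally show ?thesis using True by simp
  next
    case False
    then have "t = 0 \<or> t \<notin> {0..\<delta>\<^sup>2}" by auto
    then show ?thesis by auto
  qed
  have "ennreal (b * pi * (2 * (\<delta>\<^sup>2)\<^sup>2 / (\<delta>\<^sup>2 + \<rho>\<^sup>2)\<^sup>2) - b * pi * (2 * 0\<^sup>2 / (0 + \<rho>\<^sup>2)\<^sup>2))
      = (\<integral>\<^sup>+t. ennreal (b * pi * (t * h t)) * indicator {0..\<delta>\<^sup>2} t \<partial>lborel)"
  proof (rule nn_integral_FTC_Icc[symmetric, where F="\<lambda>t. b * pi * (2 * t\<^sup>2 / (t + \<rho>\<^sup>2)\<^sup>2)"])
    fix t assume "t \<in> {0..\<delta>\<^sup>2}"
    then have t: "0 \<le> t" by simp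
    then show "0 \<le> b * pi * (t * h t)" using h0[of t] pos by simp
    have "((\<lambda>t. 2 * t\<^sup>2 / (t + \<rho>\<^sup>2)\<^sup>2) has_real_derivative t * h t) (at t)"
      unfolding h_def by (rule DERIV_density_kernel(2)[OF nz[OF t]])
    from DERIV_cmult[OF this, of "b * pi"]
    show "((\<lambda>t. b * pi * (2 * t\<^sup>2 / (t + \<rho>\<^sup>2)\<^sup>2)) has_real_derivative b * pi * (t * h t)) (at t)" .
  qed (use pos in auto)
  also have "\<dots> \<le> (\<integral>\<^sup>+t. \<integral>\<^sup>+z. ?F z t \<partial>V \<partial>lborel)" by (intro nn_integral_mono outer)
  also have "\<dots> = (\<integral>\<^sup>+z. \<integral>\<^sup>+t. ?F z t \<partial>lborel \<partial>V)" using Fubini'[OF meas] by simp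
  also have "\<dots> \<le> (\<integral>\<^sup>+z. ennreal (?g z) \<partial>V)" by (intro nn_integral_mono inner)
  also have "\<dots> = ennreal (\<integral>z. ?g z \<partial>V)"
  proof (rule nn_integral_eq_integral)
    show "integrable V ?g" by (rule integrable_kernel[OF pos(2)])
  qed auto
  finally have "b * pi * (2 * (\<delta>\<^sup>2)\<^sup>2 / (\<delta>\<^sup>2 + \<rho>\<^sup>2)\<^sup>2) \<le> (\<integral>z. ?g z \<partial>V)"
    by (subst (asm) ennreal_le_iff) (auto intro!: integral_nonneg_AE)
  then show ?thesis by (simp add: mult_ac)
qed

lemma density_kernel_limit:
  assumes d: "has_density V p \<Theta>" "1 \<le> \<Theta>" and \<epsilon>: "\<epsilon> > 0"
  shows "eventually (\<lambda>\<rho>. 2 * pi - \<epsilon> < (\<integral>z. 2 * \<rho>\<^sup>2 / ((D p z)\<^sup>2 + \<rho>\<^sup>2)\<^sup>2 \<partial>V)) (at_right 0)"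
proof -
  define b where "b = max 0 (1 - \<epsilon> / (4 * pi))"
  have b: "0 \<le> b" "b < 1" "2 * pi - \<epsilon> < b * 2 * pi"
    using \<epsilon> by (auto simp: b_def field_simps max_def)
  have "eventually (\<lambda>r. b < measure V {z. D p z \<le> r} / (pi * r\<^sup>2)) (at_right 0)"
    using d b by (intro order_tendstoD(1)[of _ \<Theta>]) (auto simp: has_density_def weight_cball)
  then obtain \<delta>0 where \<delta>0: "\<delta>0 > 0" "\<And>r. 0 < r \<Longrightarrow> r < \<delta>0 \<Longrightarrow> b < measure V {z. D p z \<le> r} / (pi * r\<^sup>2)"
    unfolding eventually_at_right_field by auto
  define \<delta> where "\<delta> = \<delta>0 / 2"
  have \<delta>: "\<delta> > 0" using \<delta>0 by (simp add: \<delta>_def)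
  have dens: "b * (pi * r\<^sup>2) \<le> measure V {z. D p z \<le> r}" if "0 < r" "r \<le> \<delta>" for r
  proof -
    have "b < measure V {z. D p z \<le> r} / (pi * r\<^sup>2)" using that \<delta>0 by (intro \<delta>0(2)) (auto simp: \<delta>_def)
    then show ?thesis using that by (simp add: pos_less_divide_eq)
  qed
  have "((\<lambda>\<rho>. b * (2 * pi * (\<delta>\<^sup>2)\<^sup>2 / (\<delta>\<^sup>2 + \<rho>\<^sup>2)\<^sup>2)) \<longlongrightarrow> b * (2 * pi * (\<delta>\<^sup>2)\<^sup>2 / (\<delta>\<^sup>2 + 0\<^sup>2)\<^sup>2)) (at_right 0)"
    using \<delta> by (intro tendsto_intros) auto
  then have "eventually (\<lambda>\<rho>. 2 * pi - \<epsilon> < b * (2 * pi * (\<delta>\<^sup>2)\<^sup>2 / (\<delta>\<^sup>2 + \<rho>\<^sup>2)\<^sup>2)) (at_right 0)"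
    using b \<delta> by (intro order_tendstoD(1)) (auto simp: mult_ac)
  then show ?thesis using eventually_at_right_less[of 0]
  proof eventually_elim
    case (elim \<rho>)
    then show ?case using density_kernel_bound[OF dens \<delta> elim(2) b(1)] by linarith
  qed
qed


lemma monotonicity_two_scales:
  assumes s: "bounded_by_arc s" and \<rho>: "0 < \<rho>" "\<rho> < r"
  shows "(\<integral>z. 2 * \<rho>\<^sup>2 / ((D p z)\<^sup>2 + \<rho>\<^sup>2)\<^sup>2 \<partial>V) \<le> (\<integral>z. 2 * r\<^sup>2 / ((D p z)\<^sup>2 + r\<^sup>2)\<^sup>2 \<partial>V) +
     (\<integral>\<tau>. parallelogram_area (\<gamma> \<tau> - p) (c \<tau>) * (1 / ((norm (\<gamma> \<tau> - p))\<^sup>2 + \<rho>\<^sup>2) - 1 / ((norm (\<gamma> \<tau> - p))\<^sup>2 + r\<^sup>2)) \<partial>arc_measure s 1)"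
proof -
  have r: "r > 0" using \<rho> by simp
  have nz: "\<rho> \<noteq> 0" "r \<noteq> 0" using \<rho> r by auto
  have pos: "t + \<rho>\<^sup>2 > 0" "t + r\<^sup>2 > 0" if "t \<ge> 0" for t using that \<rho> r by (simp_all add: add_nonneg_pos)
  have rr: "\<rho>\<^sup>2 \<le> r\<^sup>2" using \<rho> by (intro power_mono) auto
  let ?X = "\<lambda>x. newton p \<rho> x - newton p r x"
  let ?X' = "\<lambda>x h. newton_deriv p \<rho> x h - newton_deriv p r x h"
  let ?g = "\<lambda>z. 2 * (\<rho>\<^sup>2 + (perp p z)\<^sup>2) / ((D p z)\<^sup>2 + \<rho>\<^sup>2)\<^sup>2 - 2 * (r\<^sup>2 + (perp p z)\<^sup>2) / ((D p z)\<^sup>2 + r\<^sup>2)\<^sup>2"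
  have sm: "smooth ?X" by (intro smooth_diff smooth_newton nz)
  have der: "(?X has_derivative ?X' x) (at x)" for x
    by (intro has_derivative_diff has_derivative_newton nz)
  have td: "tangential_div (snd z) (?X' (fst z)) = ?g z" if z: "snd z \<in> planes" for z
  proof -
    have "tangential_div (snd z) (?X' (fst z)) = tangential_div (snd z) (newton_deriv p \<rho> (fst z)) - tangential_div (snd z) (newton_deriv p r (fst z))"
      by (simp add: tangential_div_def inner_diff_right sum_subtractf)
    then show ?thesis unfolding tangential_div_newton[OF z nz(1)] tangential_div_newton[OF z nz(2)] .
  qed
  have meas: "?g \<in> borel_measurable V" by measurable
  have ig: "integrable V ?g" by (rule first_variation(1)[OF s sm der meas td])
  have "(\<integral>z. 2 * \<rho>\<^sup>2 / ((D p z)\<^sup>2 + \<rho>\<^sup>2)\<^sup>2 \<partial>V) \<le> (\<integral>z. 2 * r\<^sup>2 / ((D p z)\<^sup>2 + r\<^sup>2)\<^sup>2 + ?g z \<partial>V)"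
  proof (rule integral_mono[OF integrable_kernel[OF \<rho>(1)] Bochner_Integration.integrable_add[OF integrable_kernel[OF r] ig]])
    fix z
    have "((D p z)\<^sup>2 + \<rho>\<^sup>2)\<^sup>2 \<le> ((D p z)\<^sup>2 + r\<^sup>2)\<^sup>2" using rr by (intro power_mono) auto
    then have "2 * (perp p z)\<^sup>2 / ((D p z)\<^sup>2 + r\<^sup>2)\<^sup>2 \<le> 2 * (perp p z)\<^sup>2 / ((D p z)\<^sup>2 + \<rho>\<^sup>2)\<^sup>2"
      by (intro divide_left_mono mult_pos_pos zero_less_power pos) auto
    then show "2 * \<rho>\<^sup>2 / ((D p z)\<^sup>2 + \<rho>\<^sup>2)\<^sup>2 \<le> 2 * r\<^sup>2 / ((D p z)\<^sup>2 + r\<^sup>2)\<^sup>2 + ?g z"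
      by (simp add: add_divide_distrib distrib_left)
  qed
  also have "\<dots> = (\<integral>z. 2 * r\<^sup>2 / ((D p z)\<^sup>2 + r\<^sup>2)\<^sup>2 \<partial>V) + (\<integral>z. ?g z \<partial>V)"
    by (rule Bochner_Integration.integral_add[OF integrable_kernel[OF r] ig])
  also have "(\<integral>z. ?g z \<partial>V) \<le> (\<integral>\<tau>. parallelogram_area (?X (\<gamma> \<tau>)) (c \<tau>) \<partial>arc_measure s 1)"
    by (rule first_variation(2)[OF s sm der meas td])
  also have "\<dots> = (\<integral>\<tau>. parallelogram_area (\<gamma> \<tau> - p) (c \<tau>) * (1 / ((norm (\<gamma> \<tau> - p))\<^sup>2 + \<rho>\<^sup>2) - 1 / ((norm (\<gamma> \<tau> - p))\<^sup>2 + r\<^sup>2)) \<partial>arc_measure s 1)"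
  proof (intro Bochner_Integration.integral_cong refl)
    fix \<tau>
    have "1 / ((norm (\<gamma> \<tau> - p))\<^sup>2 + r\<^sup>2) \<le> 1 / ((norm (\<gamma> \<tau> - p))\<^sup>2 + \<rho>\<^sup>2)"
      using rr by (intro divide_left_mono mult_pos_pos pos) auto
    moreover have "?X (\<gamma> \<tau>) = (1 / ((norm (\<gamma> \<tau> - p))\<^sup>2 + \<rho>\<^sup>2) - 1 / ((norm (\<gamma> \<tau> - p))\<^sup>2 + r\<^sup>2)) *\<^sub>R (\<gamma> \<tau> - p)"
      by (simp add: newton_def algebra_simps)
    ultimately show "parallelogram_area (?X (\<gamma> \<tau>)) (c \<tau>) =
        parallelogram_area (\<gamma> \<tau> - p) (c \<tau>) * (1 / ((norm (\<gamma> \<tau> - p))\<^sup>2 + \<rho>\<^sup>2) - 1 / ((norm (\<gamma> \<tau> - p))\<^sup>2 + r\<^sup>2))"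
      by (simp add: parallelogram_area_scale_left)
  qed
  finally show ?thesis by simp
qed

end

locale touching_varifold = varifold_arc \<gamma> c C K m V R
  for \<gamma> c :: "real \<Rightarrow> real^'n::finite" and C K m and V :: "'n varifold" and R +
  fixes s :: real
  assumes bba: "bounded_by_arc s" and s: "0 \<le> s" "s < 1"
    and TC: "\<And>ts. sorted_wrt (<) ts \<Longrightarrow> set ts \<subseteq> {0..1} \<Longrightarrow> polygon_curvature (map \<gamma> ts) \<le> 2 * pi"
    and dens: "\<And>p. p \<in> support V - \<gamma> ` {0..1} \<Longrightarrow> \<exists>\<Theta>\<ge>1. has_density V p \<Theta>"
    and touch: "\<gamma> s \<in> support V"
begin

abbreviation a where "a \<equiv> \<gamma> s"

abbreviation \<Gamma> where "\<Gamma> \<equiv> arc_measure s 1"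

lemma measurable_gamma_c [measurable]:
  "\<gamma> \<in> borel_measurable \<Gamma>" "c \<in> borel_measurable \<Gamma>"
  using s by (auto intro: measurable_gamma measurable_c)

lemma AE_off_arc: "AE z in V. fst z \<in> support V - \<gamma> ` {0..1}"
  using AE_in_support[OF sets_V] arc_null[OF bba s(1) less_imp_le[OF s(2)]] by eventually_elim auto

lemma AE_off_a: "AE z in V. D a z > 0"
  using AE_off_arc by eventually_elim (use s in auto)

lemma support_points_near:
  assumes "r > 0"
  obtains q where "q \<in> support V - \<gamma> ` {0..1}" "norm (q - a) < r"
proof -
  have "emeasure V (fst -` ball a r \<inter> space V) > 0"
    using touch assms by (simp add: support_def weight_def emeasure_distr)
  moreover have "fst -` ball a r \<inter> space V \<in> sets V" by measurable
  ultimately have "\<not> (AE z in V. z \<notin> fst -` ball a r \<inter> space V)"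
    by (subst AE_iff_measurable[OF _ refl]) (auto simp: space_V Int_def)
  moreover have "AE z in V. z \<notin> fst -` ball a r \<inter> space V"
    if none: "\<And>q. q \<in> support V - \<gamma> ` {0..1} \<Longrightarrow> q \<notin> ball a r"
    using AE_off_arc by eventually_elim (use none in auto)
  ultimately have "\<exists>q. q \<in> support V - \<gamma> ` {0..1} \<and> q \<in> ball a r" by blast
  then show thesis using that by (auto simp: dist_norm norm_minus_commute)
qed

lemma arc_dist: "s \<le> \<tau> \<Longrightarrow> \<tau> \<le> 1 \<Longrightarrow> m * (\<tau> - s) \<le> norm (\<gamma> \<tau> - a)"
  using bilip[of \<tau> s] s by simp

lemma off_arc_distance:
  assumes "q \<notin> \<gamma> ` {0..1}"
  obtains d where "d > 0" "\<And>\<tau>. \<tau> \<in> {0..1} \<Longrightarrow> d \<le> norm (\<gamma> \<tau> - q)"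
proof -
  have "compact (\<gamma> ` {0..1})" by (intro compact_continuous_image \<gamma>_cont) auto
  then have "closed (\<gamma> ` {0..1})" by (rule compact_imp_closed)
  from separate_point_closed[OF this assms]
  show thesis using that by (auto simp: dist_norm norm_minus_commute)
qed

lemma full_density_bound:
  assumes q: "q \<in> support V - \<gamma> ` {0..1}" and r: "r > 0"
  shows "2 * pi \<le> (\<integral>z. 2 * r\<^sup>2 / ((D q z)\<^sup>2 + r\<^sup>2)\<^sup>2 \<partial>V)
    + (\<integral>\<tau>. parallelogram_area (\<gamma> \<tau> - q) (c \<tau>) / (norm (\<gamma> \<tau> - q))\<^sup>2 * (r\<^sup>2 / ((norm (\<gamma> \<tau> - q))\<^sup>2 + r\<^sup>2)) \<partial>\<Gamma>)"
    (is "_ \<le> ?I + ?J")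
proof (rule field_le_epsilon)
  fix \<epsilon> :: real assume \<epsilon>: "\<epsilon> > 0"
  obtain \<Theta> where \<Theta>: "\<Theta> \<ge> 1" "has_density V q \<Theta>" using dens[OF q] by blast
  obtain d where d: "d > 0" "\<And>\<tau>. \<tau> \<in> {0..1} \<Longrightarrow> d \<le> norm (\<gamma> \<tau> - q)"
    using off_arc_distance q by blast
  have "eventually (\<lambda>\<rho>. 2 * pi - \<epsilon> < (\<integral>z. 2 * \<rho>\<^sup>2 / ((D q z)\<^sup>2 + \<rho>\<^sup>2)\<^sup>2 \<partial>V) \<and> 0 < \<rho> \<and> \<rho> < r) (at_right 0)"
    by (intro eventually_conj density_kernel_limit[OF \<Theta>(2,1) \<epsilon>] eventually_at_right_less)
       (use r in \<open>auto simp: eventually_at_right_field\<close>)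
  then obtain \<rho> where \<rho>: "2 * pi - \<epsilon> < (\<integral>z. 2 * \<rho>\<^sup>2 / ((D q z)\<^sup>2 + \<rho>\<^sup>2)\<^sup>2 \<partial>V)" "0 < \<rho>" "\<rho> < r"
    using eventually_happens'[OF trivial_limit_at_right_real] by blast
  let ?A = "\<lambda>\<tau>. parallelogram_area (\<gamma> \<tau> - q) (c \<tau>)" and ?n = "\<lambda>\<tau>. (norm (\<gamma> \<tau> - q))\<^sup>2"
  have le: "?A \<tau> * (1 / (?n \<tau> + \<rho>\<^sup>2) - 1 / (?n \<tau> + r\<^sup>2)) \<le> ?A \<tau> / ?n \<tau> * (r\<^sup>2 / (?n \<tau> + r\<^sup>2))"
    and nn: "0 \<le> ?A \<tau> * (1 / (?n \<tau> + \<rho>\<^sup>2) - 1 / (?n \<tau> + r\<^sup>2))"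
    and ub: "?A \<tau> / ?n \<tau> * (r\<^sup>2 / (?n \<tau> + r\<^sup>2)) \<le> K / d"
    if \<tau>: "s < \<tau>" "\<tau> \<le> 1" for \<tau>
  proof -
    have N: "d \<le> norm (\<gamma> \<tau> - q)" using d(2)[of \<tau>] \<tau> s by auto
    then have n: "?n \<tau> > 0" using d(1) by auto
    have "1 / (?n \<tau> + \<rho>\<^sup>2) \<le> 1 / ?n \<tau>" using n by (intro divide_left_mono mult_pos_pos add_pos_nonneg) auto
    moreover have "1 / ?n \<tau> - 1 / (?n \<tau> + r\<^sup>2) = 1 / ?n \<tau> * (r\<^sup>2 / (?n \<tau> + r\<^sup>2))"
    proof -
      have "1 / x - 1 / (x + y) = 1 / x * (y / (x + y))" if "x > 0" "x + y > 0" for x y :: real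
        using that by (simp add: field_simps)
      then show ?thesis using n r by (simp add: add_pos_nonneg)
    qed
    ultimately have "1 / (?n \<tau> + \<rho>\<^sup>2) - 1 / (?n \<tau> + r\<^sup>2) \<le> 1 / ?n \<tau> * (r\<^sup>2 / (?n \<tau> + r\<^sup>2))" by linarith
    then show "?A \<tau> * (1 / (?n \<tau> + \<rho>\<^sup>2) - 1 / (?n \<tau> + r\<^sup>2)) \<le> ?A \<tau> / ?n \<tau> * (r\<^sup>2 / (?n \<tau> + r\<^sup>2))"
      using mult_left_mono[OF _ parallelogram_area_nonneg, of _ _ "\<gamma> \<tau> - q" "c \<tau>"] by (metis (no_types) mult.assoc times_divide_eq_right mult_1_right)
    have "\<rho>\<^sup>2 \<le> r\<^sup>2" using \<rho> by (intro power_mono) auto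
    then have "1 / (?n \<tau> + r\<^sup>2) \<le> 1 / (?n \<tau> + \<rho>\<^sup>2)"
      using n by (intro divide_left_mono mult_pos_pos add_pos_nonneg) auto
    then show "0 \<le> ?A \<tau> * (1 / (?n \<tau> + \<rho>\<^sup>2) - 1 / (?n \<tau> + r\<^sup>2))" by simp
    have "?A \<tau> \<le> norm (\<gamma> \<tau> - q) * K"
      using parallelogram_area_le_norm[of "\<gamma> \<tau> - q" "c \<tau>"] mult_left_mono[OF speed[of \<tau>] norm_ge_zero[of "\<gamma> \<tau> - q"]] \<tau> s
      by auto
    then have "?A \<tau> / ?n \<tau> \<le> norm (\<gamma> \<tau> - q) * K / ?n \<tau>" by (intro divide_right_mono) auto
    also have "\<dots> = K / norm (\<gamma> \<tau> - q)" using n by (simp add: power2_eq_square)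
    also have "\<dots> \<le> K / d" using N K0 d(1) less_le_trans[OF d(1) N] by (intro divide_left_mono mult_pos_pos)
    finally have 1: "?A \<tau> / ?n \<tau> \<le> K / d" .
    have "r\<^sup>2 / (?n \<tau> + r\<^sup>2) \<le> 1" using n r by (simp add: divide_le_eq add_pos_nonneg)
    then have "?A \<tau> / ?n \<tau> * (r\<^sup>2 / (?n \<tau> + r\<^sup>2)) \<le> ?A \<tau> / ?n \<tau> * 1" by (intro mult_left_mono) auto
    then show "?A \<tau> / ?n \<tau> * (r\<^sup>2 / (?n \<tau> + r\<^sup>2)) \<le> K / d" using 1 by simp
  qed
  have "(\<integral>\<tau>. ?A \<tau> * (1 / (?n \<tau> + \<rho>\<^sup>2) - 1 / (?n \<tau> + r\<^sup>2)) \<partial>\<Gamma>) \<le> ?J"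
  proof (rule integral_mono_AE)
    show "integrable \<Gamma> (\<lambda>\<tau>. ?A \<tau> / ?n \<tau> * (r\<^sup>2 / (?n \<tau> + r\<^sup>2)))"
    proof (rule integrable_arc_bounded[of _ _ _ "K / d"])
      fix \<tau> assume *: "s < \<tau>" "\<tau> \<le> 1"
      show "\<bar>?A \<tau> / ?n \<tau> * (r\<^sup>2 / (?n \<tau> + r\<^sup>2))\<bar> \<le> K / d" using ub[OF *] by simp
    qed measurable
    show "integrable \<Gamma> (\<lambda>\<tau>. ?A \<tau> * (1 / (?n \<tau> + \<rho>\<^sup>2) - 1 / (?n \<tau> + r\<^sup>2)))"
    proof (rule integrable_arc_bounded[of _ _ _ "K / d"])
      fix \<tau> assume *: "s < \<tau>" "\<tau> \<le> 1"
      show "\<bar>?A \<tau> * (1 / (?n \<tau> + \<rho>\<^sup>2) - 1 / (?n \<tau> + r\<^sup>2))\<bar> \<le> K / d"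
        using nn[OF *] le[OF *] ub[OF *] by linarith
    qed measurable
    show "AE \<tau> in \<Gamma>. ?A \<tau> * (1 / (?n \<tau> + \<rho>\<^sup>2) - 1 / (?n \<tau> + r\<^sup>2)) \<le> ?A \<tau> / ?n \<tau> * (r\<^sup>2 / (?n \<tau> + r\<^sup>2))"
      using AE_arc_measure[of s 1] by eventually_elim (use le in blast)
  qed
  then show "2 * pi \<le> ?I + ?J + \<epsilon>"
    using monotonicity_two_scales[OF bba \<rho>(2,3), of q] \<rho>(1) by linarith
qed

end

context touching_varifold begin

lemma seen_ratio_bound:
  assumes "\<tau> \<in> {0..1}" "d \<le> norm (\<gamma> \<tau> - q)" "d > 0"
  shows "parallelogram_area (\<gamma> \<tau> - q) (c \<tau>) / (norm (\<gamma> \<tau> - q))\<^sup>2 \<le> K / d"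
proof -
  have n: "norm (\<gamma> \<tau> - q) > 0" using assms by linarith
  have "parallelogram_area (\<gamma> \<tau> - q) (c \<tau>) \<le> norm (\<gamma> \<tau> - q) * K"
    using order_trans[OF parallelogram_area_le_norm mult_left_mono[OF speed[OF assms(1)] norm_ge_zero]] .
  then have "parallelogram_area (\<gamma> \<tau> - q) (c \<tau>) / (norm (\<gamma> \<tau> - q))\<^sup>2 \<le> norm (\<gamma> \<tau> - q) * K / (norm (\<gamma> \<tau> - q))\<^sup>2"
    by (intro divide_right_mono) auto
  also have "\<dots> = K / norm (\<gamma> \<tau> - q)" using n by (simp add: power2_eq_square)
  also have "\<dots> \<le> K / d" using assms n K0 by (intro divide_left_mono mult_pos_pos)
  finally show ?thesis .
qed

lemma lower_mass:
  obtains r0 where "r0 > 0" "\<And>r. 0 < r \<Longrightarrow> r < r0 \<Longrightarrow> 2 \<le> (\<integral>z. 2 * r\<^sup>2 / ((D a z)\<^sup>2 + r\<^sup>2)\<^sup>2 \<partial>V)"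
proof -
  obtain \<epsilon> where \<epsilon>: "\<epsilon> > 0" "s + \<epsilon> \<le> 1"
    "\<And>ts. sorted_wrt (<) ts \<Longrightarrow> set ts \<subseteq> {s<..s + \<epsilon>} \<Longrightarrow> polygon_curvature (map \<gamma> ts) \<le> 1/2"
    using small_total_curvature_near[OF TC s, of "1/2"] by auto
  define d where "d = m * \<epsilon> / 2"
  have d: "d > 0" using m0 \<epsilon> by (simp add: d_def)
  define r0 where "r0 = sqrt (d ^ 3 / (2 * (K + 1)))"
  have r0: "r0 > 0" using d K0 by (simp add: r0_def)
  have key: "2 \<le> (\<integral>z. 2 * r\<^sup>2 / ((D q z)\<^sup>2 + r\<^sup>2)\<^sup>2 \<partial>V)"
    if r: "0 < r" "r < r0" and q: "q \<in> support V - \<gamma> ` {0..1}" "norm (q - a) < d" for q r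
  proof -
    let ?h = "\<lambda>\<tau>. parallelogram_area (\<gamma> \<tau> - q) (c \<tau>) / (norm (\<gamma> \<tau> - q))\<^sup>2"
    let ?w = "\<lambda>\<tau>. r\<^sup>2 / ((norm (\<gamma> \<tau> - q))\<^sup>2 + r\<^sup>2)"
    obtain dq where dq: "dq > 0" "\<And>\<tau>. \<tau> \<in> {0..1} \<Longrightarrow> dq \<le> norm (\<gamma> \<tau> - q)"
      using off_arc_distance q by blast
    have h: "0 \<le> ?h \<tau>" "\<tau> \<in> {0..1} \<Longrightarrow> ?h \<tau> \<le> K / dq" for \<tau>
      using seen_ratio_bound[of \<tau> dq q] dq by auto
    have w: "0 \<le> ?w \<tau>" "?w \<tau> \<le> 1" for \<tau> using r by (auto simp: divide_le_eq add_nonneg_pos)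
    have hw: "?h \<tau> * ?w \<tau> \<le> ?h \<tau>" for \<tau> using mult_left_mono[OF w(2) h(1)] by simp
    have ih: "integrable \<Gamma> ?h"
    proof (rule integrable_arc_bounded[of _ _ _ "K / dq"])
      fix \<tau> assume "s < \<tau>" "\<tau> \<le> 1"
      then show "\<bar>?h \<tau>\<bar> \<le> K / dq" using h[of \<tau>] s by auto
    qed measurable
    have ihw: "integrable \<Gamma> (\<lambda>\<tau>. ?h \<tau> * ?w \<tau>)"
      by (rule Bochner_Integration.integrable_bound[OF ih]) (use h w hw in \<open>auto simp: abs_mult\<close>)
    have se: "s \<le> s + \<epsilon>" using \<epsilon> by simp
    have near: "(\<integral>\<tau>. ?h \<tau> * ?w \<tau> \<partial>arc_measure s (s + \<epsilon>)) \<le> pi + 1/2"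
    proof -
      have "(\<integral>\<tau>. ?h \<tau> * ?w \<tau> \<partial>arc_measure s (s + \<epsilon>)) \<le> (\<integral>\<tau>. ?h \<tau> \<partial>arc_measure s (s + \<epsilon>))"
        by (intro integral_mono hw integral_arc_measure_split(2)[OF ihw se \<epsilon>(2)] integral_arc_measure_split(2)[OF ih se \<epsilon>(2)])
      also have "\<dots> \<le> pi + 1/2"
      proof (rule integral_arc_limit_le[where M="K / dq"])
        show "integrable (arc_measure s (s + \<epsilon>)) ?h" by (rule integral_arc_measure_split(2)[OF ih se \<epsilon>(2)])
        show "AE t in arc_measure s (s + \<epsilon>). ?h t \<le> K / dq"
          using AE_arc_measure[of s "s + \<epsilon>"] by eventually_elim (rule h(2), use s \<epsilon> in auto)
        fix t assume t: "s < t" "t < s + \<epsilon>"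
        have sub: "{t..s + \<epsilon>} \<subseteq> {0..1}" using t s \<epsilon> by auto
        have "continuous_on {t..s + \<epsilon>} ?h"
        proof (intro continuous_intros continuous_on_subset[OF \<gamma>_cont sub] continuous_on_subset[OF c_cont sub] ballI)
          fix x assume "x \<in> {t..s + \<epsilon>}"
          then have "norm (\<gamma> x - q) > 0" using dq sub by (metis less_le_trans subsetD)
          then show "(norm (\<gamma> x - q))\<^sup>2 \<noteq> 0" by simp
        qed
        then have "(\<integral>\<tau>. ?h \<tau> \<partial>arc_measure t (s + \<epsilon>)) = integral {t..s + \<epsilon>} ?h"
          by (rule integral_arc_measure_continuous)
        also have "\<dots> \<le> pi + 1/2"
        proof (rule seen_from_outside)
          fix ts assume "sorted_wrt (<) ts" "set ts \<subseteq> {t..s + \<epsilon>}"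
          then show "polygon_curvature (map \<gamma> ts) \<le> 1/2" using t by (intro \<epsilon>(3)) auto
        qed (use t s \<epsilon> q(1) sub in auto)
        finally show "(\<integral>\<tau>. ?h \<tau> \<partial>arc_measure t (s + \<epsilon>)) \<le> pi + 1/2" .
      qed (use \<epsilon> in auto)
      finally show ?thesis .
    qed
    have far: "(\<integral>\<tau>. ?h \<tau> * ?w \<tau> \<partial>arc_measure (s + \<epsilon>) 1) \<le> 1/2"
    proof -
      have pt: "?h \<tau> * ?w \<tau> \<le> 1/2" if \<tau>: "s + \<epsilon> < \<tau>" "\<tau> \<le> 1" for \<tau>
      proof -
        have "m * \<epsilon> \<le> m * (\<tau> - s)" using \<tau> m0 by simp
        also have "\<dots> \<le> norm (\<gamma> \<tau> - a)" using \<tau> \<epsilon> by (intro arc_dist) auto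
        also have "\<dots> \<le> norm (\<gamma> \<tau> - q) + norm (q - a)" using norm_triangle_ineq[of "\<gamma> \<tau> - q" "q - a"] by simp
        finally have dd: "d \<le> norm (\<gamma> \<tau> - q)" using q(2) by (simp add: d_def)
        then have "d\<^sup>2 \<le> (norm (\<gamma> \<tau> - q))\<^sup>2 + r\<^sup>2" using d power_mono[of d "norm (\<gamma> \<tau> - q)" 2] by (simp add: add_increasing2)
        moreover from this have "0 < (norm (\<gamma> \<tau> - q))\<^sup>2 + r\<^sup>2" using less_le_trans[OF zero_less_power[OF d]] by blast
        ultimately have "?w \<tau> \<le> r\<^sup>2 / d\<^sup>2" using d by (intro divide_left_mono mult_pos_pos zero_less_power) auto
        moreover have "?h \<tau> \<le> K / d" using seen_ratio_bound[OF _ dd d] \<tau> s \<epsilon> by auto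
        ultimately have "?h \<tau> * ?w \<tau> \<le> K / d * (r\<^sup>2 / d\<^sup>2)"
          using h(1) w(1) K0 d by (intro mult_mono) auto
        also have "\<dots> = K * r\<^sup>2 / d ^ 3" by (simp add: power2_eq_square power3_eq_cube)
        also have "\<dots> \<le> 1/2"
        proof -
          have "r\<^sup>2 \<le> r0\<^sup>2" using r by (intro power_mono) auto
          also have "r0\<^sup>2 = d ^ 3 / (2 * (K + 1))" using d K0 by (simp add: r0_def)
          finally have "(K + 1) * r\<^sup>2 \<le> d ^ 3 / 2" using K0 by (simp add: field_simps)
          moreover have "K * r\<^sup>2 \<le> (K + 1) * r\<^sup>2" by (intro mult_right_mono) auto
          ultimately show ?thesis using d by (simp add: pos_divide_le_eq)
        qed
        finally show ?thesis .
      qed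
      have "(\<integral>\<tau>. ?h \<tau> * ?w \<tau> \<partial>arc_measure (s + \<epsilon>) 1) \<le> 1/2 * (1 - (s + \<epsilon>))"
        by (rule integral_le_const_arc[OF \<epsilon>(2) integral_arc_measure_split(3)[OF ihw se \<epsilon>(2)]])
           (use AE_arc_measure[of "s + \<epsilon>" 1] in \<open>eventually_elim, use pt in blast\<close>)
      also have "\<dots> \<le> 1/2 * 1" using s \<epsilon> by (intro mult_left_mono) auto
      finally show ?thesis by simp
    qed
    have "(\<integral>\<tau>. ?h \<tau> * ?w \<tau> \<partial>\<Gamma>) \<le> pi + 1"
      using integral_arc_measure_split(1)[OF ihw se \<epsilon>(2)] near far by linarith
    then show ?thesis using full_density_bound[OF q(1) r(1)] pi_gt3 by linarith
  qed
  have "2 \<le> (\<integral>z. 2 * r\<^sup>2 / ((D a z)\<^sup>2 + r\<^sup>2)\<^sup>2 \<partial>V)" if r: "0 < r" "r < r0" for r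
  proof -
    have "\<exists>q. q \<in> support V - \<gamma> ` {0..1} \<and> norm (q - a) < min d (1 / real (Suc k))" for k
      using support_points_near[of "min d (1 / real (Suc k))"] d by (metis min_less_iff_conj zero_less_divide_1_iff of_nat_0_less_iff zero_less_Suc)
    then obtain q where q: "\<And>k. q k \<in> support V - \<gamma> ` {0..1}" "\<And>k. norm (q k - a) < min d (1 / real (Suc k))"
      by metis
    have qa: "q \<longlonglongrightarrow> a"
    proof (rule LIMSEQ_norm_0[THEN LIM_zero_cancel])
      show "norm (q k - a) < 1 / real (Suc k)" for k using q(2)[of k] by simp
    qed
    have "(\<lambda>k. \<integral>z. 2 * r\<^sup>2 / ((D (q k) z)\<^sup>2 + r\<^sup>2)\<^sup>2 \<partial>V) \<longlonglongrightarrow> (\<integral>z. 2 * r\<^sup>2 / ((D a z)\<^sup>2 + r\<^sup>2)\<^sup>2 \<partial>V)"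
    proof (rule integral_dominated_convergence[where w="\<lambda>z. 2 / r\<^sup>2"])
      show "AE z in V. (\<lambda>k. 2 * r\<^sup>2 / ((D (q k) z)\<^sup>2 + r\<^sup>2)\<^sup>2) \<longlonglongrightarrow> 2 * r\<^sup>2 / ((D a z)\<^sup>2 + r\<^sup>2)\<^sup>2"
      proof (rule AE_I2)
        fix z
        have "(D a z)\<^sup>2 + r\<^sup>2 > 0" using r by (simp add: add_nonneg_pos)
        then show "(\<lambda>k. 2 * r\<^sup>2 / ((D (q k) z)\<^sup>2 + r\<^sup>2)\<^sup>2) \<longlonglongrightarrow> 2 * r\<^sup>2 / ((D a z)\<^sup>2 + r\<^sup>2)\<^sup>2"
          by (intro tendsto_intros qa) auto
      qed
      show "AE z in V. norm (2 * r\<^sup>2 / ((D (q k) z)\<^sup>2 + r\<^sup>2)\<^sup>2) \<le> 2 / r\<^sup>2" for k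
        using kernel_bound[OF r(1)] by (intro AE_I2) auto
    qed auto
    then show ?thesis
      by (rule LIMSEQ_le_const) (use key[OF r q(1)] q(2) in auto)
  qed
  then show thesis using that r0 by blast
qed

definition e where "e = sgn (c s)"

lemma c_s_nz: "c s \<noteq> 0"
proof
  assume "c s = 0"
  define h where "h = min (1 - s) (m / (2 * (C + 1)))"
  have h: "0 < h" "s + h \<le> 1" "(C + 1) * h \<le> m / 2"
  proof -
    show "0 < h" "s + h \<le> 1" using s m0 C0 by (auto simp: h_def)
    have "(C + 1) * h \<le> (C + 1) * (m / (2 * (C + 1)))" using C0 by (intro mult_left_mono) (auto simp: h_def)
    also have "(C + 1) * (m / (2 * (C + 1))) = m / 2" using C0 by (simp add: field_simps)
    finally show "(C + 1) * h \<le> m / 2" .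
  qed
  have "m * h \<le> norm (\<gamma> (s + h) - a)" using arc_dist[of "s + h"] h by simp
  also have "\<dots> \<le> C * h\<^sup>2" using taylor[of "s + h" s] h s \<open>c s = 0\<close> by simp
  finally have "m * h \<le> C * h * h" by (simp add: power2_eq_square mult.assoc)
  then have "m \<le> C * h" using h(1) by simp
  also have "\<dots> \<le> (C + 1) * h" using h by (simp add: algebra_simps)
  finally show False using h(3) m0 by linarith
qed

lemma norm_e: "norm e = 1" and e_c: "c s = norm (c s) *\<^sub>R e"
  using c_s_nz by (auto simp: e_def norm_sgn sgn_div_norm)

lemma area_e: "s \<le> \<tau> \<Longrightarrow> \<tau> \<le> 1 \<Longrightarrow> parallelogram_area e (c \<tau>) \<le> C * (\<tau> - s)"
proof -
  assume t: "s \<le> \<tau>" "\<tau> \<le> 1"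
  have "parallelogram_area (c \<tau>) e \<le> norm (c \<tau> - norm (c s) *\<^sub>R e) * norm e" by (rule parallelogram_area_le)
  also have "\<dots> = norm (c \<tau> - c s)" using norm_e e_c by simp
  also have "\<dots> \<le> C * \<bar>\<tau> - s\<bar>" using t s by (intro lip) auto
  finally show ?thesis using t by (simp add: parallelogram_area_commute)
qed

lemma transversal_points:
  assumes \<sigma>: "\<sigma> > 0"
  obtains q where "q \<in> support V - \<gamma> ` {0..1}" "norm (q - a) < \<sigma>" "(q - a) \<bullet> e \<le> norm (q - a) / 2"
proof (rule ccontr)
  assume "\<not> thesis"
  then have cone: "norm (q - a) / 2 < (q - a) \<bullet> e" if "q \<in> support V - \<gamma> ` {0..1}" "norm (q - a) < \<sigma>" for q
    using that \<open>\<And>q. q \<in> support V - \<gamma> ` {0..1} \<Longrightarrow> norm (q - a) < \<sigma> \<Longrightarrow> (q - a) \<bullet> e \<le> norm (q - a) / 2 \<Longrightarrow> thesis\<close>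
    by force
  let ?E = "\<lambda>z. (perp a z)\<^sup>2 / (D a z) ^ 4"
  have iE: "integrable V ?E" using perp_energy[OF bba s(1) _ , of s] s by simp
  let ?M = "measure V UNIV"
  let ?S = "\<lambda>\<rho> z. sqrt ((D a z)\<^sup>2 + \<rho>\<^sup>2)"
  let ?F = "\<lambda>\<rho> z. (if D a z < \<sigma> then D a z / (?S \<rho> z) ^ 3 else 0)"
  define B where "B = 4 * (C / m + (\<integral>z. ?E z \<partial>V) + ?M / \<sigma>\<^sup>2)"
  have F: "integrable V (?F \<rho>)" "(\<integral>z. ?F \<rho> z \<partial>V) \<le> B" if \<rho>: "\<rho> > 0" for \<rho>
  proof -
    have pos: "t + \<rho>\<^sup>2 > 0" if "t \<ge> 0" for t using that \<rho> by (simp add: add_nonneg_pos)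
    have nz: "(norm y)\<^sup>2 + \<rho>\<^sup>2 > 0" for y :: "real^'n" using pos[of "(norm y)\<^sup>2"] by simp
    let ?\<phi> = "\<lambda>t. - 1 / sqrt (t + \<rho>\<^sup>2)" and ?\<phi>' = "\<lambda>t. 1 / (2 * (sqrt (t + \<rho>\<^sup>2)) ^ 3)"
    let ?X = "\<lambda>x. ?\<phi> ((norm (x - a))\<^sup>2) *\<^sub>R e"
    let ?X' = "\<lambda>x h. (2 * ?\<phi>' ((norm (x - a))\<^sup>2) * ((x - a) \<bullet> h)) *\<^sub>R e + ?\<phi> ((norm (x - a))\<^sup>2) *\<^sub>R 0"
    let ?g = "\<lambda>z. ((fst z - a) \<bullet> (snd z *v e)) / (?S \<rho> z) ^ 3"
    have sm: "smooth ?X" 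
      by (intro smooth_scaleR smooth_divide smooth_sqrt smooth_add smooth_norm_sq smooth_diff smooth_ident smooth_const)
         (use nz \<rho> in auto)
    have d\<phi>: "(?\<phi> has_real_derivative ?\<phi>' t) (at t)" if "t \<ge> 0" for t
    proof -
      have p: "sqrt (t + \<rho>\<^sup>2) > 0" using pos[OF that] by simp
      have "((\<lambda>t. sqrt (t + \<rho>\<^sup>2)) has_real_derivative inverse (sqrt (t + \<rho>\<^sup>2)) / 2) (at t)"
        using pos[OF that] by (auto intro!: derivative_eq_intros simp: inverse_eq_divide)
      from DERIV_inverse'[OF this] p
      have "((\<lambda>t. inverse (sqrt (t + \<rho>\<^sup>2))) has_real_derivative
         - (inverse (sqrt (t + \<rho>\<^sup>2)) * (inverse (sqrt (t + \<rho>\<^sup>2)) / 2) * inverse (sqrt (t + \<rho>\<^sup>2)))) (at t)"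
        by simp
      from DERIV_minus[OF this] show ?thesis
        by (simp add: inverse_eq_divide power3_eq_cube mult_ac)
    qed
    have der: "(?X has_derivative ?X' x) (at x)" for x
      by (intro has_derivative_radial_weight d\<phi> has_derivative_const) simp
    have td: "tangential_div (snd z) (?X' (fst z)) = ?g z" if z: "snd z \<in> planes" for z
      unfolding tangential_div_radial_weight[OF z] by (simp add: tangential_div_def)
    have meas: "?g \<in> borel_measurable V" by measurable
    have ig: "integrable V ?g" by (rule first_variation(1)[OF bba sm der meas td])
    have Fm: "?F \<rho> \<in> borel_measurable V" by measurable
    have Sp: "?S \<rho> z > 0" "D a z \<le> ?S \<rho> z" for z using nz[of "fst z - a"] by (auto intro: real_le_rsqrt)
    show iF: "integrable V (?F \<rho>)"
    proof (rule V.integrable_const_bound[OF _ Fm, of "\<sigma> / \<rho> ^ 3"])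
      show "AE z in V. norm (?F \<rho> z) \<le> \<sigma> / \<rho> ^ 3"
      proof (rule AE_I2)
        fix z
        have "\<rho> \<le> ?S \<rho> z" using \<rho> by (intro real_le_rsqrt) auto
        then have "\<rho> ^ 3 \<le> (?S \<rho> z) ^ 3" using \<rho> by (intro power_mono) auto
        then show "norm (?F \<rho> z) \<le> \<sigma> / \<rho> ^ 3" using \<rho> Sp(1)[of z] \<sigma> by (auto intro!: frac_le)
      qed
    qed
    have "(\<integral>z. ?g z \<partial>V) \<le> (\<integral>\<tau>. parallelogram_area (?X (\<gamma> \<tau>)) (c \<tau>) \<partial>\<Gamma>)"
      by (rule first_variation(2)[OF bba sm der meas td])
    also have "\<dots> \<le> C / m * (1 - s)"
    proof -
      have le: "parallelogram_area (?X (\<gamma> \<tau>)) (c \<tau>) \<le> C / m" if \<tau>: "s < \<tau>" "\<tau> \<le> 1" for \<tau>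
      proof -
        let ?N = "sqrt ((norm (\<gamma> \<tau> - a))\<^sup>2 + \<rho>\<^sup>2)"
        have N: "m * (\<tau> - s) \<le> ?N"
          using arc_dist[of \<tau>] \<tau> by (intro order_trans[OF _ real_le_rsqrt[of "norm (\<gamma> \<tau> - a)"]]) auto
        have "parallelogram_area (?X (\<gamma> \<tau>)) (c \<tau>) = parallelogram_area e (c \<tau>) / ?N"
          unfolding parallelogram_area_scale_left using nz[of "\<gamma> \<tau> - a"] by simp
        also have "\<dots> \<le> (C * (\<tau> - s)) / (m * (\<tau> - s))"
          using area_e[of \<tau>] \<tau> N m0 C0 by (intro frac_le) auto
        also have "\<dots> = C / m" using \<tau> by simp
        finally show ?thesis .
      qed
      show ?thesis
      proof (rule integral_le_const_arc)
        show "integrable \<Gamma> (\<lambda>\<tau>. parallelogram_area (?X (\<gamma> \<tau>)) (c \<tau>))"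
        proof (rule integrable_arc_bounded)
          fix \<tau> assume "s < \<tau>" "\<tau> \<le> 1"
          then show "\<bar>parallelogram_area (?X (\<gamma> \<tau>)) (c \<tau>)\<bar> \<le> C / m" using le by simp
        qed measurable
        show "AE \<tau> in \<Gamma>. parallelogram_area (?X (\<gamma> \<tau>)) (c \<tau>) \<le> C / m"
          using AE_arc_measure[of s 1] by eventually_elim (use le in blast)
      qed (use s in simp)
    qed
    also have "\<dots> \<le> C / m * 1" using s C0 m0 by (intro mult_left_mono) auto
    finally have gle: "(\<integral>z. ?g z \<partial>V) \<le> C / m" by simp
    have "AE z in V. ?F \<rho> z \<le> 4 * (?g z + ?E z + 1 / \<sigma>\<^sup>2)"
      using planes_AE AE_off_arc AE_off_a
    proof eventually_elim
      case (elim z)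
      let ?y = "fst z - a" and ?s = "?S \<rho> z"
      have D: "D a z > 0" using elim(3) .
      have s3: "?s ^ 3 > 0" "(D a z) ^ 3 \<le> ?s ^ 3" using Sp[of z] by (auto intro: power_mono)
      have Pe: "?y \<bullet> (snd z *v e) = (snd z *v ?y) \<bullet> e" using plane_sym[OF elim(1)] .
      show ?case
      proof (cases "D a z < \<sigma>")
        case False
        have "\<bar>?y \<bullet> (snd z *v e)\<bar> \<le> D a z"
          unfolding Pe using Cauchy_Schwarz_ineq2[of "snd z *v ?y" e] plane_norm_le[OF elim(1), of ?y] norm_e by simp
        then have "\<bar>?g z\<bar> \<le> D a z / ?s ^ 3" using s3 by (simp add: abs_div divide_right_mono)
        also have "\<dots> \<le> D a z / (D a z) ^ 3" using s3 D by (intro divide_left_mono mult_pos_pos) auto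
        also have "\<dots> = 1 / (D a z)\<^sup>2" using D by (simp add: power2_eq_square power3_eq_cube)
        also have "\<dots> \<le> 1 / \<sigma>\<^sup>2" using False \<sigma> D by (intro divide_left_mono power_mono mult_pos_pos) auto
        finally have "\<bar>?g z\<bar> \<le> 1 / \<sigma>\<^sup>2" .
        moreover have "0 \<le> ?E z" by simp
        moreover have "0 \<le> 4 * (x + y + b)" if "\<bar>x\<bar> \<le> b" "0 \<le> y" for x y b :: real
          using that by (auto simp: abs_le_iff)
        ultimately have "0 \<le> 4 * (?g z + ?E z + 1 / \<sigma>\<^sup>2)" by blast
        then show ?thesis using False by (simp only: if_False)
      next
        case True
        have yq: "D a z / 2 < ?y \<bullet> e" using cone[of "fst z"] elim(2) True by simp
        have "?y \<bullet> e - (snd z *v ?y) \<bullet> e = (?y - snd z *v ?y) \<bullet> e" by (simp add: inner_diff_left)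
        also have "\<dots> \<le> perp a z" unfolding perp_def using norm_cauchy_schwarz[of "?y - snd z *v ?y" e] norm_e by simp
        finally have "D a z / 2 - perp a z \<le> ?y \<bullet> (snd z *v e)" using yq Pe by linarith
        then have "(D a z / 2 - perp a z) / ?s ^ 3 \<le> ?g z" using s3 by (intro divide_right_mono) auto
        then have 1: "(D a z / ?s ^ 3) / 2 - perp a z / ?s ^ 3 \<le> ?g z" by (simp add: diff_divide_distrib)
        have "perp a z / ?s ^ 3 \<le> ?E z + (D a z / ?s ^ 3) / 4"
        proof -
          define f u where "f = perp a z / (D a z)\<^sup>2" "u = (D a z)\<^sup>2 / ?s ^ 3"
          have "perp a z / ?s ^ 3 = f * u" using D by (simp add: f_u_def)
          also have "\<dots> \<le> f\<^sup>2 + u\<^sup>2 / 4" using zero_le_power2[of "f - u / 2"] by (simp add: power2_eq_square algebra_simps)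
          also have "f\<^sup>2 = ?E z" by (simp add: f_u_def power_divide flip: power_mult)
          also have "u\<^sup>2 \<le> D a z / ?s ^ 3"
          proof -
            have "u\<^sup>2 = (D a z / ?s ^ 3) * ((D a z) ^ 3 / ?s ^ 3)" by (simp add: f_u_def power2_eq_square power3_eq_cube)
            also have "\<dots> \<le> (D a z / ?s ^ 3) * 1" using s3 D by (intro mult_left_mono) auto
            finally show ?thesis by simp
          qed
          finally show ?thesis by simp
        qed
        moreover have "0 \<le> 1 / \<sigma>\<^sup>2" by simp
        moreover have "x \<le> 4 * (g + y + b)" if "x / 2 - p \<le> g" "p \<le> y + x / 4" "0 \<le> b" for x p g y b :: real
          using that by (simp add: field_simps)
        ultimately have "D a z / ?s ^ 3 \<le> 4 * (?g z + ?E z + 1 / \<sigma>\<^sup>2)" using 1 by blast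
        then show ?thesis using True by (simp only: if_True)
      qed
    qed
    moreover have igE: "integrable V (\<lambda>z. ?g z + ?E z)" by (rule Bochner_Integration.integrable_add[OF ig iE])
    ultimately have "(\<integral>z. ?F \<rho> z \<partial>V) \<le> (\<integral>z. 4 * (?g z + ?E z + 1 / \<sigma>\<^sup>2) \<partial>V)"
      by (intro integral_mono_AE[OF iF] integrable_mult_right Bochner_Integration.integrable_add[OF _ V.integrable_const])
    also have "\<dots> = 4 * ((\<integral>z. ?g z + ?E z \<partial>V) + ?M / \<sigma>\<^sup>2)"
      unfolding integral_mult_right_zero Bochner_Integration.integral_add[OF igE V.integrable_const] by (simp add: space_V)
    also have "(\<integral>z. ?g z + ?E z \<partial>V) = (\<integral>z. ?g z \<partial>V) + (\<integral>z. ?E z \<partial>V)"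
      by (rule Bochner_Integration.integral_add[OF ig iE])
    finally have "(\<integral>z. ?F \<rho> z \<partial>V) \<le> 4 * ((\<integral>z. ?g z \<partial>V) + (\<integral>z. ?E z \<partial>V) + ?M / \<sigma>\<^sup>2)" .
    also have "\<dots> \<le> B" using gle by (simp add: B_def)
    finally show "(\<integral>z. ?F \<rho> z \<partial>V) \<le> B" .
  qed
  let ?r = "\<lambda>k::nat. 1 / real (Suc k)"
  have r0: "?r \<longlonglongrightarrow> 0" using LIMSEQ_inverse_real_of_nat by (simp add: inverse_eq_divide)
  let ?G = "\<lambda>z. if D a z < \<sigma> then 1 / (D a z)\<^sup>2 else 0"
  have iG: "integrable V ?G"
  proof (rule integrable_limit_nonneg(1)[where F="\<lambda>k. ?F (?r k)" and B=B])
    show "AE z in V. (\<lambda>k. ?F (?r k) z) \<longlonglongrightarrow> ?G z"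
      using AE_off_a
    proof eventually_elim
      case (elim z)
      have "(\<lambda>k. D a z / (?S (?r k) z) ^ 3) \<longlonglongrightarrow> D a z / (sqrt ((D a z)\<^sup>2 + 0\<^sup>2)) ^ 3"
        using elim by (intro tendsto_intros r0) auto
      moreover have "D a z / (sqrt ((D a z)\<^sup>2 + 0\<^sup>2)) ^ 3 = 1 / (D a z)\<^sup>2"
        using elim by (simp add: power2_eq_square power3_eq_cube)
      ultimately show ?case by auto
    qed
  qed (use F in auto)
  obtain r0 where r0p: "r0 > 0" "\<And>r. 0 < r \<Longrightarrow> r < r0 \<Longrightarrow> 2 \<le> (\<integral>z. 2 * r\<^sup>2 / ((D a z)\<^sup>2 + r\<^sup>2)\<^sup>2 \<partial>V)"
    using lower_mass by blast
  have "(\<lambda>k. \<integral>z. 2 * (?r k)\<^sup>2 / ((D a z)\<^sup>2 + (?r k)\<^sup>2)\<^sup>2 \<partial>V) \<longlonglongrightarrow> (\<integral>z. 0 \<partial>V)"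
  proof (rule integral_dominated_convergence[where w="\<lambda>z. 2 * (?G z + 1 / \<sigma>\<^sup>2)"])
    show "AE z in V. (\<lambda>k. 2 * (?r k)\<^sup>2 / ((D a z)\<^sup>2 + (?r k)\<^sup>2)\<^sup>2) \<longlonglongrightarrow> 0"
      using AE_off_a
    proof eventually_elim
      case (elim z)
      have "(\<lambda>k. 2 * (?r k)\<^sup>2 / ((D a z)\<^sup>2 + (?r k)\<^sup>2)\<^sup>2) \<longlonglongrightarrow> 2 * 0\<^sup>2 / ((D a z)\<^sup>2 + 0\<^sup>2)\<^sup>2"
        using elim by (intro tendsto_intros r0) auto
      then show ?case by simp
    qed
    show "AE z in V. norm (2 * (?r k)\<^sup>2 / ((D a z)\<^sup>2 + (?r k)\<^sup>2)\<^sup>2) \<le> 2 * (?G z + 1 / \<sigma>\<^sup>2)" for k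
      using AE_off_a
    proof eventually_elim
      case (elim z)
      have le: "x / (y + x)\<^sup>2 \<le> 1 / y" if "x > 0" "y > 0" for x y :: real
      proof -
        have "x * y \<le> (y + x)\<^sup>2" using that by (simp add: power2_eq_square algebra_simps)
        then show ?thesis using that by (simp add: divide_simps)
      qed
      have 1: "(?r k)\<^sup>2 / ((D a z)\<^sup>2 + (?r k)\<^sup>2)\<^sup>2 \<le> 1 / (D a z)\<^sup>2" using elim by (intro le) auto
      have 2: "1 / (D a z)\<^sup>2 \<le> 1 / \<sigma>\<^sup>2" if "\<not> D a z < \<sigma>"
        using that \<sigma> by (intro divide_left_mono power_mono mult_pos_pos) auto
      have 3: "0 \<le> 1 / \<sigma>\<^sup>2" by simp
      have le2: "(?r k)\<^sup>2 / ((D a z)\<^sup>2 + (?r k)\<^sup>2)\<^sup>2 \<le> ?G z + 1 / \<sigma>\<^sup>2"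
      proof -
        have "x \<le> (if Q then u else 0) + b" if "x \<le> u" "\<not> Q \<Longrightarrow> u \<le> b" "0 \<le> b" for x u b :: real and Q
          using that by (cases Q) auto
        from this[OF 1 2 3] show ?thesis .
      qed
      have eq2: "norm (2 * (?r k)\<^sup>2 / ((D a z)\<^sup>2 + (?r k)\<^sup>2)\<^sup>2) = 2 * ((?r k)\<^sup>2 / ((D a z)\<^sup>2 + (?r k)\<^sup>2)\<^sup>2)" by simp
      show ?case unfolding eq2 by (rule mult_left_mono[OF le2]) simp
    qed
  qed (use iG in auto)
  then have "(\<lambda>k. \<integral>z. 2 * (?r k)\<^sup>2 / ((D a z)\<^sup>2 + (?r k)\<^sup>2)\<^sup>2 \<partial>V) \<longlonglongrightarrow> 0" by simp
  from order_tendstoD(2)[OF this, of 2]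
  have ev: "eventually (\<lambda>k. (\<integral>z. 2 * (?r k)\<^sup>2 / ((D a z)\<^sup>2 + (?r k)\<^sup>2)\<^sup>2 \<partial>V) < 2) sequentially" by simp
  have "eventually (\<lambda>k. False) sequentially"
    using ev order_tendstoD(2)[OF r0 r0p(1)]
  proof eventually_elim
    case (elim k)
    then show False using r0p(2)[of "?r k"] by simp
  qed
  then show False by simp
qed

end

lemma DERIV_rotation_weight:
  fixes t \<rho> b l :: real
  assumes t: "t \<ge> 0" and \<rho>: "\<rho> > 0" and l: "l > 0" "b \<le> l / 2"
  defines "S \<equiv> \<lambda>t. sqrt (t + \<rho>\<^sup>2)"
  shows "((\<lambda>t. 1 / (S t * ((S t)\<^sup>2 - 2 * S t * b + l\<^sup>2))) has_real_derivative
      - (3 * (S t)\<^sup>2 - 4 * S t * b + l\<^sup>2) / (2 * (S t) ^ 3 * ((S t)\<^sup>2 - 2 * S t * b + l\<^sup>2)\<^sup>2)) (at t)"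
proof -
  have pos: "t + \<rho>\<^sup>2 > 0" using t \<rho> by (simp add: add_nonneg_pos)
  then have S: "S t > 0" by (simp add: S_def)
  have "(S t)\<^sup>2 - 2 * S t * b + l\<^sup>2 > 0"
  proof -
    have "2 * S t * b \<le> S t * l" using mult_left_mono[OF l(2), of "2 * S t"] S by simp
    moreover have "S t * l \<le> ((S t)\<^sup>2 + l\<^sup>2) / 2" using sum_squares_bound[of "S t" l] by simp
    moreover have "0 < (S t)\<^sup>2 + l\<^sup>2" using S by (simp add: add_pos_nonneg)
    ultimately show ?thesis by (simp add: field_simps)
  qed
  then have Q: "S t * ((S t)\<^sup>2 - 2 * S t * b + l\<^sup>2) \<noteq> 0" using S by simp
  have dS: "(S has_real_derivative 1 / (2 * S t)) (at t)"
    unfolding S_def using pos by (auto intro!: derivative_eq_intros simp: inverse_eq_divide)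
  have dG: "((\<lambda>x. x * (x\<^sup>2 - 2 * x * b + l\<^sup>2)) has_real_derivative 3 * x\<^sup>2 - 4 * x * b + l\<^sup>2) (at x)" for x
    by (auto intro!: derivative_eq_intros simp: power2_eq_square algebra_simps)
  have "((\<lambda>t. S t * ((S t)\<^sup>2 - 2 * S t * b + l\<^sup>2)) has_real_derivative
      (3 * (S t)\<^sup>2 - 4 * S t * b + l\<^sup>2) * (1 / (2 * S t))) (at t)"
    by (rule DERIV_chain2[OF dG dS])
  from DERIV_inverse'[OF this Q]
  have d: "((\<lambda>t. inverse (S t * ((S t)\<^sup>2 - 2 * S t * b + l\<^sup>2))) has_real_derivative
     - (inverse (S t * ((S t)\<^sup>2 - 2 * S t * b + l\<^sup>2)) * ((3 * (S t)\<^sup>2 - 4 * S t * b + l\<^sup>2) * (1 / (2 * S t)))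
        * inverse (S t * ((S t)\<^sup>2 - 2 * S t * b + l\<^sup>2)))) (at t)" .
  have e: "- (inverse (x * z) * (n * (1 / (2 * x))) * inverse (x * z)) = - n / (2 * x ^ 3 * z\<^sup>2)" for x z n :: real
  proof -
    have "inverse u * (n * (1 / v)) * inverse u = n / (v * u * u)" for u v :: real
      by (simp only: inverse_eq_divide times_divide_eq_right times_divide_eq_left divide_divide_eq_left
          mult_1_left mult_1_right mult_ac)
    then have "inverse (x * z) * (n * (1 / (2 * x))) * inverse (x * z) = n / (2 * x * (x * z) * (x * z))" .
    also have "2 * x * (x * z) * (x * z) = 2 * x ^ 3 * z\<^sup>2"
      by (simp only: power2_eq_square power3_eq_cube mult_ac)
    finally show ?thesis by (simp only: minus_divide_left)
  qed
  show ?thesis using d unfolding e unfolding inverse_eq_divide .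
qed

context touching_varifold begin

definition rot :: "real^'n \<Rightarrow> real^'n \<Rightarrow> real^'n" where
  "rot w h = (e \<bullet> h) *\<^sub>R w - (w \<bullet> h) *\<^sub>R e"

lemma norm_rot: "norm (rot w h) \<le> 2 * norm w * norm h"
proof -
  have "norm (rot w h) \<le> norm ((e \<bullet> h) *\<^sub>R w) + norm ((w \<bullet> h) *\<^sub>R e)" unfolding rot_def by (rule norm_triangle_ineq4)
  also have "\<dots> = \<bar>e \<bullet> h\<bar> * norm w + \<bar>w \<bullet> h\<bar>" by (simp add: norm_e)
  also have "\<dots> \<le> norm h * norm w + norm w * norm h"
    using Cauchy_Schwarz_ineq2[of e h] Cauchy_Schwarz_ineq2[of w h] norm_e by (intro add_mono mult_right_mono) auto
  finally show ?thesis by (simp add: mult_ac)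
qed

lemma rot_orth: "h \<bullet> rot w h = 0"
  by (simp add: rot_def inner_diff_right inner_commute)

lemma rot_linear: "linear (rot w)"
  by (intro linearI) (simp_all add: rot_def inner_add_right algebra_simps)

lemma rot_add: "rot w (x + y) = rot w x + rot w y" and rot_scale: "rot w (k *\<^sub>R x) = k *\<^sub>R rot w x"
  using linear_add[OF rot_linear] linear_scale[OF rot_linear] by auto

lemma rot_e: "w \<bullet> e = 0 \<Longrightarrow> rot w e = w"
  by (simp add: rot_def norm_e power2_norm_eq_inner[symmetric])

text \<open>Data of the pole \<open>q\<close>.\<close>

definition axial :: "real^'n \<Rightarrow> real" where "axial q = (q - a) \<bullet> e"
definition lateral :: "real^'n \<Rightarrow> real^'n" where "lateral q = (q - a) - axial q *\<^sub>R e"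
definition Q :: "real^'n \<Rightarrow> real \<Rightarrow> real" where
  "Q q t = t\<^sup>2 - 2 * t * axial q + (norm (q - a))\<^sup>2"

lemma lateral_e: "lateral q \<bullet> e = 0"
  by (simp add: lateral_def axial_def inner_diff_left norm_e power2_norm_eq_inner[symmetric])

lemma norm_sub_e: "(norm (w - b *\<^sub>R e))\<^sup>2 = (norm w)\<^sup>2 - 2 * b * (w \<bullet> e) + b\<^sup>2"
proof -
  have "e \<bullet> e = 1" by (simp add: norm_e power2_norm_eq_inner[symmetric])
  then show ?thesis unfolding power2_norm_eq_inner
    by (simp add: inner_diff_left inner_diff_right inner_commute[of e w] power2_eq_square algebra_simps)
qed

lemma norm_lateral: "norm (lateral q) \<le> norm (q - a)"
proof -
  have "(norm (lateral q))\<^sup>2 = (norm (q - a))\<^sup>2 - (axial q)\<^sup>2"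
    unfolding lateral_def norm_sub_e axial_def by (simp add: power2_eq_square)
  then have "(norm (lateral q))\<^sup>2 \<le> (norm (q - a))\<^sup>2" by simp
  then show ?thesis by (simp add: power2_le_iff_abs_le)
qed

lemma Q_eq: "Q q t = (norm (t *\<^sub>R e - (q - a)))\<^sup>2"
  using norm_sub_e[of "q - a" t] by (simp add: Q_def axial_def norm_minus_commute mult_ac)

lemma Q_lower:
  assumes "axial q \<le> norm (q - a) / 2" "t \<ge> 0"
  shows "(t\<^sup>2 + (norm (q - a))\<^sup>2) / 2 \<le> Q q t"
proof -
  have "2 * t * axial q \<le> t * norm (q - a)" using mult_left_mono[OF assms(1), of "2 * t"] assms(2) by simp
  moreover have "t * norm (q - a) \<le> (t\<^sup>2 + (norm (q - a))\<^sup>2) / 2" using sum_squares_bound[of t "norm (q - a)"] by simp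
  ultimately show ?thesis unfolding Q_def by (simp add: field_simps)
qed

definition S :: "real \<Rightarrow> real^'n \<Rightarrow> real" where "S \<rho> x = sqrt ((norm (x - a))\<^sup>2 + \<rho>\<^sup>2)"

definition correction :: "real^'n \<Rightarrow> real \<Rightarrow> real^'n \<Rightarrow> real^'n" where
  "correction q \<rho> x = (1 / (S \<rho> x * Q q (S \<rho> x))) *\<^sub>R rot (lateral q) (x - a)"

definition error :: "real \<Rightarrow> (real^'n) \<times> (real^'n^'n) \<Rightarrow> real" where
  "error l z = (perp a z / (D a z)\<^sup>2) * (l / ((D a z)\<^sup>2 + l\<^sup>2))"

lemma measurable_error [measurable]: "error l \<in> borel_measurable V"
  unfolding error_def by measurable

lemma correction_field:
  assumes q: "axial q \<le> norm (q - a) / 2" "q \<noteq> a" and \<rho>: "\<rho> > 0"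
  obtains X' g where "smooth (correction q \<rho>)" "\<And>x. (correction q \<rho> has_derivative X' x) (at x)"
    "g \<in> borel_measurable V" "\<And>z. snd z \<in> planes \<Longrightarrow> tangential_div (snd z) (X' (fst z)) = g z"
    "\<And>z. snd z \<in> planes \<Longrightarrow> D a z > 0 \<Longrightarrow> \<bar>g z\<bar> \<le> 40 * error (norm (q - a)) z"
proof -
  let ?l = "norm (q - a)" and ?b = "axial q" and ?w = "lateral q"
  have l: "?l > 0" using q(2) by simp
  have nz: "(norm (y::real^'n))\<^sup>2 + \<rho>\<^sup>2 > 0" for y using \<rho> by (simp add: add_nonneg_pos)
  have Sp: "S \<rho> x > 0" "norm (x - a) \<le> S \<rho> x" for x unfolding S_def using nz[of "x - a"] by (auto intro: real_le_rsqrt)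
  have Qp: "Q q t > 0" if "t > 0" for t
  proof -
    have "0 < (t\<^sup>2 + ?l\<^sup>2) / 2" using that l by (simp add: add_pos_pos)
    then show ?thesis using Q_lower[OF q(1), of t] that by linarith
  qed
  let ?S = "\<lambda>t. sqrt (t + \<rho>\<^sup>2)"
  let ?\<phi> = "\<lambda>t. 1 / (?S t * Q q (?S t))"
  let ?\<phi>' = "\<lambda>t. - (3 * (?S t)\<^sup>2 - 4 * ?S t * ?b + ?l\<^sup>2) / (2 * (?S t) ^ 3 * (Q q (?S t))\<^sup>2)"
  let ?W = "\<lambda>x. rot ?w (x - a)"
  let ?X' = "\<lambda>x h. (2 * ?\<phi>' ((norm (x - a))\<^sup>2) * ((x - a) \<bullet> h)) *\<^sub>R ?W x + ?\<phi> ((norm (x - a))\<^sup>2) *\<^sub>R rot ?w h"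
  let ?g = "\<lambda>z. 2 * ?\<phi>' ((D a z)\<^sup>2) * ((fst z - a) \<bullet> (snd z *v ?W (fst z)))"
  have Xeq: "correction q \<rho> = (\<lambda>x. ?\<phi> ((norm (x - a))\<^sup>2) *\<^sub>R ?W x)"
    by (simp add: correction_def S_def fun_eq_iff)
  have sS: "smooth (S \<rho>)" unfolding S_def
    by (intro smooth_sqrt smooth_add smooth_norm_sq smooth_diff smooth_ident smooth_const) (use nz in auto)
  have sW: "smooth ?W" unfolding rot_def
    by (intro smooth_diff smooth_scaleR smooth_inner smooth_ident smooth_const)
  have sm: "smooth (correction q \<rho>)" unfolding correction_def Q_def
    by (intro smooth_scaleR[OF _ sW] smooth_divide smooth_mult smooth_add smooth_diff smooth_power smooth_const sS)
       (use Sp(1) Qp[OF Sp(1)] in \<open>auto simp: Q_def less_imp_neq[THEN not_sym]\<close>)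
  have dW: "(?W has_derivative rot ?w) (at x)" for x
  proof -
    have "bounded_linear (rot ?w)" by (rule linear_conv_bounded_linear[THEN iffD1, OF rot_linear])
    then have "((\<lambda>x. rot ?w x - rot ?w a) has_derivative (\<lambda>h. rot ?w h - 0)) (at x)"
      by (intro has_derivative_diff has_derivative_const bounded_linear_imp_has_derivative)
    then show ?thesis by (simp add: linear_diff[OF rot_linear])
  qed
  have der: "(correction q \<rho> has_derivative ?X' x) (at x)" for x
    unfolding Xeq
    by (rule has_derivative_radial_weight[OF dW])
       (use DERIV_rotation_weight[OF _ \<rho> l q(1), of "(norm (x - a))\<^sup>2"] in \<open>simp add: Q_def\<close>)
  have td: "tangential_div (snd z) (?X' (fst z)) = ?g z" if z: "snd z \<in> planes" for z
    unfolding tangential_div_radial_weight[OF z] using tangential_div_skew[OF z, of e ?w] by (simp add: rot_def[abs_def])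
  have mW: "(\<lambda>z. ?W (fst z)) \<in> borel_measurable V" unfolding rot_def by measurable
  have meas: "?g \<in> borel_measurable V" unfolding Q_def using mW by measurable
  have bound: "\<bar>?g z\<bar> \<le> 40 * error ?l z" if z: "snd z \<in> planes" and D: "D a z > 0" for z
  proof -
    let ?y = "fst z - a"
    let ?s = "S \<rho> (fst z)"
    have s: "?s > 0" "D a z \<le> ?s" using Sp by auto
    have prod: "\<bar>u * v\<bar> \<le> b * d" if "\<bar>v\<bar> \<le> d" "\<bar>u\<bar> \<le> b" for u v b d :: real
    proof -
      have "0 \<le> b" using order_trans[OF abs_ge_zero that(2)] .
      then show ?thesis unfolding abs_mult using mult_mono[OF that(2,1)] by simp
    qed
    have "\<bar>?y \<bullet> (snd z *v ?W (fst z))\<bar> \<le> perp a z * (2 * ?l * D a z)"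
    proof -
      have "?y \<bullet> (snd z *v ?W (fst z)) = (snd z *v ?y) \<bullet> rot ?w ?y" using plane_sym[OF z] .
      also have "\<dots> = - ((?y - snd z *v ?y) \<bullet> rot ?w ?y)" using rot_orth[of ?y ?w] by (simp add: inner_diff_left)
      finally have "\<bar>?y \<bullet> (snd z *v ?W (fst z))\<bar> \<le> perp a z * norm (rot ?w ?y)"
        unfolding perp_def using Cauchy_Schwarz_ineq2[of "?y - snd z *v ?y" "rot ?w ?y"] by simp
      also have "norm (rot ?w ?y) \<le> 2 * ?l * D a z"
        using norm_rot[of ?w ?y] norm_lateral[of q] by (smt (verit) mult_right_mono norm_ge_zero)
      finally show ?thesis by (simp add: mult_left_mono)
    qed
    moreover have "\<bar>2 * ?\<phi>' ((D a z)\<^sup>2)\<bar> \<le> 20 / (?s ^ 3 * (?s\<^sup>2 + ?l\<^sup>2))"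
    proof -
      have Ss: "?S ((D a z)\<^sup>2) = ?s" by (simp add: S_def)
      have "\<bar>?b\<bar> \<le> ?l" unfolding axial_def using Cauchy_Schwarz_ineq2[of "q - a" e] norm_e by simp
      then have "\<bar>4 * ?s * ?b\<bar> \<le> 4 * ?s * ?l" using s by (simp add: abs_mult)
      moreover have "2 * ?s * ?l \<le> ?s\<^sup>2 + ?l\<^sup>2" using sum_squares_bound[of ?s ?l] by simp
      ultimately have "\<bar>3 * ?s\<^sup>2 - 4 * ?s * ?b + ?l\<^sup>2\<bar> \<le> 5 * (?s\<^sup>2 + ?l\<^sup>2)"
      proof -
        have "\<bar>3 * A - u + B\<bar> \<le> 5 * (A + B)" if "\<bar>u\<bar> \<le> 4 * p" "2 * p \<le> A + B" "0 \<le> A" "0 \<le> B" for A B u p :: real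
          using that by (auto simp: abs_le_iff)
        from this[of _ "?s * ?l"] show "\<bar>4 * ?s * ?b\<bar> \<le> 4 * ?s * ?l \<Longrightarrow> 2 * ?s * ?l \<le> ?s\<^sup>2 + ?l\<^sup>2 \<Longrightarrow> ?thesis"
          by (simp only: mult.assoc zero_le_power2)
      qed
      moreover have "((?s\<^sup>2 + ?l\<^sup>2) / 2)\<^sup>2 \<le> (Q q ?s)\<^sup>2" using Q_lower[OF q(1), of ?s] s by (intro power_mono) auto
      moreover have sl: "?s\<^sup>2 + ?l\<^sup>2 > 0" using s by (simp add: add_pos_nonneg)
      ultimately have "\<bar>3 * ?s\<^sup>2 - 4 * ?s * ?b + ?l\<^sup>2\<bar> / (?s ^ 3 * (Q q ?s)\<^sup>2)
         \<le> 5 * (?s\<^sup>2 + ?l\<^sup>2) / (?s ^ 3 * ((?s\<^sup>2 + ?l\<^sup>2) / 2)\<^sup>2)"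
        using s by (intro frac_le mult_left_mono mult_pos_pos) auto
      also have "\<dots> = 20 / (?s ^ 3 * (?s\<^sup>2 + ?l\<^sup>2))"
      proof -
        have "5 * x / (y * (x / 2)\<^sup>2) = 20 / (y * x)" if "x > 0" "y > 0" for x y :: real
          using that by (simp add: power2_eq_square)
        from this[OF sl] show ?thesis using s by simp
      qed
      finally have "\<bar>3 * ?s\<^sup>2 - 4 * ?s * ?b + ?l\<^sup>2\<bar> / (?s ^ 3 * (Q q ?s)\<^sup>2) \<le> 20 / (?s ^ 3 * (?s\<^sup>2 + ?l\<^sup>2))" .
      moreover have abs_form: "\<bar>2 * (- N / (2 * x * y))\<bar> = \<bar>N\<bar> / (x * y)" if "0 \<le> x" "0 \<le> y" for N x y :: real
      proof -
        have "2 * (- N / (2 * x * y)) = - (N / (x * y))" by simp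
        then show ?thesis using that by (simp only: abs_minus_cancel abs_divide abs_mult abs_of_nonneg)
      qed
      have "\<bar>2 * (- (3 * ?s\<^sup>2 - 4 * ?s * ?b + ?l\<^sup>2) / (2 * ?s ^ 3 * (Q q ?s)\<^sup>2))\<bar>
          = \<bar>3 * ?s\<^sup>2 - 4 * ?s * ?b + ?l\<^sup>2\<bar> / (?s ^ 3 * (Q q ?s)\<^sup>2)"
        by (rule abs_form) (use s in auto)
      ultimately show ?thesis unfolding Ss by (simp only:)
    qed
    ultimately have "\<bar>?g z\<bar> \<le> 20 / (?s ^ 3 * (?s\<^sup>2 + ?l\<^sup>2)) * (perp a z * (2 * ?l * D a z))"
      by (rule prod)
    also have "\<dots> \<le> 20 / ((D a z) ^ 3 * ((D a z)\<^sup>2 + ?l\<^sup>2)) * (perp a z * (2 * ?l * D a z))"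
    proof (rule mult_right_mono[OF divide_left_mono])
      show "(D a z) ^ 3 * ((D a z)\<^sup>2 + ?l\<^sup>2) \<le> ?s ^ 3 * (?s\<^sup>2 + ?l\<^sup>2)"
        using less_imp_le[OF s(1)]
        by (intro mult_mono[OF power_mono[OF s(2)] add_right_mono[OF power_mono[OF s(2)]]]) auto
      show "0 < ?s ^ 3 * (?s\<^sup>2 + ?l\<^sup>2) * ((D a z) ^ 3 * ((D a z)\<^sup>2 + ?l\<^sup>2))"
        by (intro mult_pos_pos zero_less_power add_pos_nonneg s(1) D zero_le_power2)
    qed auto
    also have "\<dots> = 40 * error ?l z"
    proof -
      have "20 / (d ^ 3 * x) * (p * (2 * l * d)) = 40 * (p / d\<^sup>2 * (l / x))" if "d > 0" for d x p l :: real
        using that by (simp add: power2_eq_square power3_eq_cube)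
      from this[OF D] show ?thesis unfolding error_def .
    qed
    finally show ?thesis .
  qed
  show thesis
  proof (rule that[of ?X' ?g])
    show "smooth (correction q \<rho>)" by (rule sm)
    show "(correction q \<rho> has_derivative ?X' x) (at x)" for x by (rule der)
    show "?g \<in> borel_measurable V" by (rule meas)
    show "tangential_div (snd z) (?X' (fst z)) = ?g z" if "snd z \<in> planes" for z by (rule td[OF that])
    show "\<bar>?g z\<bar> \<le> 40 * error ?l z" if "snd z \<in> planes" "D a z > 0" for z by (rule bound[OF that])
  qed
qed

lemma error_vanishes:
  assumes l: "l \<longlonglongrightarrow> 0" "\<And>k. 0 < l k"
  shows "integrable V (error (l k))" and "\<epsilon> > 0 \<Longrightarrow> eventually (\<lambda>k. (\<integral>z. error (l k) z \<partial>V) < \<epsilon>) sequentially"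
proof -
  let ?f = "\<lambda>z. perp a z / (D a z)\<^sup>2" and ?h = "\<lambda>k z. l k / ((D a z)\<^sup>2 + (l k)\<^sup>2)"
  let ?E = "\<lambda>z. (perp a z)\<^sup>2 / (D a z) ^ 4"
  have iE: "integrable V ?E" using perp_energy[OF bba s(1) _ , of s] s by simp
  have fE: "(?f z)\<^sup>2 = ?E z" for z by (simp add: power_divide flip: power_mult)
  have hK: "2 * (?h k z)\<^sup>2 = 2 * (l k)\<^sup>2 / ((D a z)\<^sup>2 + (l k)\<^sup>2)\<^sup>2" for k z by (simp add: power_divide)
  have ih: "integrable V (\<lambda>z. 2 * (?h k z)\<^sup>2)" for k unfolding hK by (rule integrable_kernel[OF l(2)])
  have h\<Lambda>: "(\<integral>z. 2 * (?h k z)\<^sup>2 \<partial>V) \<le> \<Lambda>" for k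
  proof -
    have "(\<integral>z. 2 * (?h k z)\<^sup>2 \<partial>V) \<le> (\<integral>z. 2 * ((l k)\<^sup>2 + (perp a z)\<^sup>2) / ((D a z)\<^sup>2 + (l k)\<^sup>2)\<^sup>2 \<partial>V)"
      unfolding hK
    proof (rule integral_mono[OF integrable_kernel[OF l(2)] monotonicity(1)[OF bba l(2)]])
      show "2 * (l k)\<^sup>2 / ((D a z)\<^sup>2 + (l k)\<^sup>2)\<^sup>2
          \<le> 2 * ((l k)\<^sup>2 + (perp a z)\<^sup>2) / ((D a z)\<^sup>2 + (l k)\<^sup>2)\<^sup>2" for z
        by (rule divide_right_mono) auto
    qed
    also have "\<dots> \<le> \<Lambda>" by (rule monotonicity_on_arc[OF bba s(1) _ l(2)]) (use s in auto)
    finally show ?thesis .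
  qed
  have h0: "0 \<le> ?h k z" for k z using l(2)[of k] by simp
  have f0: "0 \<le> ?f z" for z by simp
  have young: "x * y \<le> \<theta> * y\<^sup>2 + x\<^sup>2 / (4 * \<theta>)" if "\<theta> > 0" for x y \<theta> :: real
  proof -
    have "0 \<le> (x - 2 * \<theta> * y)\<^sup>2" by simp
    then have "4 * \<theta> * (x * y) \<le> 4 * \<theta> * (\<theta> * y\<^sup>2 + x\<^sup>2 / (4 * \<theta>))"
      using that by (simp add: power2_eq_square algebra_simps)
    then show ?thesis using that by simp
  qed
  show int: "integrable V (error (l k))" for k
  proof (rule Bochner_Integration.integrable_bound)
    show "integrable V (\<lambda>z. 2 * (?h k z)\<^sup>2 + ?E z)" by (rule Bochner_Integration.integrable_add[OF ih iE])
    show "AE z in V. norm (error (l k) z) \<le> norm (2 * (?h k z)\<^sup>2 + ?E z)"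
    proof (rule AE_I2)
      fix z
      have "x * y \<le> 2 * y\<^sup>2 + x\<^sup>2" for x y :: real
        using young[of 2 x y] zero_le_power2[of x] by linarith
      from this[of "?f z" "?h k z"] have "?f z * ?h k z \<le> 2 * (?h k z)\<^sup>2 + ?E z" unfolding fE .
      moreover have "0 \<le> ?f z * ?h k z" using f0 h0 by (rule mult_nonneg_nonneg)
      moreover have "norm (error (l k) z) = ?f z * ?h k z" using calculation(2) by (simp only: error_def real_norm_def abs_of_nonneg)
      ultimately show "norm (error (l k) z) \<le> norm (2 * (?h k z)\<^sup>2 + ?E z)"
        using order_trans[OF _ abs_ge_self, of "?f z * ?h k z"] by (simp only: real_norm_def)
    qed
  qed measurable
  assume \<epsilon>: "\<epsilon> > 0"
  define \<theta> where "\<theta> = \<epsilon> / (2 * (\<Lambda> + 1))"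
  have \<theta>: "\<theta> > 0" using \<epsilon> \<Lambda>_nonneg by (simp add: \<theta>_def)
  let ?e = "\<lambda>k z. max 0 (error (l k) z - \<theta> * (2 * (?h k z)\<^sup>2))"
  have ie: "integrable V (?e k)" for k
    by (intro Bochner_Integration.integrable_max Bochner_Integration.integrable_diff integrable_mult_right integrable_zero int ih)
  have "(\<lambda>k. \<integral>z. ?e k z \<partial>V) \<longlonglongrightarrow> (\<integral>z. 0 \<partial>V)"
  proof (rule integral_dominated_convergence[where w="\<lambda>z. ?E z / (4 * (2 * \<theta>))"])
    show "AE z in V. (\<lambda>k. ?e k z) \<longlonglongrightarrow> 0"
      using AE_off_a
    proof eventually_elim
      case (elim z)
      have "(\<lambda>k. max 0 (?f z * ?h k z - \<theta> * (2 * (?h k z)\<^sup>2)))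
         \<longlonglongrightarrow> max 0 (?f z * (0 / ((D a z)\<^sup>2 + 0\<^sup>2)) - \<theta> * (2 * (0 / ((D a z)\<^sup>2 + 0\<^sup>2))\<^sup>2))"
        using elim by (intro tendsto_intros l) auto
      then show ?case by (simp add: error_def)
    qed
    show "AE z in V. norm (?e k z) \<le> ?E z / (4 * (2 * \<theta>))" for k
    proof (rule AE_I2)
      fix z
      have "?f z * ?h k z \<le> (2 * \<theta>) * (?h k z)\<^sup>2 + ?E z / (4 * (2 * \<theta>))"
        using young[of "2 * \<theta>" "?f z" "?h k z"] \<theta> unfolding fE by simp
      then have "error (l k) z - \<theta> * (2 * (?h k z)\<^sup>2) \<le> ?E z / (4 * (2 * \<theta>))" by (simp add: error_def)
      moreover have "0 \<le> ?E z / (4 * (2 * \<theta>))" using \<theta> by simp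
      moreover have "\<bar>max 0 x\<bar> \<le> w" if "x \<le> w" "0 \<le> w" for x w :: real using that by auto
      ultimately show "norm (?e k z) \<le> ?E z / (4 * (2 * \<theta>))" unfolding real_norm_def by blast
    qed
  qed (use ie Bochner_Integration.integrable_divide[OF iE, of "4 * (2 * \<theta>)"] in auto)
  then have "(\<lambda>k. \<integral>z. ?e k z \<partial>V) \<longlonglongrightarrow> 0" by simp
  from order_tendstoD(2)[OF this, of "\<epsilon> / 2"] \<epsilon>
  have "eventually (\<lambda>k. (\<integral>z. ?e k z \<partial>V) < \<epsilon> / 2) sequentially" by simp
  then show "eventually (\<lambda>k. (\<integral>z. error (l k) z \<partial>V) < \<epsilon>) sequentially"
  proof eventually_elim
    case (elim k)
    have "(\<integral>z. error (l k) z \<partial>V) \<le> (\<integral>z. ?e k z + \<theta> * (2 * (?h k z)\<^sup>2) \<partial>V)"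
    proof (rule integral_mono[OF int])
      show "integrable V (\<lambda>z. ?e k z + \<theta> * (2 * (?h k z)\<^sup>2))"
        by (intro Bochner_Integration.integrable_add ie integrable_mult_right ih)
      have "x \<le> max 0 (x - y) + y" for x y :: real by (simp add: max_def)
      then show "error (l k) z \<le> ?e k z + \<theta> * (2 * (?h k z)\<^sup>2)" for z .
    qed
    also have "\<dots> = (\<integral>z. ?e k z \<partial>V) + \<theta> * (\<integral>z. 2 * (?h k z)\<^sup>2 \<partial>V)"
      unfolding Bochner_Integration.integral_add[OF ie integrable_mult_right[OF ih]] integral_mult_right_zero ..
    also have "\<dots> \<le> (\<integral>z. ?e k z \<partial>V) + \<theta> * (\<Lambda> + 1)"
      using h\<Lambda>[of k] \<theta> by (intro add_left_mono mult_left_mono) auto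
    also have "\<theta> * (\<Lambda> + 1) = \<epsilon> / 2"
    proof -
      have *: "\<epsilon> / (2 * x) * x = \<epsilon> / 2" if "x > 0" for x using that by simp
      have "\<Lambda> + 1 > 0" using \<Lambda>_nonneg by simp
      from *[OF this] show ?thesis unfolding \<theta>_def .
    qed
    finally show ?case using elim by linarith
  qed
qed

end

context touching_varifold begin

definition limit_field :: "real^'n \<Rightarrow> real^'n \<Rightarrow> real^'n" where
  "limit_field q x = (1 / (norm (x - q))\<^sup>2) *\<^sub>R (x - q)
     + (1 / (norm (x - a) * Q q (norm (x - a)))) *\<^sub>R rot (lateral q) (x - a)"

definition A0 :: real where "A0 = 2 * C / m\<^sup>2"
definition r1 :: real where "r1 = 1 / (4 * (A0 + 1))"

lemma A0_nonneg: "0 \<le> A0" using C0 by (simp add: A0_def)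
lemma r1_pos: "0 < r1" using A0_nonneg by (simp add: r1_def)

lemma arc_deviation:
  assumes "s \<le> \<tau>" "\<tau> \<le> 1"
  shows "norm ((\<gamma> \<tau> - a) - norm (\<gamma> \<tau> - a) *\<^sub>R e) \<le> A0 * (norm (\<gamma> \<tau> - a))\<^sup>2"
proof -
  let ?y = "\<gamma> \<tau> - a" and ?h = "\<tau> - s"
  have 1: "norm (?y - (?h * norm (c s)) *\<^sub>R e) \<le> C * ?h\<^sup>2"
    using taylor[of \<tau> s] assms s e_c by (simp add: scaleR_scaleR[symmetric] del: scaleR_scaleR)
  have n: "norm ((?h * norm (c s)) *\<^sub>R e) = ?h * norm (c s)" using assms by (simp add: norm_e)
  have "\<bar>norm ?y - ?h * norm (c s)\<bar> \<le> C * ?h\<^sup>2"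
    using norm_triangle_ineq3[of ?y "(?h * norm (c s)) *\<^sub>R e"] 1 n by linarith
  then have 2: "norm ((?h * norm (c s)) *\<^sub>R e - norm ?y *\<^sub>R e) \<le> C * ?h\<^sup>2"
    by (simp add: scaleR_left_diff_distrib[symmetric] norm_e abs_minus_commute)
  have "norm (?y - norm ?y *\<^sub>R e) \<le> C * ?h\<^sup>2 + C * ?h\<^sup>2"
    by (rule norm_diff_triangle_le[OF 1 2])
  also have "\<dots> = A0 * (m * ?h)\<^sup>2" using m0 by (simp add: A0_def power_mult_distrib)
  also have "\<dots> \<le> A0 * (norm ?y)\<^sup>2"
    using arc_dist[OF assms] assms m0 A0_nonneg by (intro mult_left_mono power_mono) auto
  finally show ?thesis .
qed

lemma arc_point_pos: "s < \<tau> \<Longrightarrow> \<tau> \<le> 1 \<Longrightarrow> norm (\<gamma> \<tau> - a) > 0"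
  using inj_gamma[of \<tau> s] s by simp

lemma pole_distance:
  assumes q: "axial q \<le> norm (q - a) / 2" "norm (q - a) \<le> r1 / 2" and \<tau>: "s < \<tau>" "\<tau> \<le> 1"
  shows "sqrt (Q q (norm (\<gamma> \<tau> - a))) / 3 \<le> norm (\<gamma> \<tau> - q)"
proof -
  let ?y = "\<gamma> \<tau> - a" and ?w = "q - a"
  let ?r = "norm ?y"
  have N: "sqrt (Q q ?r) = norm (?r *\<^sub>R e - ?w)" by (simp add: Q_eq)
  have r: "?r > 0" by (rule arc_point_pos[OF \<tau>])
  show ?thesis
  proof (cases "?r \<le> r1")
    case True
    have "(?r / 2)\<^sup>2 = ?r\<^sup>2 / 4" by (simp add: power_divide)
    moreover have "u \<le> v" if "u = x / 4" "(x + y) / 2 \<le> v" "0 \<le> x" "0 \<le> y" for u v x y :: real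
      using that by simp
    ultimately have "(?r / 2)\<^sup>2 \<le> Q q ?r"
      using Q_lower[OF q(1), of ?r, OF norm_ge_zero] zero_le_power2[of ?r] zero_le_power2[of "norm ?w"] by blast
    then have n: "?r / 2 \<le> sqrt (Q q ?r)" by (rule real_le_rsqrt)
    have "A0 * ?r\<^sup>2 = (A0 * ?r) * ?r" by (simp add: power2_eq_square)
    also have "\<dots> \<le> (1 / 4) * ?r"
    proof (rule mult_right_mono)
      have "A0 * ?r \<le> (A0 + 1) * r1" using True r A0_nonneg by (intro mult_mono) auto
      also have "\<dots> = 1 / 4" using A0_nonneg by (simp add: r1_def)
      finally show "A0 * ?r \<le> 1 / 4" .
    qed simp
    finally have "norm (?y - ?r *\<^sub>R e) \<le> sqrt (Q q ?r) / 2" using arc_deviation[of \<tau>] \<tau> n by linarith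
    moreover have "norm (?r *\<^sub>R e - ?w) \<le> norm (\<gamma> \<tau> - q) + norm (?y - ?r *\<^sub>R e)"
      using norm_triangle_ineq4[of "\<gamma> \<tau> - q" "?y - ?r *\<^sub>R e"] by (simp add: algebra_simps)
    ultimately show ?thesis unfolding N using norm_ge_zero[of "?r *\<^sub>R e - ?w"] by linarith
  next
    case False
    have "norm (?r *\<^sub>R e - ?w) \<le> ?r + norm ?w" using norm_triangle_ineq4[of "?r *\<^sub>R e" ?w] norm_e by simp
    moreover have "?r \<le> norm (\<gamma> \<tau> - q) + norm ?w" using norm_triangle_ineq[of "\<gamma> \<tau> - q" ?w] by simp
    ultimately show ?thesis unfolding N using False q(2) r by linarith
  qed
qed

lemma limit_field_bound:
  assumes q: "axial q \<le> norm (q - a) / 2" "norm (q - a) \<le> r1 / 2" "q \<noteq> a" and \<tau>: "s < \<tau>" "\<tau> \<le> 1"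
  shows "parallelogram_area (limit_field q (\<gamma> \<tau>)) (c \<tau>) \<le> 18 * C / m + 68 * A0 * K"
proof -
  let ?y = "\<gamma> \<tau> - a" and ?w = "q - a" and ?l = "norm (q - a)" and ?b = "axial q" and ?p = "lateral q"
  let ?r = "norm ?y" and ?M = "norm (\<gamma> \<tau> - q)" and ?u = "(\<gamma> \<tau> - a) - norm (\<gamma> \<tau> - a) *\<^sub>R e"
  define N where "N = sqrt (Q q ?r)"
  have r: "?r > 0" by (rule arc_point_pos[OF \<tau>])
  have l: "?l > 0" using q(3) by simp
  have Qlow: "(?r\<^sup>2 + ?l\<^sup>2) / 2 \<le> Q q ?r" using Q_lower[OF q(1), of ?r] r by simp
  have "0 < (?r\<^sup>2 + ?l\<^sup>2) / 2" using r by (simp add: add_pos_nonneg)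
  then have Qpos: "Q q ?r > 0" using Qlow by linarith
  then have N: "N > 0" "N\<^sup>2 = Q q ?r" by (auto simp: N_def)
  have NM: "N \<le> 3 * ?M" using pole_distance[OF q(1,2) \<tau>] by (simp add: N_def)
  then have M: "?M > 0" using N(1) by linarith
  have rN: "?r\<^sup>2 \<le> 2 * N\<^sup>2" and lN: "?l\<^sup>2 \<le> 2 * N\<^sup>2" using Qlow N(2) by (auto simp: field_simps) (smt (verit) zero_le_power2)+
  have r2: "?r \<le> 2 * N" and l2: "?l \<le> 2 * N"
  proof -
    have "(2 * N)\<^sup>2 = 4 * N\<^sup>2" by (simp add: power_mult_distrib)
    then have "?r\<^sup>2 \<le> (2 * N)\<^sup>2" "?l\<^sup>2 \<le> (2 * N)\<^sup>2" using rN lN zero_le_power2[of N] by linarith+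
    then show "?r \<le> 2 * N" "?l \<le> 2 * N" using N(1) by (auto intro: power2_le_imp_le)
  qed
  have u: "norm ?u \<le> A0 * ?r\<^sup>2" using arc_deviation[of \<tau>] \<tau> by simp
  have M2: "1 / ?M\<^sup>2 \<le> 9 / N\<^sup>2"
  proof -
    have "N\<^sup>2 \<le> (3 * ?M)\<^sup>2" using NM N(1) by (intro power_mono) auto
    then show ?thesis using M N(1) by (simp add: field_simps power_mult_distrib)
  qed
  define lam where "lam = (?r - ?b) / ?M\<^sup>2"
  define t2 t3 t4 where "t2 = (1 / ?M\<^sup>2) *\<^sub>R ?u" and "t3 = (1 / N\<^sup>2 - 1 / ?M\<^sup>2) *\<^sub>R ?p"
    and "t4 = (1 / (?r * N\<^sup>2)) *\<^sub>R rot ?p ?u"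
  have split: "limit_field q (\<gamma> \<tau>) = lam *\<^sub>R e + (t2 + t3 + t4)"
  proof -
    have y: "?y = ?r *\<^sub>R e + ?u" by simp
    have "\<gamma> \<tau> - q = (?r - ?b) *\<^sub>R e + ?u - ?p" by (simp add: lateral_def algebra_simps)
    then have "(1 / ?M\<^sup>2) *\<^sub>R (\<gamma> \<tau> - q) = (1 / ?M\<^sup>2) *\<^sub>R ((?r - ?b) *\<^sub>R e + ?u - ?p)" by (rule arg_cong)
    moreover have "k *\<^sub>R (x *\<^sub>R e + v - w) = (x * k) *\<^sub>R e + k *\<^sub>R v - k *\<^sub>R w" for k x and v w :: "real^'n"
      by (simp add: scaleR_add_right scaleR_diff_right mult.commute)
    moreover have "(?r - ?b) * (1 / ?M\<^sup>2) = lam" by (simp add: lam_def)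
    ultimately have "(1 / ?M\<^sup>2) *\<^sub>R (\<gamma> \<tau> - q) = lam *\<^sub>R e + t2 - (1 / ?M\<^sup>2) *\<^sub>R ?p"
      by (simp only: t2_def)
    moreover have "rot ?p ?y = ?r *\<^sub>R ?p + rot ?p ?u"
      by (subst y) (simp only: rot_add rot_scale rot_e[OF lateral_e])
    then have "(1 / (?r * Q q ?r)) *\<^sub>R rot ?p ?y = (1 / N\<^sup>2) *\<^sub>R ?p + t4"
      using r by (simp add: t4_def N(2) scaleR_add_right)
    ultimately show ?thesis by (simp add: limit_field_def t3_def scaleR_left_diff_distrib)
  qed
  have T1: "parallelogram_area (lam *\<^sub>R e) (c \<tau>) \<le> 18 * C / m"
  proof -
    have "\<bar>?r - ?b\<bar> \<le> N"
    proof -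
      have "(?r *\<^sub>R e - ?w) \<bullet> e = ?r - ?b" by (simp add: inner_diff_left axial_def norm_e power2_norm_eq_inner[symmetric])
      then have "\<bar>?r - ?b\<bar> \<le> norm (?r *\<^sub>R e - ?w)" using Cauchy_Schwarz_ineq2[of "?r *\<^sub>R e - ?w" e] norm_e by simp
      then show ?thesis by (simp add: N_def Q_eq)
    qed
    then have "\<bar>lam\<bar> \<le> N * (9 / N\<^sup>2)"
      unfolding lam_def abs_divide divide_inverse[of "\<bar>?r - ?b\<bar>"] using M2 N(1)
      by (intro mult_mono) (auto simp: inverse_eq_divide)
    also have "\<dots> = 9 / N" using N(1) by (simp add: power2_eq_square)
    also have "\<dots> \<le> 18 / ?r" using r2 r N(1) by (simp add: field_simps)
    finally have lam: "\<bar>lam\<bar> \<le> 18 / ?r" .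
    have "\<tau> - s \<le> ?r / m" using arc_dist[of \<tau>] \<tau> m0 by (simp add: field_simps)
    then have "C * (\<tau> - s) \<le> C * (?r / m)" using C0 by (rule mult_left_mono)
    then have "parallelogram_area e (c \<tau>) \<le> C * (?r / m)" using area_e[of \<tau>] \<tau> by linarith
    then have "\<bar>lam\<bar> * parallelogram_area e (c \<tau>) \<le> 18 / ?r * (C * (?r / m))"
      using lam r by (intro mult_mono) auto
    then show ?thesis using r by (simp add: parallelogram_area_scale_left)
  qed
  have T2: "norm t2 \<le> 18 * A0"
  proof -
    have "norm t2 = 1 / ?M\<^sup>2 * norm ?u" by (simp add: t2_def)
    also have "\<dots> \<le> 9 / N\<^sup>2 * (A0 * (2 * N\<^sup>2))"
      using M2 u mult_left_mono[OF rN A0_nonneg] by (intro mult_mono) auto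
    also have "\<dots> = 18 * A0" using N(1) by simp
    finally show ?thesis .
  qed
  have T3: "norm t3 \<le> 48 * A0"
  proof -
    have "\<bar>?M - N\<bar> \<le> norm ?u"
      unfolding N_def Q_eq real_sqrt_abs abs_norm_cancel
      using norm_triangle_ineq3[of "\<gamma> \<tau> - q" "?r *\<^sub>R e - ?w"] by (simp add: algebra_simps)
    then have MN: "\<bar>?M - N\<bar> \<le> A0 * ?r\<^sup>2" using u by linarith
    have "1 / N\<^sup>2 - 1 / ?M\<^sup>2 = (?M - N) * (1 / (?M * N\<^sup>2) + 1 / (?M\<^sup>2 * N))"
      using M N(1) by (simp add: field_simps power2_eq_square)
    moreover have "1 / (?M * N\<^sup>2) + 1 / (?M\<^sup>2 * N) \<le> 12 / N ^ 3"
    proof -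
      have M1: "1 / ?M \<le> 3 / N" using NM M N(1) by (simp add: field_simps)
      have "1 / (?M * N\<^sup>2) = 1 / ?M * (1 / N\<^sup>2)" by simp
      also have "\<dots> \<le> 3 / N * (1 / N\<^sup>2)" using M1 by (rule mult_right_mono) simp
      finally have a: "1 / (?M * N\<^sup>2) \<le> 3 / N ^ 3" by (simp add: power2_eq_square power3_eq_cube)
      have "1 / (?M\<^sup>2 * N) = 1 / ?M\<^sup>2 * (1 / N)" by simp
      also have "\<dots> \<le> 9 / N\<^sup>2 * (1 / N)" using M2 N(1) by (intro mult_right_mono) auto
      finally have b: "1 / (?M\<^sup>2 * N) \<le> 9 / N ^ 3" by (simp add: power2_eq_square power3_eq_cube)
      show ?thesis using add_mono[OF a b] by (simp add: add_divide_distrib[symmetric])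
    qed
    ultimately have "\<bar>1 / N\<^sup>2 - 1 / ?M\<^sup>2\<bar> \<le> (A0 * ?r\<^sup>2) * (12 / N ^ 3)"
      using MN M N(1) by (simp only: abs_mult) (intro mult_mono, auto)
    then have "norm t3 \<le> (A0 * ?r\<^sup>2) * (12 / N ^ 3) * ?l"
      unfolding t3_def norm_scaleR using norm_lateral[of q] A0_nonneg N(1) by (intro mult_mono) auto
    also have "\<dots> \<le> (A0 * (2 * N\<^sup>2)) * (12 / N ^ 3) * (2 * N)"
      using rN l2 A0_nonneg N(1) by (intro mult_mono mult_nonneg_nonneg) auto
    also have "\<dots> = 48 * A0" using N(1) by (simp add: power2_eq_square power3_eq_cube)
    finally show ?thesis .
  qed
  have T4: "norm t4 \<le> 2 * A0"
  proof -
    have "norm (rot ?p ?u) \<le> 2 * ?l * (A0 * ?r\<^sup>2)"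
      using norm_rot[of ?p ?u] mult_mono[OF mult_left_mono[OF norm_lateral[of q], of 2] u] by simp
    then have "norm t4 \<le> 1 / (?r * N\<^sup>2) * (2 * ?l * (A0 * ?r\<^sup>2))"
      unfolding t4_def norm_scaleR using r by (intro mult_mono) auto
    also have "\<dots> = A0 * (2 * ?l * ?r) / N\<^sup>2" using r by (simp add: power2_eq_square)
    also have "\<dots> \<le> A0 * (2 * N\<^sup>2) / N\<^sup>2"
      using sum_squares_bound[of ?l ?r] Qlow N(2) A0_nonneg
      using less_imp_le[OF Qpos] by (intro divide_right_mono mult_left_mono) (auto simp: field_simps)
    also have "\<dots> = 2 * A0" using N(1) by simp
    finally show ?thesis .
  qed
  have "norm (t2 + t3 + t4) \<le> 68 * A0"
    using norm_triangle_ineq[of "t2 + t3" t4] norm_triangle_ineq[of t2 t3] T2 T3 T4 by linarith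
  then have "parallelogram_area (t2 + t3 + t4) (c \<tau>) \<le> 68 * A0 * K"
    using order_trans[OF parallelogram_area_le_norm mult_mono[OF _ speed]] \<tau> s A0_nonneg by auto
  then show ?thesis unfolding split
    using parallelogram_area_add_left[of "lam *\<^sub>R e" "t2 + t3 + t4" "c \<tau>"] T1 by linarith
qed

end

lemma tendsto_parallelogram_area [tendsto_intros]:
  fixes f g :: "'b \<Rightarrow> 'a::real_inner"
  assumes "(f \<longlongrightarrow> u) F" "(g \<longlongrightarrow> v) F"
  shows "((\<lambda>x. parallelogram_area (f x) (g x)) \<longlongrightarrow> parallelogram_area u v) F"
  unfolding parallelogram_area_def by (intro tendsto_intros assms)

context touching_varifold begin

lemma norm_newton_le: "norm (newton q \<rho> x) \<le> 1 / norm (x - q)"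
proof (cases "x = q")
  case False
  have "norm (newton q \<rho> x) = norm (x - q) / ((norm (x - q))\<^sup>2 + \<rho>\<^sup>2)" by (simp add: newton_def)
  also have "\<dots> \<le> norm (x - q) / (norm (x - q))\<^sup>2"
    using False by (intro divide_left_mono mult_pos_pos add_pos_nonneg) auto
  also have "\<dots> = 1 / norm (x - q)" using False by (simp add: power2_eq_square)
  finally show ?thesis .
qed (simp add: newton_def)

lemma norm_correction_le:
  assumes q: "axial q \<le> norm (q - a) / 2" "q \<noteq> a" and \<rho>: "\<rho> > 0"
  shows "norm (correction q \<rho> x) \<le> 4 / norm (q - a)"
proof -
  let ?l = "norm (q - a)" and ?s = "S \<rho> x"
  have l: "?l > 0" using q(2) by simp
  have s: "?s > 0" "norm (x - a) \<le> ?s"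
    unfolding S_def using \<rho> by (auto intro: real_le_rsqrt simp: add_nonneg_pos)
  have Q: "?l\<^sup>2 / 2 \<le> Q q ?s"
  proof -
    have "?l\<^sup>2 / 2 \<le> (?s\<^sup>2 + ?l\<^sup>2) / 2" by simp
    also have "\<dots> \<le> Q q ?s" using s by (intro Q_lower[OF q(1)]) auto
    finally show ?thesis .
  qed
  have Qp: "Q q ?s > 0" using Q l by (auto intro: less_le_trans[OF _ Q])
  have "norm (rot (lateral q) (x - a)) \<le> 2 * ?l * ?s"
  proof -
    have "norm (rot (lateral q) (x - a)) \<le> 2 * norm (lateral q) * norm (x - a)" by (rule norm_rot)
    also have "\<dots> \<le> 2 * ?l * ?s" using norm_lateral[of q] s by (intro mult_mono) auto
    finally show ?thesis .
  qed
  then have "norm (correction q \<rho> x) \<le> 1 / (?s * Q q ?s) * (2 * ?l * ?s)"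
    unfolding correction_def norm_scaleR using s Qp by (intro mult_mono) auto
  also have "\<dots> = 2 * ?l / Q q ?s" using s by simp
  also have "\<dots> \<le> 2 * ?l / (?l\<^sup>2 / 2)" using Q Qp l by (intro divide_left_mono mult_pos_pos) auto
  also have "\<dots> = 4 / ?l" using l by (simp add: power2_eq_square)
  finally show ?thesis .
qed

lemma measurable_limit_field: "(\<lambda>\<tau>. limit_field q (\<gamma> \<tau>)) \<in> borel_measurable \<Gamma>"
  unfolding limit_field_def Q_def rot_def by measurable

lemma pole_inequality:
  assumes q: "q \<in> support V - \<gamma> ` {0..1}" "axial q \<le> norm (q - a) / 2" "norm (q - a) \<le> r1 / 2"
    and \<eta>: "2 * norm (q - a) < \<eta>"
  shows "2 * pi + 2 * (\<integral>z. (if \<eta> \<le> D a z then (perp q z)\<^sup>2 / (D q z) ^ 4 else 0) \<partial>V)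
    \<le> (\<integral>\<tau>. parallelogram_area (limit_field q (\<gamma> \<tau>)) (c \<tau>) \<partial>\<Gamma>) + 40 * (\<integral>z. error (norm (q - a)) z \<partial>V)"
proof -
  let ?r = "\<lambda>k::nat. 1 / real (Suc k)"
  have r0: "?r \<longlonglongrightarrow> 0" using LIMSEQ_inverse_real_of_nat by (simp add: inverse_eq_divide)
  have rp: "?r k > 0" for k by simp
  have "a \<in> \<gamma> ` {0..1}" using s by auto
  then have qa: "q \<noteq> a" using q(1) by auto
  let ?l = "norm (q - a)"
  have l: "?l > 0" using qa by simp
  obtain dq where dq: "dq > 0" "\<And>\<tau>. \<tau> \<in> {0..1} \<Longrightarrow> dq \<le> norm (\<gamma> \<tau> - q)"
    using off_arc_distance q(1) by blast
  let ?Err = "\<integral>z. error ?l z \<partial>V"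
  have iErr: "integrable V (error ?l)"
  proof -
    have "(\<lambda>k. ?l * ?r k) \<longlonglongrightarrow> ?l * 0" by (intro tendsto_intros r0)
    then have "(\<lambda>k. ?l * ?r k) \<longlonglongrightarrow> 0" by simp
    from error_vanishes(1)[OF this, of 0] l show ?thesis by simp
  qed
  let ?P = "\<lambda>k z. if \<eta> \<le> D a z then (perp q z)\<^sup>2 / ((D q z)\<^sup>2 + (?r k)\<^sup>2)\<^sup>2 else 0"
  let ?X = "\<lambda>k x. newton q (?r k) x + correction q (?r k) x"
  let ?B = "\<lambda>k. \<integral>\<tau>. parallelogram_area (?X k (\<gamma> \<tau>)) (c \<tau>) \<partial>\<Gamma>"
  let ?I = "\<lambda>k. \<integral>z. 2 * (?r k)\<^sup>2 / ((D q z)\<^sup>2 + (?r k)\<^sup>2)\<^sup>2 \<partial>V"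
  have far: "(perp q z)\<^sup>2 / ((D q z)\<^sup>2 + (?r k)\<^sup>2)\<^sup>2 \<le> 4 / \<eta>\<^sup>2"
    if "snd z \<in> planes" "\<eta> \<le> D a z" for z k
  proof -
    have "D a z \<le> D q z + ?l" using norm_triangle_ineq[of "fst z - q" "q - a"] by simp
    then have dz: "\<eta> / 2 \<le> D q z" using that(2) \<eta> by linarith
    have e0: "\<eta> > 0" using \<eta> l by linarith
    then have Dp: "D q z > 0" using dz by linarith
    have "(perp q z)\<^sup>2 / ((D q z)\<^sup>2 + (?r k)\<^sup>2)\<^sup>2 \<le> (D q z)\<^sup>2 / ((D q z)\<^sup>2)\<^sup>2"
      using perp_le[OF that(1), of q] Dp by (intro frac_le power_mono zero_less_power) auto
    also have "\<dots> = 1 / (D q z)\<^sup>2" using Dp by (simp add: power2_eq_square)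
    also have "\<dots> \<le> 1 / (\<eta> / 2)\<^sup>2" using dz e0 Dp by (intro divide_left_mono power_mono mult_pos_pos) auto
    also have "\<dots> = 4 / \<eta>\<^sup>2" by (simp add: power_divide)
    finally show ?thesis .
  qed
  have Pb: "AE z in V. norm (?P k z) \<le> 4 / \<eta>\<^sup>2" for k
    using planes_AE by eventually_elim (use far in \<open>auto simp: abs_of_nonneg\<close>)
  have iP: "integrable V (?P k)" for k
    by (rule V.integrable_const_bound[OF Pb]) measurable
  have step: "?I k + 2 * (\<integral>z. ?P k z \<partial>V) \<le> ?B k + 40 * ?Err" for k
  proof -
    have nz: "?r k \<noteq> 0" by simp
    obtain Y' g where Y: "smooth (correction q (?r k))" "\<And>x. (correction q (?r k) has_derivative Y' x) (at x)"
      "g \<in> borel_measurable V" "\<And>z. snd z \<in> planes \<Longrightarrow> tangential_div (snd z) (Y' (fst z)) = g z"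
      "\<And>z. snd z \<in> planes \<Longrightarrow> D a z > 0 \<Longrightarrow> \<bar>g z\<bar> \<le> 40 * error ?l z"
      using correction_field[OF q(2) qa rp] by metis
    let ?N = "\<lambda>z. 2 * ((?r k)\<^sup>2 + (perp q z)\<^sup>2) / ((D q z)\<^sup>2 + (?r k)\<^sup>2)\<^sup>2"
    have sm: "smooth (?X k)" by (intro smooth_add smooth_newton nz Y(1))
    have der: "(?X k has_derivative (\<lambda>h. newton_deriv q (?r k) x h + Y' x h)) (at x)" for x
      by (intro has_derivative_add has_derivative_newton nz Y(2))
    have meas: "(\<lambda>z. ?N z + g z) \<in> borel_measurable V" using Y(3) by measurable
    have td: "tangential_div (snd z) (\<lambda>h. newton_deriv q (?r k) (fst z) h + Y' (fst z) h) = ?N z + g z"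
      if "snd z \<in> planes" for z
      unfolding tangential_div_add tangential_div_newton[OF that nz] Y(4)[OF that] ..
    have iN: "integrable V (\<lambda>z. ?N z + g z)" by (rule first_variation(1)[OF bba sm der meas td])
    have le: "(\<integral>z. ?N z + g z \<partial>V) \<le> ?B k" by (rule first_variation(2)[OF bba sm der meas td])
    have "(\<integral>z. 2 * (?r k)\<^sup>2 / ((D q z)\<^sup>2 + (?r k)\<^sup>2)\<^sup>2 + 2 * ?P k z \<partial>V) \<le> (\<integral>z. (?N z + g z) + 40 * error ?l z \<partial>V)"
    proof (rule integral_mono_AE)
      show "integrable V (\<lambda>z. 2 * (?r k)\<^sup>2 / ((D q z)\<^sup>2 + (?r k)\<^sup>2)\<^sup>2 + 2 * ?P k z)"
        by (intro Bochner_Integration.integrable_add integrable_kernel rp integrable_mult_right iP)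
      show "integrable V (\<lambda>z. (?N z + g z) + 40 * error ?l z)"
        by (intro Bochner_Integration.integrable_add[OF iN] integrable_mult_right iErr)
      show "AE z in V. 2 * (?r k)\<^sup>2 / ((D q z)\<^sup>2 + (?r k)\<^sup>2)\<^sup>2 + 2 * ?P k z \<le> (?N z + g z) + 40 * error ?l z"
        using planes_AE AE_off_a
      proof eventually_elim
        case (elim z)
        let ?d = "((D q z)\<^sup>2 + (?r k)\<^sup>2)\<^sup>2"
        have "?P k z \<le> (perp q z)\<^sup>2 / ?d" by auto
        moreover have "?N z = 2 * (?r k)\<^sup>2 / ?d + 2 * ((perp q z)\<^sup>2 / ?d)"
          by (simp only: add_divide_distrib distrib_left times_divide_eq_right)
        moreover have "\<bar>g z\<bar> \<le> 40 * error ?l z" using Y(5)[OF elim] .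
        moreover have "i + 2 * p \<le> (n + g) + e" if "p \<le> b" "n = i + 2 * b" "\<bar>g\<bar> \<le> e" for i p n g e b :: real
          using that by (auto simp: abs_le_iff)
        ultimately show ?case by blast
      qed
    qed
    also have "\<dots> = (\<integral>z. ?N z + g z \<partial>V) + 40 * ?Err"
      unfolding Bochner_Integration.integral_add[OF iN integrable_mult_right[OF iErr]] integral_mult_right_zero ..
    finally have "(\<integral>z. 2 * (?r k)\<^sup>2 / ((D q z)\<^sup>2 + (?r k)\<^sup>2)\<^sup>2 + 2 * ?P k z \<partial>V) \<le> (\<integral>z. ?N z + g z \<partial>V) + 40 * ?Err" .
    moreover have "(\<integral>z. 2 * (?r k)\<^sup>2 / ((D q z)\<^sup>2 + (?r k)\<^sup>2)\<^sup>2 + 2 * ?P k z \<partial>V) = ?I k + 2 * (\<integral>z. ?P k z \<partial>V)"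
      unfolding Bochner_Integration.integral_add[OF integrable_kernel[OF rp] integrable_mult_right[OF iP]] integral_mult_right_zero ..
    ultimately show ?thesis using le by linarith
  qed
  have limP: "(\<lambda>k. \<integral>z. ?P k z \<partial>V) \<longlonglongrightarrow> (\<integral>z. (if \<eta> \<le> D a z then (perp q z)\<^sup>2 / (D q z) ^ 4 else 0) \<partial>V)"
  proof (rule integral_dominated_convergence[where w="\<lambda>z. 4 / \<eta>\<^sup>2"])
    show "AE z in V. (\<lambda>k. ?P k z) \<longlonglongrightarrow> (if \<eta> \<le> D a z then (perp q z)\<^sup>2 / (D q z) ^ 4 else 0)"
    proof (rule AE_I2)
      fix z
      show "(\<lambda>k. ?P k z) \<longlonglongrightarrow> (if \<eta> \<le> D a z then (perp q z)\<^sup>2 / (D q z) ^ 4 else 0)"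
      proof (cases "\<eta> \<le> D a z")
        case True
        have "D a z \<le> D q z + ?l" using norm_triangle_ineq[of "fst z - q" "q - a"] by simp
        then have Dp: "D q z > 0" using True \<eta> l by linarith
        have "(\<lambda>k. (perp q z)\<^sup>2 / ((D q z)\<^sup>2 + (?r k)\<^sup>2)\<^sup>2) \<longlonglongrightarrow> (perp q z)\<^sup>2 / ((D q z)\<^sup>2 + 0\<^sup>2)\<^sup>2"
          using Dp by (intro tendsto_intros r0) auto
        then show ?thesis using True by (simp flip: power_mult)
      qed simp
    qed
  qed (use Pb in auto)
  have limB: "?B \<longlonglongrightarrow> (\<integral>\<tau>. parallelogram_area (limit_field q (\<gamma> \<tau>)) (c \<tau>) \<partial>\<Gamma>)"
  proof (rule integral_dominated_convergence[where w="\<lambda>\<tau>. (1 / dq + 4 / ?l) * K"])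
    interpret N: finite_measure \<Gamma> by (rule finite_arc_measure)
    show "integrable \<Gamma> (\<lambda>\<tau>. (1 / dq + 4 / ?l) * K)" by simp
    show "(\<lambda>\<tau>. parallelogram_area (limit_field q (\<gamma> \<tau>)) (c \<tau>)) \<in> borel_measurable \<Gamma>"
      by (intro measurable_area measurable_limit_field measurable_gamma_c)
    show "(\<lambda>\<tau>. parallelogram_area (?X k (\<gamma> \<tau>)) (c \<tau>)) \<in> borel_measurable \<Gamma>" for k
      unfolding newton_def correction_def Q_def rot_def S_def by measurable
    show "AE \<tau> in \<Gamma>. norm (parallelogram_area (?X k (\<gamma> \<tau>)) (c \<tau>)) \<le> (1 / dq + 4 / ?l) * K" for k
      using AE_arc_measure[of s 1]
    proof eventually_elim
      case (elim \<tau>)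
      then have \<tau>: "\<tau> \<in> {0..1}" using s by auto
      have "norm (?X k (\<gamma> \<tau>)) \<le> norm (newton q (?r k) (\<gamma> \<tau>)) + norm (correction q (?r k) (\<gamma> \<tau>))" by (rule norm_triangle_ineq)
      also have "\<dots> \<le> 1 / dq + 4 / ?l"
      proof (rule add_mono[OF order_trans[OF norm_newton_le] norm_correction_le[OF q(2) qa rp]])
        show "1 / norm (\<gamma> \<tau> - q) \<le> 1 / dq"
          using dq(1) less_le_trans[OF dq(1) dq(2)[OF \<tau>]] by (intro divide_left_mono dq(2)[OF \<tau>] mult_pos_pos) auto
      qed
      finally have "norm (?X k (\<gamma> \<tau>)) \<le> 1 / dq + 4 / ?l" .
      then have "norm (?X k (\<gamma> \<tau>)) * norm (c \<tau>) \<le> (1 / dq + 4 / ?l) * K"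
        using speed[OF \<tau>] dq(1) by (intro mult_mono) auto
      then show ?case using parallelogram_area_le_norm[of "?X k (\<gamma> \<tau>)" "c \<tau>"] by simp
    qed
    show "AE \<tau> in \<Gamma>. (\<lambda>k. parallelogram_area (?X k (\<gamma> \<tau>)) (c \<tau>)) \<longlonglongrightarrow> parallelogram_area (limit_field q (\<gamma> \<tau>)) (c \<tau>)"
      using AE_arc_measure[of s 1]
    proof eventually_elim
      case (elim \<tau>)
      then have \<tau>: "\<tau> \<in> {0..1}" using s by auto
      have n: "norm (\<gamma> \<tau> - q) > 0" by (rule less_le_trans[OF dq(1) dq(2)[OF \<tau>]])
      have y: "norm (\<gamma> \<tau> - a) > 0" using elim by (intro arc_point_pos) auto
      have "0 < ((norm (\<gamma> \<tau> - a))\<^sup>2 + ?l\<^sup>2) / 2" using y by (simp add: add_pos_nonneg)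
      then have Qp: "Q q (norm (\<gamma> \<tau> - a)) > 0" using Q_lower[OF q(2) norm_ge_zero, of "\<gamma> \<tau> - a"] by linarith
      have S: "(\<lambda>k. S (?r k) (\<gamma> \<tau>)) \<longlonglongrightarrow> norm (\<gamma> \<tau> - a)"
      proof -
        have "(\<lambda>k. S (?r k) (\<gamma> \<tau>)) \<longlonglongrightarrow> sqrt ((norm (\<gamma> \<tau> - a))\<^sup>2 + 0\<^sup>2)"
          unfolding S_def by (intro tendsto_intros r0)
        then show ?thesis by simp
      qed
      have QS: "(\<lambda>k. Q q (S (?r k) (\<gamma> \<tau>))) \<longlonglongrightarrow> Q q (norm (\<gamma> \<tau> - a))"
        unfolding Q_def by (intro tendsto_intros S)
      have "(\<lambda>k. ?X k (\<gamma> \<tau>)) \<longlonglongrightarrow> (1 / ((norm (\<gamma> \<tau> - q))\<^sup>2 + 0\<^sup>2)) *\<^sub>R (\<gamma> \<tau> - q)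
         + (1 / (norm (\<gamma> \<tau> - a) * Q q (norm (\<gamma> \<tau> - a)))) *\<^sub>R rot (lateral q) (\<gamma> \<tau> - a)"
        unfolding newton_def correction_def using n y Qp
        by (intro tendsto_intros S QS r0) auto
      then have "(\<lambda>k. ?X k (\<gamma> \<tau>)) \<longlonglongrightarrow> limit_field q (\<gamma> \<tau>)" by (simp add: limit_field_def)
      then show ?case by (intro tendsto_parallelogram_area tendsto_const)
    qed
  qed
  show ?thesis
  proof (rule field_le_epsilon)
    fix \<epsilon> :: real assume \<epsilon>: "\<epsilon> > 0"
    obtain \<Theta> where \<Theta>: "\<Theta> \<ge> 1" "has_density V q \<Theta>" using dens[OF q(1)] by blast
    from density_kernel_limit[OF \<Theta>(2,1) \<epsilon>] obtain b where b: "b > 0"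
      "\<And>\<rho>. 0 < \<rho> \<Longrightarrow> \<rho> < b \<Longrightarrow> 2 * pi - \<epsilon> < (\<integral>z. 2 * \<rho>\<^sup>2 / ((D q z)\<^sup>2 + \<rho>\<^sup>2)\<^sup>2 \<partial>V)"
      unfolding eventually_at_right_field by auto
    have ev: "eventually (\<lambda>k. (2 * pi - \<epsilon>) + 2 * (\<integral>z. ?P k z \<partial>V) \<le> ?B k + 40 * ?Err) sequentially"
      using order_tendstoD(2)[OF r0 b(1)]
    proof eventually_elim
      case (elim k)
      then show ?case using b(2)[OF rp, of k] step[of k] by linarith
    qed
    have "(2 * pi - \<epsilon>) + 2 * (\<integral>z. (if \<eta> \<le> D a z then (perp q z)\<^sup>2 / (D q z) ^ 4 else 0) \<partial>V)
       \<le> (\<integral>\<tau>. parallelogram_area (limit_field q (\<gamma> \<tau>)) (c \<tau>) \<partial>\<Gamma>) + 40 * ?Err"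
      by (rule tendsto_le[OF trivial_limit_sequentially _ _ ev]) (intro tendsto_intros limP limB)+
    then show "2 * pi + 2 * (\<integral>z. (if \<eta> \<le> D a z then (perp q z)\<^sup>2 / (D q z) ^ 4 else 0) \<partial>V)
       \<le> (\<integral>\<tau>. parallelogram_area (limit_field q (\<gamma> \<tau>)) (c \<tau>) \<partial>\<Gamma>) + 40 * ?Err + \<epsilon>" by linarith
  qed
qed

end

context touching_varifold begin

abbreviation seen_from_a :: "real \<Rightarrow> real" where
  "seen_from_a \<tau> \<equiv> parallelogram_area (\<gamma> \<tau> - a) (c \<tau>) / (norm (\<gamma> \<tau> - a))\<^sup>2"

lemma seen_from_a_bound: "s \<le> \<tau> \<Longrightarrow> \<tau> \<le> 1 \<Longrightarrow> seen_from_a \<tau> \<le> \<Lambda>"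
  unfolding \<Lambda>_def by (rule area_over_sq) (use s in auto)

lemma integrable_seen_from_a: "integrable \<Gamma> seen_from_a"
proof (rule integrable_arc_bounded)
  fix \<tau> assume "s < \<tau>" "\<tau> \<le> 1"
  then show "\<bar>seen_from_a \<tau>\<bar> \<le> \<Lambda>" using seen_from_a_bound[of \<tau>] by simp
qed measurable

lemma seen_length_le_2pi: "(\<integral>\<tau>. seen_from_a \<tau> \<partial>\<Gamma>) \<le> 2 * pi"
proof (rule integral_arc_limit_le[OF integrable_seen_from_a])
  show "AE \<tau> in \<Gamma>. seen_from_a \<tau> \<le> \<Lambda>"
    using AE_arc_measure[of s 1] by eventually_elim (use seen_from_a_bound in auto)
  fix t assume t: "s < t" "t < 1"
  have sub: "{t..1} \<subseteq> {0..1}" using t s by auto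
  have "continuous_on {t..1} seen_from_a"
  proof (intro continuous_intros continuous_on_subset[OF \<gamma>_cont sub] continuous_on_subset[OF c_cont sub] ballI)
    fix x assume "x \<in> {t..1}"
    then have "norm (\<gamma> x - a) > 0" using t by (intro arc_point_pos) auto
    then show "(norm (\<gamma> x - a))\<^sup>2 \<noteq> 0" by simp
  qed
  from integral_arc_measure_continuous[OF this]
  show "(\<integral>\<tau>. seen_from_a \<tau> \<partial>arc_measure t 1) \<le> 2 * pi"
    using seen_from_start[OF TC s(1) t] by simp
qed (use s in auto)

lemma conical_identity:
  assumes \<eta>: "\<eta> > 0"
  shows "2 * pi + 2 * (\<integral>z. (if \<eta> \<le> D a z then (perp a z)\<^sup>2 / (D a z) ^ 4 else 0) \<partial>V) \<le> (\<integral>\<tau>. seen_from_a \<tau> \<partial>\<Gamma>)"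
proof -
  let ?r = "\<lambda>k::nat. 1 / real (Suc k)"
  have r0: "?r \<longlonglongrightarrow> 0" using LIMSEQ_inverse_real_of_nat by (simp add: inverse_eq_divide)
  let ?\<sigma> = "\<lambda>k. min (r1 / 2) (min (\<eta> / 3) (?r k))"
  have "\<exists>q. q \<in> support V - \<gamma> ` {0..1} \<and> norm (q - a) < ?\<sigma> k \<and> (q - a) \<bullet> e \<le> norm (q - a) / 2" for k
  proof -
    have "?\<sigma> k > 0" using r1_pos \<eta> by simp
    then show ?thesis using transversal_points by metis
  qed
  then obtain q where q: "\<And>k. q k \<in> support V - \<gamma> ` {0..1}" "\<And>k. norm (q k - a) < ?\<sigma> k"
    "\<And>k. (q k - a) \<bullet> e \<le> norm (q k - a) / 2" by metis
  let ?l = "\<lambda>k. norm (q k - a)"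
  have lb: "?l k \<le> r1 / 2" "2 * ?l k < \<eta>" "?l k < ?r k" for k using q(2)[of k] \<eta> by auto
  have l0: "?l \<longlonglongrightarrow> 0"
  proof (rule tendsto_sandwich[OF always_eventually always_eventually tendsto_const r0])
    show "\<forall>k. 0 \<le> ?l k" by simp
    show "\<forall>k. ?l k \<le> ?r k" using lb(3) less_imp_le by blast
  qed
  have qa: "q \<longlonglongrightarrow> a" using l0 by (rule LIM_zero_cancel[OF tendsto_norm_zero_cancel])
  have lp: "?l k > 0" for k
  proof -
    have "a \<in> \<gamma> ` {0..1}" using s by auto
    then have "q k \<noteq> a" using q(1)[of k] by auto
    then show ?thesis by simp
  qed
  have ax: "axial (q k) \<le> ?l k / 2" for k using q(3)[of k] by (simp add: axial_def)
  let ?P = "\<lambda>p z. if \<eta> \<le> D a z then (perp p z)\<^sup>2 / (D p z) ^ 4 else 0"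
  let ?B = "\<lambda>k. \<integral>\<tau>. parallelogram_area (limit_field (q k) (\<gamma> \<tau>)) (c \<tau>) \<partial>\<Gamma>"
  let ?E = "\<lambda>k. \<integral>z. error (?l k) z \<partial>V"
  have step: "2 * pi + 2 * (\<integral>z. ?P (q k) z \<partial>V) \<le> ?B k + 40 * ?E k" for k
    by (rule pole_inequality[OF q(1) ax lb(1,2)])
  have Pb: "AE z in V. norm (?P (q k) z) \<le> 4 / \<eta>\<^sup>2" for k
    using planes_AE
  proof eventually_elim
    case (elim z)
    have "norm ((perp (q k) z)\<^sup>2 / (D (q k) z) ^ 4) \<le> 4 / \<eta>\<^sup>2" if h: "\<eta> \<le> D a z"
    proof -
      have "D a z \<le> D (q k) z + ?l k" using norm_triangle_ineq[of "fst z - q k" "q k - a"] by simp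
      then have dz: "\<eta> / 2 \<le> D (q k) z" using h lb(2)[of k] by linarith
      then have Dp: "D (q k) z > 0" using \<eta> by linarith
      have "(perp (q k) z)\<^sup>2 / (D (q k) z) ^ 4 \<le> (D (q k) z)\<^sup>2 / (D (q k) z) ^ 4"
        using perp_le[OF elim, of "q k"] by (intro divide_right_mono power_mono) auto
      also have "\<dots> = 1 / (D (q k) z)\<^sup>2" using Dp by (simp add: power2_eq_square power4_eq_xxxx)
      also have "\<dots> \<le> 1 / (\<eta> / 2)\<^sup>2" using dz \<eta> Dp by (intro divide_left_mono power_mono mult_pos_pos) auto
      also have "\<dots> = 4 / \<eta>\<^sup>2" by (simp add: power_divide)
      finally show ?thesis by simp
    qed
    then show ?case by auto
  qed
  have limP: "(\<lambda>k. \<integral>z. ?P (q k) z \<partial>V) \<longlonglongrightarrow> (\<integral>z. ?P a z \<partial>V)"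
  proof (rule integral_dominated_convergence[where w="\<lambda>z. 4 / \<eta>\<^sup>2"])
    show "AE z in V. (\<lambda>k. ?P (q k) z) \<longlonglongrightarrow> ?P a z"
    proof (rule AE_I2)
      fix z
      show "(\<lambda>k. ?P (q k) z) \<longlonglongrightarrow> ?P a z"
      proof (cases "\<eta> \<le> D a z")
        case True
        have "bounded_linear (\<lambda>x. snd z *v x)" by (simp add: linear_conv_bounded_linear[symmetric])
        then have "(\<lambda>k. snd z *v (fst z - q k)) \<longlonglongrightarrow> snd z *v (fst z - a)"
          by (rule bounded_linear.tendsto) (intro tendsto_intros qa)
        then have "(\<lambda>k. (perp (q k) z)\<^sup>2 / (D (q k) z) ^ 4) \<longlonglongrightarrow> (perp a z)\<^sup>2 / (D a z) ^ 4"
          unfolding perp_def using True \<eta> by (intro tendsto_intros qa) auto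
        then show ?thesis using True by simp
      qed simp
    qed
  qed (use Pb in auto)
  have limB: "?B \<longlonglongrightarrow> (\<integral>\<tau>. seen_from_a \<tau> \<partial>\<Gamma>)"
  proof (rule integral_dominated_convergence[where w="\<lambda>\<tau>. 18 * C / m + 68 * A0 * K"])
    interpret N: finite_measure \<Gamma> by (rule finite_arc_measure)
    show "integrable \<Gamma> (\<lambda>\<tau>. 18 * C / m + 68 * A0 * K)" by simp
    show "seen_from_a \<in> borel_measurable \<Gamma>" by measurable
    show "(\<lambda>\<tau>. parallelogram_area (limit_field (q k) (\<gamma> \<tau>)) (c \<tau>)) \<in> borel_measurable \<Gamma>" for k
      by (intro measurable_area measurable_limit_field measurable_gamma_c)
    show "AE \<tau> in \<Gamma>. norm (parallelogram_area (limit_field (q k) (\<gamma> \<tau>)) (c \<tau>)) \<le> 18 * C / m + 68 * A0 * K" for k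
      using AE_arc_measure[of s 1]
    proof eventually_elim
      case (elim \<tau>)
      have "q k \<noteq> a" using lp[of k] by auto
      from limit_field_bound[OF ax lb(1) this, of \<tau>] show ?case using elim by simp
    qed
    show "AE \<tau> in \<Gamma>. (\<lambda>k. parallelogram_area (limit_field (q k) (\<gamma> \<tau>)) (c \<tau>)) \<longlonglongrightarrow> seen_from_a \<tau>"
      using AE_arc_measure[of s 1]
    proof eventually_elim
      case (elim \<tau>)
      let ?y = "\<gamma> \<tau> - a"
      have y: "norm ?y > 0" using elim by (intro arc_point_pos) auto
      have axl: "(\<lambda>k. axial (q k)) \<longlonglongrightarrow> (a - a) \<bullet> e" unfolding axial_def by (intro tendsto_intros qa)
      then have axl0: "(\<lambda>k. axial (q k)) \<longlonglongrightarrow> 0" by simp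
      have "(\<lambda>k. lateral (q k)) \<longlonglongrightarrow> (a - a) - 0 *\<^sub>R e" unfolding lateral_def by (intro tendsto_intros qa axl0)
      then have lat: "(\<lambda>k. lateral (q k)) \<longlonglongrightarrow> 0" by simp
      have "(\<lambda>k. rot (lateral (q k)) ?y) \<longlonglongrightarrow> (e \<bullet> ?y) *\<^sub>R 0 - (0 \<bullet> ?y) *\<^sub>R e"
        unfolding rot_def by (intro tendsto_intros lat)
      then have rt: "(\<lambda>k. rot (lateral (q k)) ?y) \<longlonglongrightarrow> 0" by simp
      have "(\<lambda>k. Q (q k) (norm ?y)) \<longlonglongrightarrow> (norm ?y)\<^sup>2 - 2 * norm ?y * 0 + 0\<^sup>2"
        unfolding Q_def by (intro tendsto_intros axl0 l0)
      then have Ql: "(\<lambda>k. Q (q k) (norm ?y)) \<longlonglongrightarrow> (norm ?y)\<^sup>2" by simp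
      have "(\<lambda>k. limit_field (q k) (\<gamma> \<tau>)) \<longlonglongrightarrow> (1 / (norm ?y)\<^sup>2) *\<^sub>R ?y + (1 / (norm ?y * (norm ?y)\<^sup>2)) *\<^sub>R 0"
        unfolding limit_field_def using y by (intro tendsto_intros qa rt Ql) auto
      then have "(\<lambda>k. limit_field (q k) (\<gamma> \<tau>)) \<longlonglongrightarrow> (1 / (norm ?y)\<^sup>2) *\<^sub>R ?y" by simp
      then have "(\<lambda>k. parallelogram_area (limit_field (q k) (\<gamma> \<tau>)) (c \<tau>))
          \<longlonglongrightarrow> parallelogram_area ((1 / (norm ?y)\<^sup>2) *\<^sub>R ?y) (c \<tau>)"
        by (intro tendsto_parallelogram_area tendsto_const)
      then show ?case by (simp add: parallelogram_area_scale_left)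
    qed
  qed
  show ?thesis
  proof (rule field_le_epsilon)
    fix \<epsilon> :: real assume "\<epsilon> > 0"
    then have "\<epsilon> / 40 > 0" by simp
    from error_vanishes(2)[OF l0 lp this]
    have ev: "eventually (\<lambda>k. 2 * pi + 2 * (\<integral>z. ?P (q k) z \<partial>V) \<le> ?B k + \<epsilon>) sequentially"
    proof eventually_elim
      case (elim k)
      have "40 * ?E k \<le> \<epsilon>" using elim by simp
      then show ?case using step[of k] by linarith
    qed
    show "2 * pi + 2 * (\<integral>z. ?P a z \<partial>V) \<le> (\<integral>\<tau>. seen_from_a \<tau> \<partial>\<Gamma>) + \<epsilon>"
      by (rule tendsto_le[OF trivial_limit_sequentially _ _ ev]) (intro tendsto_intros limP limB)+
  qed
qed

lemma conical: "AE z in V. perp a z = 0"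
proof -
  let ?P = "\<lambda>\<eta> z. if \<eta> \<le> D a z then (perp a z)\<^sup>2 / (D a z) ^ 4 else 0"
  have E: "integrable V (\<lambda>z. (perp a z)\<^sup>2 / (D a z) ^ 4)" using perp_energy[OF bba s(1) _, of s] s by simp
  have each: "AE z in V. ?P (1 / real (Suc k)) z = 0" for k
  proof -
    have i: "integrable V (?P (1 / real (Suc k)))"
      by (rule Bochner_Integration.integrable_bound[OF E]) auto
    have "(\<integral>z. ?P (1 / real (Suc k)) z \<partial>V) \<le> 0"
      using conical_identity[of "1 / real (Suc k)"] seen_length_le_2pi by simp
    moreover have "0 \<le> (\<integral>z. ?P (1 / real (Suc k)) z \<partial>V)" by (rule integral_nonneg_AE) auto
    ultimately have "(\<integral>z. ?P (1 / real (Suc k)) z \<partial>V) = 0" by linarith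
    moreover have "AE z in V. 0 \<le> ?P (1 / real (Suc k)) z" by (rule AE_I2) simp
    ultimately show ?thesis using integral_nonneg_eq_0_iff_AE[OF i] by blast
  qed
  then have "AE z in V. \<forall>k. ?P (1 / real (Suc k)) z = 0" unfolding AE_all_countable by (rule allI)
  then show ?thesis using AE_off_a
  proof eventually_elim
    case (elim z)
    obtain k where "1 / real (Suc k) < D a z"
      using reals_Archimedean[OF elim(2)] by (auto simp only: inverse_eq_divide)
    moreover have "?P (1 / real (Suc k)) z = 0" using elim(1) by (rule spec)
    ultimately have "(perp a z)\<^sup>2 / (D a z) ^ 4 = 0" by (simp split: if_splits)
    then show ?case using elim(2) by simp
  qed
qed

end

context touching_varifold begin

section \<open>rotations\<close>

definition twist :: "real^'n \<Rightarrow> real^'n \<Rightarrow> real^'n \<Rightarrow> real^'n" where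
  "twist i j y = (j \<bullet> y) *\<^sub>R i - (i \<bullet> y) *\<^sub>R j"

lemma smooth_real_polynomial:
  fixes h :: "real^'n \<Rightarrow> real"
  assumes "real_polynomial_function p" "smooth h"
  shows "smooth (\<lambda>x. p (h x))"
  using assms(1)
proof (induction p)
  case (linear f)
  then have f: "f t = t * f 1" for t using linear_simps(5)[OF linear, of t 1] by simp
  have "(\<lambda>x. f (h x)) = (\<lambda>x. h x * f 1)" by (rule ext) (rule f)
  then show ?case using assms(2) by (simp only: smooth_mult smooth_const)
next
  case (const r)
  show ?case by (rule smooth_const)
next
  case (add f g)
  then show ?case by (intro smooth_add) blast+
next
  case (mult f g)
  then show ?case by (intro smooth_mult) blast+
qed

lemma first_variation_mod_rotations:
  assumes X: "smooth X" and p: "\<And>i j. real_polynomial_function (p i j)"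
  shows "(\<integral>z. tangential_div (snd z) (frechet_derivative X (at (fst z))) \<partial>V)
    \<le> (\<integral>\<tau>. parallelogram_area (X (\<gamma> \<tau>) - (\<Sum>i\<in>Basis. \<Sum>j\<in>Basis. p i j ((norm (\<gamma> \<tau> - a))\<^sup>2) *\<^sub>R twist i j (\<gamma> \<tau> - a))) (c \<tau>) \<partial>\<Gamma>)"
proof -
  obtain p' where p': "\<And>i j t. (p i j has_real_derivative p' i j t) (at t)" "\<And>i j. real_polynomial_function (p' i j)"
    using has_real_derivative_polynomial_function[OF p] by metis
  let ?Y = "\<lambda>i j x. p i j ((norm (x - a))\<^sup>2) *\<^sub>R twist i j (x - a)"
  let ?Y' = "\<lambda>i j x h. (2 * p' i j ((norm (x - a))\<^sup>2) * ((x - a) \<bullet> h)) *\<^sub>R twist i j (x - a) + p i j ((norm (x - a))\<^sup>2) *\<^sub>R twist i j h"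
  let ?dX = "\<lambda>x. frechet_derivative X (at x)"
  let ?b = "\<lambda>z. tangential_div (snd z) (?dX (fst z))"
  let ?gy = "\<lambda>i j z. 2 * p' i j ((D a z)\<^sup>2) * ((fst z - a) \<bullet> (snd z *v twist i j (fst z - a)))"
  let ?g = "\<lambda>z. ?b z - (\<Sum>i\<in>Basis. \<Sum>j\<in>Basis. ?gy i j z)"
  have smtw: "smooth (\<lambda>x. twist i j (x - a))" for i j unfolding twist_def
    by (intro smooth_diff smooth_scaleR smooth_inner smooth_ident smooth_const)
  have smq: "smooth (\<lambda>x. (norm (x - a))\<^sup>2)"
    by (intro smooth_norm_sq smooth_diff smooth_ident smooth_const)
  have smY: "smooth (?Y i j)" for i j
    by (rule smooth_scaleR[OF smooth_real_polynomial[OF p smq] smtw])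
  have sm: "smooth (\<lambda>x. X x - (\<Sum>i\<in>Basis. \<Sum>j\<in>Basis. ?Y i j x))"
    by (intro smooth_diff[OF X] smooth_sum smY)
  have dtw: "((\<lambda>x. twist i j (x - a)) has_derivative twist i j) (at x)" for i j x
  proof -
    have "((\<lambda>x. (j \<bullet> (x - a)) *\<^sub>R i - (i \<bullet> (x - a)) *\<^sub>R j) has_derivative
        (\<lambda>h. (j \<bullet> (h - 0)) *\<^sub>R i - (i \<bullet> (h - 0)) *\<^sub>R j)) (at x)"
      by (intro has_derivative_diff has_derivative_scaleR_left has_derivative_inner_right has_derivative_ident has_derivative_const)
    then show ?thesis unfolding twist_def[abs_def] by simp
  qed
  have dY: "(?Y i j has_derivative ?Y' i j x) (at x)" for i j x
    by (rule has_derivative_radial_weight[OF dtw p'(1)])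
  have der: "((\<lambda>x. X x - (\<Sum>i\<in>Basis. \<Sum>j\<in>Basis. ?Y i j x)) has_derivative
      (\<lambda>h. ?dX x h - (\<Sum>i\<in>Basis. \<Sum>j\<in>Basis. ?Y' i j x h))) (at x)" for x
    by (intro has_derivative_diff has_derivative_sum smooth_has_derivative[OF X] dY)
  have td: "tangential_div (snd z) (\<lambda>h. ?dX (fst z) h - (\<Sum>i\<in>Basis. \<Sum>j\<in>Basis. ?Y' i j (fst z) h)) = ?g z"
    if z: "snd z \<in> planes" for z
  proof -
    have sumd: "tangential_div P (\<lambda>h. \<Sum>i\<in>I. A i h) = (\<Sum>i\<in>I. tangential_div P (A i))"
      for I and P :: "real^'n^'n" and A :: "real^'n \<Rightarrow> real^'n \<Rightarrow> real^'n"
      unfolding tangential_div_def inner_sum_right by (rule sum.swap)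
    have diffd: "tangential_div P (\<lambda>h. A h - B h) = tangential_div P A - tangential_div P B"
      for P :: "real^'n^'n" and A B :: "real^'n \<Rightarrow> real^'n"
      by (simp add: tangential_div_def inner_diff_right sum_subtractf)
    have "tangential_div (snd z) (?Y' i j (fst z)) = ?gy i j z" for i j
      unfolding tangential_div_radial_weight[OF z]
      using tangential_div_skew[OF z, of j i] by (simp add: twist_def[abs_def])
    then show ?thesis unfolding diffd sumd by simp
  qed
  have mp': "(\<lambda>z. p' i j ((D a z)\<^sup>2)) \<in> borel_measurable V" for i j
  proof -
    have "continuous_on UNIV (p' i j)"
      using continuous_on_polymonial_function[OF p'(2)[unfolded real_polynomial_function_eq]] by simp
    then have "p' i j \<in> borel_measurable borel" by (rule borel_measurable_continuous_onI)
    then show ?thesis by measurable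
  qed
  have mtw: "(\<lambda>z. twist i j (fst z - a)) \<in> borel_measurable V" for i j
    unfolding twist_def by measurable
  have mgy: "?gy i j \<in> borel_measurable V" for i j
    by (intro borel_measurable_times borel_measurable_const mp' borel_measurable_inner borel_measurable_diff
        measurable_fst_V measurable_plane_apply mtw)
  have mg: "?g \<in> borel_measurable V"
    by (intro borel_measurable_diff measurable_tangential_div[OF sets_V X] borel_measurable_sum mgy)
  have "AE z in V. ?b z = ?g z"
    using planes_AE conical
  proof eventually_elim
    case (elim z)
    define y where "y = fst z - a"
    have "snd z *v y = y" using elim(2) by (simp add: perp_def y_def)
    then have Py: "y \<bullet> (snd z *v h) = y \<bullet> h" for h using plane_sym[OF elim(1), of y h] by simp
    have "(fst z - a) \<bullet> (snd z *v twist i j (fst z - a)) = 0" for i j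
      unfolding y_def[symmetric] Py by (simp add: twist_def inner_diff_right inner_commute)
    then show ?case by simp
  qed
  then have "(\<integral>z. ?b z \<partial>V) = (\<integral>z. ?g z \<partial>V)"
    by (intro integral_cong_AE measurable_tangential_div[OF sets_V X] mg)
  also have "\<dots> \<le> (\<integral>\<tau>. parallelogram_area (X (\<gamma> \<tau>) - (\<Sum>i\<in>Basis. \<Sum>j\<in>Basis. ?Y i j (\<gamma> \<tau>))) (c \<tau>) \<partial>\<Gamma>)"
    by (rule first_variation(2)[OF bba sm der mg td])
  finally show ?thesis .
qed

end

lemma integrable_arc_continuous:
  "continuous_on {\<alpha>..\<beta>} f \<Longrightarrow> integrable (arc_measure \<alpha> \<beta>) (f :: real \<Rightarrow> real)"
  unfolding integrable_arc_measure by (rule borel_integrable_atLeastAtMost')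

context touching_varifold begin

abbreviation sqdist :: "real \<Rightarrow> real" where
  "sqdist \<tau> \<equiv> (norm (\<gamma> \<tau> - a))\<^sup>2"

abbreviation rotation_field :: "(real^'n \<Rightarrow> real^'n \<Rightarrow> real \<Rightarrow> real) \<Rightarrow> real \<Rightarrow> real^'n" where
  "rotation_field f \<tau> \<equiv> \<Sum>i\<in>Basis. \<Sum>j\<in>Basis. f i j (sqdist \<tau>) *\<^sub>R twist i j (\<gamma> \<tau> - a)"

lemma \<gamma>_cont_tail: "continuous_on {s..1} \<gamma>" and c_cont_tail: "continuous_on {s..1} c"
  using s by (auto intro: continuous_on_subset[OF \<gamma>_cont] continuous_on_subset[OF c_cont])

lemma smooth_on_tail: "smooth X \<Longrightarrow> continuous_on {s..1} (\<lambda>\<tau>. X (\<gamma> \<tau>))"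
  by (rule continuous_on_compose2[OF smooth_continuous \<gamma>_cont_tail]) auto

lemma sqdist_cont: "continuous_on {s..1} sqdist"
  by (intro continuous_intros \<gamma>_cont_tail)

lemma norm_tail_le: "s \<le> \<tau> \<Longrightarrow> \<tau> \<le> 1 \<Longrightarrow> norm (\<gamma> \<tau> - a) \<le> K * (\<tau> - s)"
  using gamma_lipschitz[of \<tau> s] s by simp

lemma norm_tail_le_K: "s \<le> \<tau> \<Longrightarrow> \<tau> \<le> 1 \<Longrightarrow> norm (\<gamma> \<tau> - a) \<le> K"
  using norm_tail_le[of \<tau>] mult_left_le[of "\<tau> - s" K] K0 s by linarith

lemma rotation_field_cont:
  assumes "\<And>i j. continuous_on {0..K\<^sup>2} (f i j)"
  shows "continuous_on {s..1} (rotation_field f)"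
proof -
  have "continuous_on {s..1} (\<lambda>\<tau>. f i j (sqdist \<tau>))" for i j
    by (rule continuous_on_compose2[OF assms sqdist_cont]) (use norm_tail_le_K in \<open>auto intro!: power_mono\<close>)
  then show ?thesis unfolding twist_def by (intro continuous_intros \<gamma>_cont_tail) auto
qed

lemma first_variation_mod_continuous_rotations:
  assumes X: "smooth X" and f: "\<And>i j. continuous_on {0..K\<^sup>2} (f i j)"
  shows "(\<integral>z. tangential_div (snd z) (frechet_derivative X (at (fst z))) \<partial>V)
    \<le> (\<integral>\<tau>. parallelogram_area (X (\<gamma> \<tau>) - rotation_field f \<tau>) (c \<tau>) \<partial>\<Gamma>)"
proof (rule field_le_epsilon)
  fix \<epsilon> :: real assume \<epsilon>: "\<epsilon> > 0"
  define B where "B = real (DIM(real^'n)) * (real (DIM(real^'n)) * (2 * K)) * K"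
  have B0: "0 \<le> B" using K0 by (simp add: B_def)
  define \<delta> where "\<delta> = \<epsilon> / (B + 1)"
  have \<delta>: "\<delta> > 0" "\<delta> * B \<le> \<epsilon>" using \<epsilon> B0 by (auto simp: \<delta>_def field_simps)
  have "\<exists>p. real_polynomial_function p \<and> (\<forall>t\<in>{0..K\<^sup>2}. \<bar>f i j t - p t\<bar> < \<delta>)" for i j
    using Stone_Weierstrass_real_polynomial_function[OF compact_Icc f \<delta>(1)] by metis
  then obtain p where p: "\<And>i j. real_polynomial_function (p i j)"
      "\<And>i j t. t \<in> {0..K\<^sup>2} \<Longrightarrow> \<bar>f i j t - p i j t\<bar> < \<delta>"
    by metis
  have pc: "continuous_on {0..K\<^sup>2} (p i j)" for i j
    using continuous_on_polymonial_function[OF p(1)[unfolded real_polynomial_function_eq]] by blast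
  let ?F = "\<lambda>\<tau>. parallelogram_area (X (\<gamma> \<tau>) - rotation_field f \<tau>) (c \<tau>)"
  let ?P = "\<lambda>\<tau>. parallelogram_area (X (\<gamma> \<tau>) - rotation_field p \<tau>) (c \<tau>)"
  have iF: "integrable \<Gamma> ?F" and iP: "integrable \<Gamma> ?P"
    by (intro integrable_arc_continuous continuous_on_parallelogram_area continuous_on_diff smooth_on_tail[OF X]
        rotation_field_cont f pc c_cont_tail)+
  have le: "?P \<tau> \<le> ?F \<tau> + \<epsilon>" if \<tau>: "s < \<tau>" "\<tau> \<le> 1" for \<tau>
  proof -
    let ?y = "\<gamma> \<tau> - a"
    have y: "norm ?y \<le> K" using norm_tail_le_K[of \<tau>] \<tau> by simp
    have t: "sqdist \<tau> \<in> {0..K\<^sup>2}" using y by (auto intro!: power_mono)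
    have tw: "norm (twist i j ?y) \<le> 2 * K" if "i \<in> Basis" "j \<in> Basis" for i j
    proof -
      have "norm (twist i j ?y) \<le> norm ((j \<bullet> ?y) *\<^sub>R i) + norm ((i \<bullet> ?y) *\<^sub>R j)"
        unfolding twist_def by (rule norm_triangle_ineq4)
      also have "\<dots> = \<bar>?y \<bullet> j\<bar> + \<bar>?y \<bullet> i\<bar>" using that by (simp add: inner_commute)
      also have "\<dots> \<le> norm ?y + norm ?y" using that by (intro add_mono Basis_le_norm)
      finally show ?thesis using y by linarith
    qed
    let ?d = "\<lambda>i j. (f i j (sqdist \<tau>) - p i j (sqdist \<tau>)) *\<^sub>R twist i j ?y"
    have d: "norm (?d i j) \<le> \<delta> * (2 * K)" if "i \<in> Basis" "j \<in> Basis" for i j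
      unfolding norm_scaleR by (intro mult_mono less_imp_le[OF p(2)] t tw that) (use \<delta> in auto)
    have eq: "rotation_field f \<tau> - rotation_field p \<tau> = (\<Sum>i\<in>Basis. \<Sum>j\<in>Basis. ?d i j)"
      by (simp only: sum_subtractf[symmetric] scaleR_diff_left)
    have "norm (\<Sum>i\<in>Basis. \<Sum>j\<in>Basis. ?d i j) \<le> (\<Sum>i\<in>(Basis::(real^'n) set). \<Sum>j\<in>(Basis::(real^'n) set). \<delta> * (2 * K))"
      by (intro sum_norm_le d)
    also have "\<dots> = \<delta> * (real (DIM(real^'n)) * (real (DIM(real^'n)) * (2 * K)))" by simp
    finally have n: "norm (rotation_field f \<tau> - rotation_field p \<tau>)
        \<le> \<delta> * (real (DIM(real^'n)) * (real (DIM(real^'n)) * (2 * K)))" unfolding eq .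
    have "parallelogram_area (rotation_field f \<tau> - rotation_field p \<tau>) (c \<tau>)
        \<le> norm (rotation_field f \<tau> - rotation_field p \<tau>) * norm (c \<tau>)" by (rule parallelogram_area_le_norm)
    also have "\<dots> \<le> \<delta> * (real (DIM(real^'n)) * (real (DIM(real^'n)) * (2 * K))) * K"
      by (intro mult_mono n speed) (use \<tau> s \<delta> K0 in auto)
    also have "\<dots> = \<delta> * B" by (simp only: B_def mult.assoc)
    finally have e: "parallelogram_area (rotation_field f \<tau> - rotation_field p \<tau>) (c \<tau>) \<le> \<epsilon>" using \<delta>(2) by linarith
    have "X (\<gamma> \<tau>) - rotation_field p \<tau> = (X (\<gamma> \<tau>) - rotation_field f \<tau>) + (rotation_field f \<tau> - rotation_field p \<tau>)"
      by simp
    then have "?P \<tau> \<le> ?F \<tau> + parallelogram_area (rotation_field f \<tau> - rotation_field p \<tau>) (c \<tau>)"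
      using parallelogram_area_add_left[of "X (\<gamma> \<tau>) - rotation_field f \<tau>" "rotation_field f \<tau> - rotation_field p \<tau>" "c \<tau>"]
      by (simp only:)
    then show ?thesis using e by linarith
  qed
  have iFP: "integrable \<Gamma> (\<lambda>\<tau>. ?P \<tau> - ?F \<tau>)" by (intro Bochner_Integration.integrable_diff iP iF)
  have "(\<integral>\<tau>. ?P \<tau> - ?F \<tau> \<partial>\<Gamma>) \<le> \<epsilon> * (1 - s)"
  proof (rule integral_le_const_arc[OF _ iFP])
    show "AE \<tau> in \<Gamma>. ?P \<tau> - ?F \<tau> \<le> \<epsilon>"
      using AE_arc_measure[of s 1] by eventually_elim (use le in \<open>simp add: diff_le_eq add.commute\<close>)
  qed (use s in simp)
  also have "\<dots> \<le> \<epsilon>" using s \<epsilon> by (intro mult_left_le) auto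
  finally have "(\<integral>\<tau>. ?P \<tau> \<partial>\<Gamma>) - (\<integral>\<tau>. ?F \<tau> \<partial>\<Gamma>) \<le> \<epsilon>" by (simp only: Bochner_Integration.integral_diff[OF iP iF])
  then show "(\<integral>z. tangential_div (snd z) (frechet_derivative X (at (fst z))) \<partial>V) \<le> (\<integral>\<tau>. ?F \<tau> \<partial>\<Gamma>) + \<epsilon>"
    using first_variation_mod_rotations[of X p, OF X p(1)] by linarith
qed

lemma distance_increases_near_start:
  obtains \<sigma> where "\<sigma> > 0" "s + \<sigma> \<le> 1" "\<And>\<tau>. s < \<tau> \<Longrightarrow> \<tau> \<le> s + \<sigma> \<Longrightarrow> (\<gamma> \<tau> - a) \<bullet> c \<tau> > 0"
    "strict_mono_on {s..s + \<sigma>} sqdist" "\<And>\<tau>. s + \<sigma> \<le> \<tau> \<Longrightarrow> \<tau> \<le> 1 \<Longrightarrow> sqdist (s + \<sigma>) \<le> sqdist \<tau>"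
proof -
  define \<sigma>1 where "\<sigma>1 = min (1 - s) (m / (4 * (C + 1)))"
  have \<sigma>1: "\<sigma>1 > 0" "s + \<sigma>1 \<le> 1" using s m0 C0 by (auto simp: \<sigma>1_def)
  have "C * \<sigma>1 \<le> C * (m / (4 * (C + 1)))" using C0 by (intro mult_left_mono) (auto simp: \<sigma>1_def)
  also have "\<dots> \<le> m / 4" using C0 m0 by (simp add: field_simps)
  finally have C\<sigma>: "C * \<sigma>1 \<le> m / 4" .
  have pos: "(\<gamma> \<tau> - a) \<bullet> c \<tau> > 0" if \<tau>: "s < \<tau>" "\<tau> \<le> s + \<sigma>1" for \<tau>
  proof -
    let ?l = "\<tau> - s" and ?n = "norm (c \<tau>)"
    have l: "?l > 0" using \<tau> by simp
    have "C * ?l \<le> C * \<sigma>1" using \<tau> C0 by (intro mult_left_mono) auto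
    then have Cl: "C * ?l \<le> m / 4" using C\<sigma> by linarith
    define r where "r = \<gamma> \<tau> - a - ?l *\<^sub>R c \<tau>"
    have "\<gamma> s - \<gamma> \<tau> - (s - \<tau>) *\<^sub>R c \<tau> = - r" by (simp add: r_def algebra_simps)
    then have r: "norm r \<le> C * ?l\<^sup>2"
      using taylor[of s \<tau>] \<tau> \<sigma>1 s by (simp add: power2_commute)
    have "m * ?l \<le> norm (?l *\<^sub>R c \<tau> + r)" using arc_dist[of \<tau>] \<tau> \<sigma>1 by (simp add: r_def)
    also have "\<dots> \<le> ?l * ?n + C * ?l\<^sup>2" using norm_triangle_ineq[of "?l *\<^sub>R c \<tau>" r] r l by simp
    also have "\<dots> = (?n + C * ?l) * ?l" by (simp add: algebra_simps power2_eq_square)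
    finally have "m \<le> ?n + C * ?l" using l by simp
    then have n: "C * ?l < ?n" using Cl m0 by linarith
    have "(\<gamma> \<tau> - a) \<bullet> c \<tau> = ?l * ?n\<^sup>2 + r \<bullet> c \<tau>" by (simp add: r_def power2_norm_eq_inner inner_diff_left)
    moreover have "\<bar>r \<bullet> c \<tau>\<bar> \<le> C * ?l\<^sup>2 * ?n"
      using Cauchy_Schwarz_ineq2[of r "c \<tau>"] mult_right_mono[OF r, of ?n] by simp
    moreover have "C * ?l\<^sup>2 * ?n < ?l * ?n\<^sup>2"
    proof -
      have "0 \<le> C * ?l" using C0 l by simp
      then have "?l * ?n > 0" using n l by (intro mult_pos_pos) linarith+
      from mult_strict_left_mono[OF n this] show ?thesis by (simp add: power2_eq_square mult_ac)
    qed
    ultimately show ?thesis by linarith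
  qed
  have mono1: "sqdist x < sqdist y" if xy: "s \<le> x" "x < y" "y \<le> s + \<sigma>1" for x y
  proof (rule DERIV_pos_imp_increasing_open[OF xy(2)])
    show "continuous_on {x..y} sqdist" using xy \<sigma>1 by (intro continuous_on_subset[OF sqdist_cont]) auto
    fix t assume t: "x < t" "t < y"
    have "at t within {0..1} = at t" using t xy \<sigma>1 s by (intro at_within_Icc_at) auto
    then have "(\<gamma> has_vector_derivative c t) (at t)" using deriv[of t] t xy \<sigma>1 s by simp
    then have "((\<lambda>\<tau>. (\<gamma> \<tau> - a) \<bullet> (\<gamma> \<tau> - a)) has_derivative
        (\<lambda>h. (\<gamma> t - a) \<bullet> (h *\<^sub>R c t - 0) + (h *\<^sub>R c t - 0) \<bullet> (\<gamma> t - a))) (at t)"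
      unfolding has_vector_derivative_def
      by (intro has_derivative_inner has_derivative_diff has_derivative_const)
    then have "(sqdist has_real_derivative 2 * ((\<gamma> t - a) \<bullet> c t)) (at t)"
      unfolding has_field_derivative_def power2_norm_eq_inner
      by (rule has_derivative_eq_rhs) (simp add: fun_eq_iff inner_commute mult_ac)
    then show "\<exists>D. (sqdist has_real_derivative D) (at t) \<and> 0 < D" using pos[of t] t xy by auto
  qed
  define \<sigma> where "\<sigma> = \<sigma>1 * (m / (K + m))"
  have q: "0 < m / (K + m)" "m / (K + m) \<le> 1" "K * (m / (K + m)) \<le> m" using m0 K0 by (auto simp: field_simps)
  have \<sigma>: "\<sigma> > 0" "\<sigma> \<le> \<sigma>1" 
    using mult_pos_pos[OF \<sigma>1(1) q(1)] q \<sigma>1 mult_left_le[of "m / (K + m)" \<sigma>1] unfolding \<sigma>_def by linarith+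
  have "K * \<sigma> = K * (m / (K + m)) * \<sigma>1" by (simp add: \<sigma>_def)
  then have K\<sigma>: "K * \<sigma> \<le> m * \<sigma>1" using mult_right_mono[OF q(3), of \<sigma>1] \<sigma>1 by simp
  have far: "sqdist (s + \<sigma>) \<le> sqdist \<tau>" if \<tau>: "s + \<sigma> \<le> \<tau>" "\<tau> \<le> 1" for \<tau>
  proof (cases "\<tau> \<le> s + \<sigma>1")
    case True
    then have "s + \<sigma> = \<tau> \<or> sqdist (s + \<sigma>) < sqdist \<tau>" using mono1[of "s + \<sigma>" \<tau>] \<tau> \<sigma> by linarith
    then show ?thesis by (elim disjE less_imp_le) simp
  next
    case False
    have "norm (\<gamma> (s + \<sigma>) - a) \<le> K * \<sigma>" using norm_tail_le[of "s + \<sigma>"] \<sigma> \<sigma>1 by simp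
    also have "m * \<sigma>1 \<le> m * (\<tau> - s)" using False m0 by (intro mult_left_mono) auto
    then have "K * \<sigma> \<le> norm (\<gamma> \<tau> - a)" using K\<sigma> arc_dist[of \<tau>] \<tau> \<sigma> by linarith
    finally show ?thesis by (intro power_mono) auto
  qed
  show thesis
  proof (rule that[OF \<sigma>(1) _ _ _ far])
    show "strict_mono_on {s..s + \<sigma>} sqdist" using mono1 \<sigma> by (auto simp: strict_mono_on_def)
  qed (use \<sigma> \<sigma>1 pos in auto)
qed

lemma function_of_distance:
  fixes \<phi> :: "real \<Rightarrow> real"
  assumes \<sigma>: "\<sigma> > 0" "s + \<sigma> \<le> 1" and mono: "strict_mono_on {s..s + \<sigma>} sqdist"
    and far: "\<And>\<tau>. s + \<sigma> \<le> \<tau> \<Longrightarrow> \<tau> \<le> 1 \<Longrightarrow> sqdist (s + \<sigma>) \<le> sqdist \<tau>"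
    and \<phi>: "continuous_on {s..s + \<sigma>} \<phi>" "\<And>\<tau>. s + \<sigma> \<le> \<tau> \<Longrightarrow> \<phi> \<tau> = 0"
  shows "\<exists>f. continuous_on {0..} f \<and> (\<forall>\<tau>\<in>{s..1}. f (sqdist \<tau>) = \<phi> \<tau>)"
proof -
  let ?I = "{s..s + \<sigma>}" and ?G = "sqdist (s + \<sigma>)"
  define \<theta> where "\<theta> = the_inv_into ?I sqdist"
  have inj: "inj_on sqdist ?I" by (rule strict_mono_on_imp_inj_on[OF mono])
  have \<theta>: "\<theta> (sqdist \<tau>) = \<tau>" if "\<tau> \<in> ?I" for \<tau> unfolding \<theta>_def by (rule the_inv_into_f_f[OF inj that])
  have cont: "continuous_on ?I sqdist" using \<sigma> by (intro continuous_on_subset[OF sqdist_cont]) auto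
  have img: "{0..?G} \<subseteq> sqdist ` ?I"
  proof (rule connected_contains_Icc)
    show "connected (sqdist ` ?I)" by (intro connected_continuous_image cont) auto
    show "0 \<in> sqdist ` ?I" using \<sigma> by (intro image_eqI[of _ _ s]) auto
  qed (use \<sigma> in auto)
  have \<theta>c: "continuous_on {0..?G} \<theta>"
    by (rule continuous_on_subset[OF continuous_on_inv[OF cont] img]) (use \<theta> in auto)
  have \<theta>r: "\<theta> t \<in> ?I" if "t \<in> {0..?G}" for t using img that \<theta> by fastforce
  have le: "sqdist \<tau> \<le> ?G" if "\<tau> \<in> ?I" for \<tau>
    using strict_mono_on_leD[OF mono that, of "s + \<sigma>"] that \<sigma> by auto
  have "continuous_on {0..} (\<lambda>t. \<theta> (min t ?G))"
    by (rule continuous_on_compose2[OF \<theta>c]) (auto intro!: continuous_intros)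
  then have "continuous_on {0..} (\<lambda>t. \<phi> (\<theta> (min t ?G)))"
    by (rule continuous_on_compose2[OF \<phi>(1)]) (intro image_subsetI \<theta>r, auto)
  moreover have "\<phi> (\<theta> (min (sqdist \<tau>) ?G)) = \<phi> \<tau>" if "\<tau> \<in> {s..1}" for \<tau>
  proof (cases "\<tau> \<le> s + \<sigma>")
    case True
    then have "\<tau> \<in> ?I" using that by simp
    then show ?thesis using le[of \<tau>] \<theta>[of \<tau>] by (simp add: min_absorb1)
  next
    case False
    then have "min (sqdist \<tau>) ?G = ?G" using far[of \<tau>] that by (simp add: min_absorb2)
    then show ?thesis using \<theta>[of "s + \<sigma>"] \<sigma> \<phi>(2) False by simp
  qed
  ultimately show ?thesis by blast
qed

lemma first_variation_mod_normal_field: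
  assumes \<sigma>: "\<sigma> > 0" "s + \<sigma> \<le> 1" and mono: "strict_mono_on {s..s + \<sigma>} sqdist"
    and far: "\<And>\<tau>. s + \<sigma> \<le> \<tau> \<Longrightarrow> \<tau> \<le> 1 \<Longrightarrow> sqdist (s + \<sigma>) \<le> sqdist \<tau>"
    and X: "smooth X" and w: "continuous_on {s..s + \<sigma>} w" "\<And>\<tau>. s + \<sigma> \<le> \<tau> \<Longrightarrow> w \<tau> = 0"
    and \<eta>: "\<eta> > 0" "\<And>\<tau>. \<tau> \<le> s + \<eta> \<Longrightarrow> w \<tau> = 0" and orth: "\<And>\<tau>. w \<tau> \<bullet> (\<gamma> \<tau> - a) = 0"
  shows "(\<integral>z. tangential_div (snd z) (frechet_derivative X (at (fst z))) \<partial>V)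
    \<le> (\<integral>\<tau>. parallelogram_area (X (\<gamma> \<tau>) - w \<tau>) (c \<tau>) \<partial>\<Gamma>)"
proof -
  let ?y = "\<lambda>\<tau>. \<gamma> (max \<tau> (s + \<eta>)) - a"
  let ?\<phi> = "\<lambda>i j \<tau>. (w \<tau> \<bullet> i) * (?y \<tau> \<bullet> j) / (norm (?y \<tau>))\<^sup>2"
  show ?thesis
  proof (cases "s + \<eta> \<le> 1")
    case \<eta>1: True
    have y0: "?y \<tau> \<noteq> 0" if "\<tau> \<le> 1" for \<tau>
      using arc_point_pos[of "max \<tau> (s + \<eta>)"] that \<eta> \<eta>1 by auto
    have "continuous_on {s..s + \<sigma>} (\<lambda>\<tau>. \<gamma> (max \<tau> (s + \<eta>)))"
      by (rule continuous_on_compose2[OF \<gamma>_cont]) (use \<sigma> \<eta> \<eta>1 s in \<open>auto intro!: continuous_intros\<close>)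
    then have cont: "continuous_on {s..s + \<sigma>} (?\<phi> i j)" for i j
      by (intro continuous_intros w) (use y0 \<sigma> in auto)
    have "\<exists>f. continuous_on {0..} f \<and> (\<forall>\<tau>\<in>{s..1}. f (sqdist \<tau>) = ?\<phi> i j \<tau>)" for i j
      by (rule function_of_distance[OF \<sigma> mono far cont]) (use w(2) in auto)
    then obtain f where f: "\<And>i j. continuous_on {0..} (f i j)"
      "\<And>i j \<tau>. \<tau> \<in> {s..1} \<Longrightarrow> f i j (sqdist \<tau>) = ?\<phi> i j \<tau>" by metis
    have fc: "continuous_on {0..K\<^sup>2} (f i j)" for i j by (rule continuous_on_subset[OF f(1)]) auto
    have eq: "rotation_field f \<tau> = w \<tau>" if \<tau>: "\<tau> \<in> {s..1}" for \<tau>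
    proof (cases "w \<tau> = 0")
      case True
      then show ?thesis unfolding f(2)[OF \<tau>] by simp
    next
      case False
      then have "s + \<eta> \<le> \<tau>" using \<eta>(2)[of \<tau>] by force
      then have m: "max \<tau> (s + \<eta>) = \<tau>" by simp
      define y where "y = \<gamma> \<tau> - a"
      have y: "(norm y)\<^sup>2 \<noteq> 0" using y0[of \<tau>] \<tau> m by (simp add: y_def)
      have wy: "w \<tau> \<bullet> y = 0" using orth[of \<tau>] by (simp add: y_def)
      have inner: "(\<Sum>j\<in>Basis. ((w \<tau> \<bullet> i) * (y \<bullet> j) / (norm y)\<^sup>2) *\<^sub>R twist i j y)
          = (w \<tau> \<bullet> i) *\<^sub>R i - ((w \<tau> \<bullet> i) * (y \<bullet> i) / (norm y)\<^sup>2) *\<^sub>R y" for i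
      proof -
        have e1: "(\<Sum>j\<in>Basis. ((w \<tau> \<bullet> i) * (y \<bullet> j) / (norm y)\<^sup>2) *\<^sub>R ((j \<bullet> y) *\<^sub>R i))
            = ((w \<tau> \<bullet> i) / (norm y)\<^sup>2 * (\<Sum>j\<in>Basis. (y \<bullet> j) * (y \<bullet> j))) *\<^sub>R i"
          by (simp add: sum_distrib_left scaleR_sum_left sum_divide_distrib inner_commute mult_ac)
        have e2: "(\<Sum>j\<in>Basis. ((w \<tau> \<bullet> i) * (y \<bullet> j) / (norm y)\<^sup>2) *\<^sub>R ((i \<bullet> y) *\<^sub>R j))
            = ((w \<tau> \<bullet> i) * (y \<bullet> i) / (norm y)\<^sup>2) *\<^sub>R (\<Sum>j\<in>Basis. (y \<bullet> j) *\<^sub>R j)"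
          by (simp add: scaleR_sum_right inner_commute mult_ac)
        have "(\<Sum>j\<in>Basis. (y \<bullet> j) * (y \<bullet> j)) = (norm y)\<^sup>2"
          unfolding power2_norm_eq_inner by (rule euclidean_inner[symmetric])
        then show ?thesis
          unfolding twist_def scaleR_diff_right sum_subtractf e1 e2 euclidean_representation using y by simp
      qed
      have "rotation_field f \<tau> = (\<Sum>i\<in>Basis. (w \<tau> \<bullet> i) *\<^sub>R i - ((w \<tau> \<bullet> i) * (y \<bullet> i) / (norm y)\<^sup>2) *\<^sub>R y)"
        unfolding f(2)[OF \<tau>] unfolding m unfolding y_def[symmetric] unfolding inner ..
      also have "\<dots> = w \<tau> - ((\<Sum>i\<in>Basis. (w \<tau> \<bullet> i) * (y \<bullet> i)) / (norm y)\<^sup>2) *\<^sub>R y"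
        by (simp add: sum_subtractf euclidean_representation sum_divide_distrib scaleR_sum_left)
      also have "(\<Sum>i\<in>Basis. (w \<tau> \<bullet> i) * (y \<bullet> i)) = 0" using wy by (simp add: euclidean_inner[symmetric])
      finally show ?thesis by simp
    qed
    have "(\<integral>\<tau>. parallelogram_area (X (\<gamma> \<tau>) - rotation_field f \<tau>) (c \<tau>) \<partial>\<Gamma>)
        = (\<integral>\<tau>. parallelogram_area (X (\<gamma> \<tau>) - w \<tau>) (c \<tau>) \<partial>\<Gamma>)"
      by (intro Bochner_Integration.integral_cong refl) (simp add: eq)
    then show ?thesis using first_variation_mod_continuous_rotations[of X f, OF X fc] by simp
  next
    case False
    then have "w \<tau> = 0" if "\<tau> \<le> 1" for \<tau> using \<eta>(2)[of \<tau>] that by simp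
    then have "(\<integral>\<tau>. parallelogram_area (X (\<gamma> \<tau>) - w \<tau>) (c \<tau>) \<partial>\<Gamma>) = (\<integral>\<tau>. parallelogram_area (X (\<gamma> \<tau>)) (c \<tau>) \<partial>\<Gamma>)"
      by (intro Bochner_Integration.integral_cong refl) simp
    then show ?thesis using bba X by (simp add: bounded_by_arc_def)
  qed
qed

lemma bounded_by_shorter_arc:
  obtains \<sigma> where "\<sigma> > 0" "s + \<sigma> \<le> 1" "bounded_by_arc (s + \<sigma>)"
proof -
  obtain \<sigma> where \<sigma>: "\<sigma> > 0" "s + \<sigma> \<le> 1" and yc: "\<And>\<tau>. s < \<tau> \<Longrightarrow> \<tau> \<le> s + \<sigma> \<Longrightarrow> (\<gamma> \<tau> - a) \<bullet> c \<tau> > 0"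
    and mono: "strict_mono_on {s..s + \<sigma>} sqdist" and far: "\<And>\<tau>. s + \<sigma> \<le> \<tau> \<Longrightarrow> \<tau> \<le> 1 \<Longrightarrow> sqdist (s + \<sigma>) \<le> sqdist \<tau>"
    using distance_increases_near_start by blast
  have "bounded_by_arc (s + \<sigma> / 2)"
    unfolding bounded_by_arc_def
  proof (intro allI impI)
    fix X :: "real^'n \<Rightarrow> real^'n" assume X: "smooth X"
    let ?I = "\<integral>z. tangential_div (snd z) (frechet_derivative X (at (fst z))) \<partial>V"
    let ?A = "\<lambda>\<tau>. parallelogram_area (X (\<gamma> \<tau>)) (c \<tau>)"
    have Ac: "continuous_on {s..1} ?A"
      by (intro continuous_on_parallelogram_area smooth_on_tail[OF X] c_cont_tail)
    then have iA: "integrable \<Gamma> ?A" by (rule integrable_arc_continuous)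
    obtain B where B: "\<And>\<tau>. \<tau> \<in> {s..1} \<Longrightarrow> ?A \<tau> \<le> B"
      using compact_imp_bounded[OF compact_continuous_image[OF Ac compact_Icc]]
      by (force simp: bounded_iff abs_le_iff)
    have est: "?I \<le> 2 * B * \<eta> + (\<integral>\<tau>. ?A \<tau> \<partial>arc_measure (s + \<sigma> / 2) 1)"
      if \<eta>: "0 < \<eta>" "\<eta> < \<sigma> / 4" for \<eta>
    proof -
      define \<kappa> where "\<kappa> = (\<lambda>\<tau>. max 0 (min (min 1 ((\<tau> - s) / \<eta> - 1)) (2 * (s + \<sigma> - \<tau>) / \<sigma>)))"
      define k where "k = (\<lambda>\<tau>. (X (\<gamma> \<tau>) \<bullet> (\<gamma> \<tau> - a)) / ((\<gamma> \<tau> - a) \<bullet> c \<tau>))"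
      define u where "u = (\<lambda>\<tau>. X (\<gamma> \<tau>) - k \<tau> *\<^sub>R c \<tau>)"
      define w where "w = (\<lambda>\<tau>. \<kappa> \<tau> *\<^sub>R u (max \<tau> (s + \<eta>)))"
      have \<kappa>c: "continuous_on S \<kappa>" for S unfolding \<kappa>_def by (intro continuous_intros) (use \<eta> \<sigma> in auto)
      have \<kappa>01: "0 \<le> \<kappa> \<tau>" "\<kappa> \<tau> \<le> 1" for \<tau> by (auto simp: \<kappa>_def)
      have \<kappa>0: "\<kappa> \<tau> = 0" if "\<tau> \<le> s + \<eta>" for \<tau>
      proof -
        have "(\<tau> - s) / \<eta> - 1 \<le> 0" using that \<eta> by simp
        then show ?thesis by (simp add: \<kappa>_def)
      qed
      have \<kappa>e: "\<kappa> \<tau> = 0" if "s + \<sigma> \<le> \<tau>" for \<tau>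
      proof -
        have "2 * (s + \<sigma> - \<tau>) / \<sigma> \<le> 0" using that \<sigma> by (intro divide_nonpos_pos) auto
        then show ?thesis by (simp add: \<kappa>_def)
      qed
      have \<kappa>1: "\<kappa> \<tau> = 1" if "s + 2 * \<eta> \<le> \<tau>" "\<tau> \<le> s + \<sigma> / 2" for \<tau>
      proof -
        have "1 \<le> (\<tau> - s) / \<eta> - 1" "1 \<le> 2 * (s + \<sigma> - \<tau>) / \<sigma>" using that \<eta> \<sigma> by (auto simp: field_simps)
        then show ?thesis by (simp add: \<kappa>_def)
      qed
      have uc: "continuous_on {s + \<eta>..s + \<sigma>} u"
        unfolding u_def k_def
        by (intro continuous_intros continuous_on_subset[OF smooth_on_tail[OF X]]
            continuous_on_subset[OF \<gamma>_cont_tail] continuous_on_subset[OF c_cont_tail])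
           (use \<eta> \<sigma> yc in force)+
      have "continuous_on {s..s + \<sigma>} (\<lambda>\<tau>. u (max \<tau> (s + \<eta>)))"
        by (rule continuous_on_compose2[OF uc]) (use \<eta> in \<open>auto intro!: continuous_intros\<close>)
      then have wc: "continuous_on {s..s + \<sigma>} w" unfolding w_def by (intro continuous_intros \<kappa>c)
      have w: "w \<tau> = \<kappa> \<tau> *\<^sub>R u \<tau>" for \<tau>
        using \<kappa>0[of \<tau>] by (cases "\<tau> \<le> s + \<eta>") (auto simp: w_def max_absorb1)
      have orth: "w \<tau> \<bullet> (\<gamma> \<tau> - a) = 0" for \<tau>
      proof (cases "s + \<eta> < \<tau> \<and> \<tau> < s + \<sigma>")
        case True
        then have "(\<gamma> \<tau> - a) \<bullet> c \<tau> \<noteq> 0" using yc[of \<tau>] \<eta> by auto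
        then have "u \<tau> \<bullet> (\<gamma> \<tau> - a) = 0" unfolding u_def k_def inner_diff_left[of "X (\<gamma> \<tau>)"] inner_scaleR_left
          by (simp add: inner_commute[of "c \<tau>"])
        then show ?thesis by (simp add: w)
      qed (use \<kappa>0 \<kappa>e in \<open>auto simp: w not_less\<close>)
      let ?B = "\<lambda>\<tau>. parallelogram_area (X (\<gamma> \<tau>) - w \<tau>) (c \<tau>)"
      have Ble: "?B \<tau> \<le> (1 - \<kappa> \<tau>) * ?A \<tau>" for \<tau>
      proof -
        have "X (\<gamma> \<tau>) - w \<tau> = (1 - \<kappa> \<tau>) *\<^sub>R X (\<gamma> \<tau>) + (\<kappa> \<tau> * k \<tau>) *\<^sub>R c \<tau>"
          by (simp add: w u_def algebra_simps)
        then have "?B \<tau> \<le> parallelogram_area ((1 - \<kappa> \<tau>) *\<^sub>R X (\<gamma> \<tau>)) (c \<tau>) + parallelogram_area ((\<kappa> \<tau> * k \<tau>) *\<^sub>R c \<tau>) (c \<tau>)"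
          by (simp only: parallelogram_area_add_left)
        moreover have "parallelogram_area (c \<tau>) (c \<tau>) = 0" by (simp add: parallelogram_area_def power2_norm_eq_inner flip: power2_eq_square)
        ultimately show ?thesis unfolding parallelogram_area_scale_left using \<kappa>01(2)[of \<tau>] by simp
      qed
      have BA: "?B \<tau> \<le> ?A \<tau>" for \<tau>
        using Ble[of \<tau>] mult_left_le_one_le[of "?A \<tau>" "1 - \<kappa> \<tau>"] \<kappa>01[of \<tau>] by simp
      have wcc: "continuous_on {s..1} w"
      proof -
        have "continuous_on ({s..s + \<sigma>} \<union> {s + \<sigma>..1}) w"
          by (rule continuous_on_closed_Un[OF _ _ wc])
             (auto intro!: continuous_on_eq[OF continuous_on_const[of _ 0]] simp: w \<kappa>e)
        moreover have "{s..s + \<sigma>} \<union> {s + \<sigma>..1} = {s..1}" using \<sigma> by auto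
        ultimately show ?thesis by simp
      qed
      have iB: "integrable \<Gamma> ?B"
        by (intro integrable_arc_continuous continuous_on_parallelogram_area continuous_on_diff smooth_on_tail[OF X] wcc c_cont_tail)
      have ord: "s \<le> s + 2 * \<eta>" "s + 2 * \<eta> \<le> s + \<sigma> / 2" "s + \<sigma> / 2 \<le> 1" "s + 2 * \<eta> \<le> 1" "s \<le> s + \<sigma> / 2"
        using \<eta> \<sigma> by auto
      note B1 = integral_arc_measure_split[OF iB ord(1,4)]
      note B2 = integral_arc_measure_split[OF B1(3) ord(2,3)]
      have "(\<integral>\<tau>. ?B \<tau> \<partial>arc_measure s (s + 2 * \<eta>)) \<le> B * (s + 2 * \<eta> - s)"
      proof (rule integral_le_const_arc[OF ord(1) B1(2)])
        show "AE \<tau> in arc_measure s (s + 2 * \<eta>). ?B \<tau> \<le> B"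
          using AE_arc_measure[of s "s + 2 * \<eta>"]
        proof eventually_elim
          case (elim \<tau>)
          then have "\<tau> \<in> {s..1}" using ord by auto
          then show ?case by (rule order_trans[OF BA B])
        qed
      qed
      moreover have "(\<integral>\<tau>. ?B \<tau> \<partial>arc_measure (s + 2 * \<eta>) (s + \<sigma> / 2)) \<le> 0 * (s + \<sigma> / 2 - (s + 2 * \<eta>))"
      proof (rule integral_le_const_arc[OF ord(2) B2(2)])
        show "AE \<tau> in arc_measure (s + 2 * \<eta>) (s + \<sigma> / 2). ?B \<tau> \<le> 0"
          using AE_arc_measure[of "s + 2 * \<eta>" "s + \<sigma> / 2"]
        proof eventually_elim
          case (elim \<tau>)
          then show ?case using Ble[of \<tau>] \<kappa>1[of \<tau>] by simp
        qed
      qed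
      moreover have "(\<integral>\<tau>. ?B \<tau> \<partial>arc_measure (s + \<sigma> / 2) 1) \<le> (\<integral>\<tau>. ?A \<tau> \<partial>arc_measure (s + \<sigma> / 2) 1)"
        by (rule integral_mono[OF B2(3) integral_arc_measure_split(3)[OF iA ord(5,3)]]) (rule BA)
      moreover have "?I \<le> (\<integral>\<tau>. ?B \<tau> \<partial>\<Gamma>)"
        by (rule first_variation_mod_normal_field[OF \<sigma> mono far X wc _ \<eta>(1) _ orth]) (auto simp: w \<kappa>0 \<kappa>e)
      ultimately show ?thesis using B1(1) B2(1) by simp
    qed
    have "eventually (\<lambda>\<eta>. ?I \<le> 2 * B * \<eta> + (\<integral>\<tau>. ?A \<tau> \<partial>arc_measure (s + \<sigma> / 2) 1)) (at_right 0)"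
      unfolding eventually_at_right_field using est \<sigma> by (intro exI[of _ "\<sigma> / 4"]) auto
    moreover have "((\<lambda>\<eta>. 2 * B * \<eta> + (\<integral>\<tau>. ?A \<tau> \<partial>arc_measure (s + \<sigma> / 2) 1)) \<longlongrightarrow>
        2 * B * 0 + (\<integral>\<tau>. ?A \<tau> \<partial>arc_measure (s + \<sigma> / 2) 1)) (at_right 0)"
      by (intro tendsto_intros)
    ultimately have "?I \<le> 2 * B * 0 + (\<integral>\<tau>. ?A \<tau> \<partial>arc_measure (s + \<sigma> / 2) 1)"
      using tendsto_lowerbound[OF _ _ trivial_limit_at_right_real] by blast
    then show "?I \<le> (\<integral>\<tau>. ?A \<tau> \<partial>arc_measure (s + \<sigma> / 2) 1)" by simp
  qed
  then show thesis using that[of "\<sigma> / 2"] \<sigma> by auto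
qed

end

lemma le_by_small_error:
  fixes J :: real
  assumes "\<And>\<epsilon>. 0 < \<epsilon> \<Longrightarrow> J \<le> B * \<epsilon> + J'"
  shows "J \<le> J'"
proof -
  have "((\<lambda>\<epsilon>. B * \<epsilon> + J') \<longlongrightarrow> B * 0 + J') (at_right 0)" by (intro tendsto_intros)
  moreover have "eventually (\<lambda>\<epsilon>. J \<le> B * \<epsilon> + J') (at_right 0)"
    unfolding eventually_at_right_field using assms by (intro exI[of _ 1]) auto
  ultimately have "J \<le> B * 0 + J'" using tendsto_lowerbound[OF _ _ trivial_limit_at_right_real] by blast
  then show ?thesis by simp
qed

context varifold_arc begin

lemma arc_area_cont:
  assumes "smooth X"
  shows "continuous_on {0..1} (\<lambda>\<tau>. parallelogram_area (X (\<gamma> \<tau>)) (c \<tau>))"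
  by (intro continuous_on_parallelogram_area c_cont
      continuous_on_compose2[OF smooth_continuous[OF assms] \<gamma>_cont]) auto

lemma arc_area_bound:
  assumes "smooth X"
  obtains B where "B \<ge> 0" "\<And>\<tau>. \<tau> \<in> {0..1} \<Longrightarrow> parallelogram_area (X (\<gamma> \<tau>)) (c \<tau>) \<le> B"
proof -
  obtain B where B: "\<And>\<tau>. \<tau> \<in> {0..1} \<Longrightarrow> parallelogram_area (X (\<gamma> \<tau>)) (c \<tau>) \<le> B"
    using compact_imp_bounded[OF compact_continuous_image[OF arc_area_cont[OF assms] compact_Icc]]
    by (force simp: bounded_iff abs_le_iff)
  show thesis using that[of "max 0 B"] B by force
qed

lemma arc_area_integrable:
  assumes "smooth X" "0 \<le> s" "t \<le> 1"
  shows "integrable (arc_measure s t) (\<lambda>\<tau>. parallelogram_area (X (\<gamma> \<tau>)) (c \<tau>))"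
  by (rule integrable_arc_continuous[OF continuous_on_subset[OF arc_area_cont[OF assms(1)]]]) (use assms in auto)

lemma bounded_by_arc_Sup:
  assumes S: "S \<noteq> {}" "S \<subseteq> {0..1}" "\<And>s. s \<in> S \<Longrightarrow> bounded_by_arc s"
  shows "bounded_by_arc (Sup S)"
  unfolding bounded_by_arc_def
proof (intro allI impI)
  fix X :: "real^'n \<Rightarrow> real^'n" assume X: "smooth X"
  let ?A = "\<lambda>\<tau>. parallelogram_area (X (\<gamma> \<tau>)) (c \<tau>)"
  let ?I = "\<integral>z. tangential_div (snd z) (frechet_derivative X (at (fst z))) \<partial>V"
  obtain B where B: "B \<ge> 0" "\<And>\<tau>. \<tau> \<in> {0..1} \<Longrightarrow> ?A \<tau> \<le> B" using arc_area_bound[OF X] by blast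
  have bdd: "bdd_above S" using S(2) by (meson bdd_above_Icc bdd_above_mono)
  have S1: "Sup S \<le> 1" using S by (intro cSup_least) auto
  show "?I \<le> (\<integral>\<tau>. ?A \<tau> \<partial>arc_measure (Sup S) 1)"
  proof (rule le_by_small_error[of _ B])
    fix \<epsilon> :: real assume "0 < \<epsilon>"
    then obtain s where s: "s \<in> S" "Sup S - \<epsilon> < s" using less_cSupD[OF S(1), of "Sup S - \<epsilon>"] by auto
    have sl: "s \<le> Sup S" "0 \<le> s" using s S bdd by (auto intro: cSup_upper)
    note sp = integral_arc_measure_split[OF arc_area_integrable[OF X sl(2) order_refl] sl(1) S1]
    have "?I \<le> (\<integral>\<tau>. ?A \<tau> \<partial>arc_measure s 1)" using S(3)[OF s(1)] X by (simp add: bounded_by_arc_def)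
    moreover have "(\<integral>\<tau>. ?A \<tau> \<partial>arc_measure s (Sup S)) \<le> B * (Sup S - s)"
    proof (rule integral_le_const_arc[OF sl(1) sp(2)])
      show "AE \<tau> in arc_measure s (Sup S). ?A \<tau> \<le> B"
        using AE_arc_measure[of s "Sup S"] by eventually_elim (use B(2) sl S1 in auto)
    qed
    moreover have "B * (Sup S - s) \<le> B * \<epsilon>" using s B by (intro mult_left_mono) auto
    ultimately show "?I \<le> B * \<epsilon> + (\<integral>\<tau>. ?A \<tau> \<partial>arc_measure (Sup S) 1)" using sp(1) by linarith
  qed
qed

lemma bounded_by_end_point:
  assumes "bounded_by_arc 1"
  shows "measure V UNIV = 0"
proof -
  have "(\<integral>z. 2 \<partial>V) \<le> (\<integral>\<tau>. parallelogram_area (\<gamma> \<tau>) (c \<tau>) \<partial>arc_measure 1 1)"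
    by (rule first_variation(2)[OF assms smooth_ident has_derivative_ident]) (simp_all add: tangential_div_ident)
  also have "\<dots> = integral {1..1} (\<lambda>\<tau>. parallelogram_area (\<gamma> \<tau>) (c \<tau>))"
    by (rule integral_arc_measure_continuous) simp
  finally have "2 * measure V UNIV \<le> 0" by (simp add: space_V)
  then show ?thesis using measure_nonneg[of V UNIV] by linarith
qed

lemma bounded_by_shorter_arc_off_support:
  assumes s: "bounded_by_arc s" "0 \<le> s" "s < 1" and off: "\<gamma> s \<notin> support V"
  obtains \<sigma> where "\<sigma> > 0" "s + \<sigma> \<le> 1" "bounded_by_arc (s + \<sigma>)"
proof -
  let ?a = "\<gamma> s"
  obtain r where r: "r > 0" "emeasure (weight V) (ball ?a r) = 0"
    using off by (auto simp: support_def not_less)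
  have far: "AE z in V. r \<le> D ?a z"
  proof -
    have "emeasure V (fst -` ball ?a r \<inter> space V) = 0" using r by (simp add: weight_def emeasure_distr)
    moreover have "fst -` ball ?a r \<inter> space V \<in> sets V" by measurable
    ultimately have "AE z in V. z \<notin> fst -` ball ?a r \<inter> space V" by (intro AE_not_in) (auto simp: null_sets_def)
    then show ?thesis by eventually_elim (auto simp: space_V dist_norm norm_minus_commute)
  qed
  define b where "b = r\<^sup>2 / 2"
  have b: "b > 0" using r by (simp add: b_def)
  define \<sigma> where "\<sigma> = min (1 - s) (r / (2 * (K + 1)))"
  have \<sigma>: "\<sigma> > 0" "s + \<sigma> \<le> 1" using s r K0 by (auto simp: \<sigma>_def)
  have "K * \<sigma> \<le> K * (r / (2 * (K + 1)))" using K0 by (intro mult_left_mono) (auto simp: \<sigma>_def)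
  also have "\<dots> \<le> r / 2" using K0 r by (simp add: field_simps)
  finally have K\<sigma>: "K * \<sigma> \<le> r / 2" .
  have "bounded_by_arc (s + \<sigma>)"
    unfolding bounded_by_arc_def
  proof (intro allI impI)
    fix X :: "real^'n \<Rightarrow> real^'n" assume X: "smooth X"
    let ?A = "\<lambda>\<tau>. parallelogram_area (X (\<gamma> \<tau>)) (c \<tau>)"
    let ?dX = "\<lambda>x. frechet_derivative X (at x)"
    let ?t = "\<lambda>z. tangential_div (snd z) (?dX (fst z))"
    obtain B where B: "B \<ge> 0" "\<And>\<tau>. \<tau> \<in> {0..1} \<Longrightarrow> ?A \<tau> \<le> B" using arc_area_bound[OF X] by blast
    obtain L where L: "L > 0" "\<And>x h. x \<in> cball 0 R \<Longrightarrow> norm (?dX x h) \<le> L * norm h"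
      using smooth_derivative_bound[OF X compact_cball[of 0 R]] by metis
    obtain N where N: "\<And>x. x \<in> cball 0 R \<Longrightarrow> norm (X x) \<le> N"
      using compact_imp_bounded[OF compact_continuous_image[OF continuous_on_subset[OF smooth_continuous[OF X]] compact_cball[of 0 R]]]
      by (force simp: bounded_iff)
    define Q where "Q = (2 * L + 2 / r\<^sup>2 * ((R + norm ?a) * N)) * measure V UNIV + B"
    have est: "(\<integral>z. ?t z \<partial>V) \<le> Q * (real n * (1/2) ^ n) + (\<integral>\<tau>. ?A \<tau> \<partial>arc_measure (s + \<sigma>) 1)"
      if n: "n > 0" for n :: nat
    proof -
      define g where "g = (\<lambda>t::real. t ^ n / (t ^ n + b ^ n))"
      define g' where "g' = (\<lambda>t::real. real n * t ^ (n - 1) * b ^ n / (t ^ n + b ^ n)\<^sup>2)"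
      define \<epsilon> where "\<epsilon> = real n * (1/2) ^ n"
      have half: "0 \<le> \<epsilon>" "(1/2) ^ n \<le> \<epsilon>" using n mult_right_mono[of 1 "real n" "(1/2) ^ n"] by (auto simp: \<epsilon>_def)
      have pos: "t ^ n + b ^ n > 0" if "t \<ge> 0" for t using b that by (simp add: add_nonneg_pos)
      have dg: "(g has_real_derivative g' t) (at t)" if "t \<ge> 0" for t
      proof -
        have "(g has_real_derivative ((real n * t ^ (n - 1)) * (t ^ n + b ^ n) - t ^ n * (real n * t ^ (n - 1))) / (t ^ n + b ^ n)\<^sup>2) (at t)"
          unfolding g_def using pos[OF that] by (auto intro!: derivative_eq_intros simp: power2_eq_square)
        then show ?thesis by (simp add: g'_def algebra_simps)
      qed
      have nz: "((norm (x - ?a))\<^sup>2) ^ n + b ^ n \<noteq> 0" for x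
        using pos[of "(norm (x - ?a))\<^sup>2"] by (intro notI) simp
      have smY: "smooth (\<lambda>x. g ((norm (x - ?a))\<^sup>2) *\<^sub>R X x)"
        unfolding g_def
        by (intro smooth_scaleR smooth_divide smooth_add smooth_power smooth_norm_sq smooth_diff smooth_ident smooth_const X)
           (rule nz)
      let ?Y' = "\<lambda>x h. (2 * g' ((norm (x - ?a))\<^sup>2) * ((x - ?a) \<bullet> h)) *\<^sub>R X x + g ((norm (x - ?a))\<^sup>2) *\<^sub>R ?dX x h"
      have dY: "((\<lambda>x. g ((norm (x - ?a))\<^sup>2) *\<^sub>R X x) has_derivative ?Y' x) (at x)" for x
        by (rule has_derivative_radial_weight[OF smooth_has_derivative[OF X] dg]) simp
      let ?F = "\<lambda>z. g ((D ?a z)\<^sup>2) * ?t z + 2 * g' ((D ?a z)\<^sup>2) * ((fst z - ?a) \<bullet> (snd z *v X (fst z)))"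
      have mX: "(\<lambda>z. X (fst z)) \<in> borel_measurable V"
        using measurable_compose[OF measurable_fst_V borel_measurable_continuous_onI[OF smooth_continuous[OF X]]] .
      note [measurable] = mX measurable_tangential_div[OF sets_V X]
      have mF: "?F \<in> borel_measurable V" unfolding g_def g'_def by measurable
      have td: "tangential_div (snd z) (?Y' (fst z)) = ?F z" if "snd z \<in> planes" for z
        by (rule tangential_div_radial_weight[OF that])
      note fv = first_variation[OF s(1) smY dY mF td]
      have it: "integrable V ?t"
        by (rule first_variation(1)[OF s(1) X smooth_has_derivative[OF X]]) simp_all
      let ?c = "(2 * L + 2 / r\<^sup>2 * ((R + norm ?a) * N)) * \<epsilon>"
      have "(\<integral>z. ?t z \<partial>V) \<le> (\<integral>z. ?F z + ?c \<partial>V)"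
      proof (rule integral_mono_AE)
        show "integrable V (\<lambda>z. ?F z + ?c)" using fv(1) by simp
        show "AE z in V. ?t z \<le> ?F z + ?c"
          using planes_AE bounded_AE far
        proof eventually_elim
          case (elim z)
          define t where "t = (D ?a z)\<^sup>2"
          have "r\<^sup>2 \<le> t" unfolding t_def using elim(3) r by (intro power_mono) auto
          then have t: "t > 0" "2 * b \<le> t" "r\<^sup>2 \<le> t" using zero_less_power[OF r(1), of 2] unfolding b_def by linarith+
          have q: "b ^ n / t ^ n \<le> (1/2) ^ n"
          proof -
            have "b / t \<le> 1 / 2" using t by (simp add: divide_le_eq)
            then have "(b / t) ^ n \<le> (1/2) ^ n" using b t by (intro power_mono) auto
            then show ?thesis by (simp add: power_divide)
          qed
          have "1 - g t = b ^ n / (t ^ n + b ^ n)" using pos[of t] t by (simp add: g_def field_simps)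
          also have "\<dots> \<le> b ^ n / t ^ n" using b t(1) by (intro divide_left_mono mult_pos_pos add_pos_pos zero_less_power) auto
          finally have g1: "1 - g t \<le> \<epsilon>" using q half by linarith
          have g0: "g t \<le> 1" using b pos[of t] t(1) by (simp add: g_def)
          have tn: "t ^ n = t * t ^ (n - 1)" using n by (cases n) auto
          have g'0: "0 \<le> g' t" using b t by (simp add: g'_def)
          have "g' t \<le> real n * t ^ (n - 1) * b ^ n / (t ^ n)\<^sup>2" unfolding g'_def
            using b t(1) by (intro divide_left_mono power_mono mult_pos_pos zero_less_power add_pos_pos) auto
          also have "\<dots> = real n * (b ^ n / t ^ n) / t" unfolding power2_eq_square using t
            by (subst (2) tn) (simp add: field_simps)
          also have "\<dots> \<le> \<epsilon> / t" unfolding \<epsilon>_def using q t by (intro divide_right_mono mult_left_mono) auto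
          also have "\<dots> \<le> \<epsilon> / r\<^sup>2" using t r half by (intro divide_left_mono) auto
          finally have g'1: "g' t \<le> \<epsilon> / r\<^sup>2" .
          have x: "fst z \<in> cball 0 R" using elim(2) by simp
          have tb: "\<bar>?t z\<bar> \<le> 2 * L"
            by (rule tangential_div_bound[OF elim(1) has_derivative_linear[OF smooth_has_derivative[OF X]] L(2)[OF x]])
          define w where "w = (fst z - ?a) \<bullet> (snd z *v X (fst z))"
          have "\<bar>w\<bar> \<le> D ?a z * norm (snd z *v X (fst z))" unfolding w_def by (rule Cauchy_Schwarz_ineq2)
          also have "\<dots> \<le> (R + norm ?a) * N"
          proof (intro mult_mono)
            show "D ?a z \<le> R + norm ?a" using norm_triangle_ineq4[of "fst z" ?a] elim(2) by linarith
            show "norm (snd z *v X (fst z)) \<le> N" using plane_norm_le[OF elim(1)] N[OF x] order_trans by blast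
            show "0 \<le> R + norm ?a" using elim(2) norm_ge_zero[of "fst z"] norm_ge_zero[of ?a] by linarith
          qed simp
          finally have w: "\<bar>w\<bar> \<le> (R + norm ?a) * N" .
          have "(1 - g t) * ?t z \<le> \<epsilon> * (2 * L)"
          proof -
            have "(1 - g t) * ?t z \<le> (1 - g t) * \<bar>?t z\<bar>" using g0 by (intro mult_left_mono) auto
            also have "\<dots> \<le> \<epsilon> * (2 * L)" using g0 g1 half tb by (intro mult_mono) auto
            finally show ?thesis .
          qed
          moreover have "- (g' t * w) \<le> \<epsilon> / r\<^sup>2 * ((R + norm ?a) * N)"
          proof -
            have "- (g' t * w) \<le> g' t * \<bar>w\<bar>" using g'0 abs_le_D2[of "g' t * w"] by (simp add: abs_mult)
            also have "\<dots> \<le> \<epsilon> / r\<^sup>2 * ((R + norm ?a) * N)" using g'0 g'1 half w by (intro mult_mono) auto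
            finally show ?thesis .
          qed
          moreover have "T \<le> h * T + 2 * k * w' + (2 * L + 2 / q * M) * e"
            if "(1 - h) * T \<le> e * (2 * L)" "- (k * w') \<le> e / q * M" for T h k w' q M e :: real
          proof -
            have "(2 * L + 2 / q * M) * e = e * (2 * L) + 2 * (e / q * M)" by (simp add: algebra_simps)
            moreover have "T - h * T = (1 - h) * T" by (simp add: algebra_simps)
            moreover have "2 * k * w' = 2 * (k * w')" by simp
            ultimately show ?thesis using that by linarith
          qed
          ultimately show ?case unfolding t_def[symmetric] w_def[symmetric] by blast
        qed
      qed (rule it)
      also have "\<dots> = (\<integral>z. ?F z \<partial>V) + ?c * measure V UNIV"
        using fv(1) by (subst Bochner_Integration.integral_add) (auto simp: space_V mult.commute)
      finally have 1: "(\<integral>z. ?t z \<partial>V) \<le> (\<integral>z. ?F z \<partial>V) + ?c * measure V UNIV" .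
      have g01: "0 \<le> g t" "g t \<le> 1" if "t \<ge> 0" for t using that b pos[OF that] by (auto simp: g_def)
      let ?G = "\<lambda>\<tau>. parallelogram_area (g ((norm (\<gamma> \<tau> - ?a))\<^sup>2) *\<^sub>R X (\<gamma> \<tau>)) (c \<tau>)"
      have G: "?G \<tau> = g ((norm (\<gamma> \<tau> - ?a))\<^sup>2) * ?A \<tau>" for \<tau>
        unfolding parallelogram_area_scale_left using g01(1) by simp
      have so: "s \<le> s + \<sigma>" using \<sigma> by simp
      note spG = integral_arc_measure_split[OF arc_area_integrable[OF smY s(2) order_refl] so \<sigma>(2)]
      have "(\<integral>\<tau>. ?G \<tau> \<partial>arc_measure s (s + \<sigma>)) \<le> (\<epsilon> * B) * (s + \<sigma> - s)"
      proof (rule integral_le_const_arc[OF so spG(2)])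
        show "AE \<tau> in arc_measure s (s + \<sigma>). ?G \<tau> \<le> \<epsilon> * B"
          using AE_arc_measure[of s "s + \<sigma>"]
        proof eventually_elim
          case (elim \<tau>)
          have \<tau>: "\<tau> \<in> {0..1}" using elim s \<sigma> by auto
          define t where "t = (norm (\<gamma> \<tau> - ?a))\<^sup>2"
          have "norm (\<gamma> \<tau> - ?a) \<le> K * (\<tau> - s)" using gamma_lipschitz[of \<tau> s] \<tau> s elim by simp
          also have "\<dots> \<le> K * \<sigma>" using elim K0 by (intro mult_left_mono) auto
          finally have "t \<le> (r / 2)\<^sup>2" unfolding t_def using K\<sigma> by (intro power_mono) auto
          then have t: "0 \<le> t" "t / b \<le> 1 / 2" using b r by (auto simp: t_def b_def power_divide field_simps)
          have "g t \<le> t ^ n / b ^ n" unfolding g_def using t b by (intro divide_left_mono mult_pos_pos) (auto simp: add_nonneg_pos)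
          also have "\<dots> = (t / b) ^ n" by (simp add: power_divide)
          also have "\<dots> \<le> (1/2) ^ n" using t b by (intro power_mono) auto
          finally have "g t \<le> \<epsilon>" using half by linarith
          then have "g t * ?A \<tau> \<le> \<epsilon> * B" using B(2)[OF \<tau>] B(1) half by (intro mult_mono) auto
          then show ?case using G[of \<tau>] by (simp only: t_def)
        qed
      qed
      also have "\<dots> \<le> \<epsilon> * B" using half B \<sigma> s by (simp add: mult_left_le)
      finally have 2: "(\<integral>\<tau>. ?G \<tau> \<partial>arc_measure s (s + \<sigma>)) \<le> \<epsilon> * B" .
      have 3: "(\<integral>\<tau>. ?G \<tau> \<partial>arc_measure (s + \<sigma>) 1) \<le> (\<integral>\<tau>. ?A \<tau> \<partial>arc_measure (s + \<sigma>) 1)"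
      proof (rule integral_mono[OF spG(3)])
        show "integrable (arc_measure (s + \<sigma>) 1) ?A" using arc_area_integrable[OF X, of "s + \<sigma>" 1] s \<sigma> by simp
        show "?G \<tau> \<le> ?A \<tau>" for \<tau> unfolding G using g01[of "(norm (\<gamma> \<tau> - ?a))\<^sup>2"] by (intro mult_left_le_one_le) auto
      qed
      have "?c * measure V UNIV + \<epsilon> * B = Q * \<epsilon>" by (simp add: Q_def algebra_simps)
      then show ?thesis using 1 fv(2) spG(1) 2 3 unfolding \<epsilon>_def[symmetric] by linarith
    qed
    have "(\<lambda>n. real n * (1/2) ^ n) \<longlonglongrightarrow> 0" using powser_times_n_limit_0[of "1/2::real"] by simp
    then have "(\<lambda>n. Q * (real n * (1/2) ^ n) + (\<integral>\<tau>. ?A \<tau> \<partial>arc_measure (s + \<sigma>) 1))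
        \<longlonglongrightarrow> Q * 0 + (\<integral>\<tau>. ?A \<tau> \<partial>arc_measure (s + \<sigma>) 1)" by (intro tendsto_intros)
    moreover have "eventually (\<lambda>n. (\<integral>z. ?t z \<partial>V) \<le> Q * (real n * (1/2) ^ n) + (\<integral>\<tau>. ?A \<tau> \<partial>arc_measure (s + \<sigma>) 1)) sequentially"
      using eventually_gt_at_top[of 0] by eventually_elim (rule est)
    ultimately have "(\<integral>z. ?t z \<partial>V) \<le> Q * 0 + (\<integral>\<tau>. ?A \<tau> \<partial>arc_measure (s + \<sigma>) 1)"
      by (rule tendsto_lowerbound) simp
    then show "(\<integral>z. ?t z \<partial>V) \<le> (\<integral>\<tau>. ?A \<tau> \<partial>arc_measure (s + \<sigma>) 1)" by simp
  qed
  then show thesis using that \<sigma> by blast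
qed

lemma varifold_vanishes:
  assumes bba: "bounded_by_arc 0"
    and TC: "\<And>ts. sorted_wrt (<) ts \<Longrightarrow> set ts \<subseteq> {0..1} \<Longrightarrow> polygon_curvature (map \<gamma> ts) \<le> 2 * pi"
    and dens: "\<And>p. p \<in> support V - \<gamma> ` {0..1} \<Longrightarrow> \<exists>\<Theta>\<ge>1. has_density V p \<Theta>"
  shows "measure V UNIV = 0"
proof -
  define S where "S = {s\<in>{0..1}. bounded_by_arc s}"
  have "0 \<in> S" using bba by (simp add: S_def)
  then have S: "S \<noteq> {}" "S \<subseteq> {0..1}" unfolding S_def by blast+
  define s where "s = Sup S"
  have bdd: "bdd_above S" using S(2) by (meson bdd_above_Icc bdd_above_mono)
  have bs: "bounded_by_arc s" unfolding s_def by (rule bounded_by_arc_Sup[OF S]) (simp add: S_def)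
  have s01: "0 \<le> s" "s \<le> 1"
    unfolding s_def using S by (rule_tac [2] cSup_least) (auto intro: cSup_upper[OF \<open>0 \<in> S\<close> bdd])
  have maximal: "t \<le> s" if "bounded_by_arc t" "0 \<le> t" "t \<le> 1" for t
    unfolding s_def using that bdd by (intro cSup_upper) (auto simp: S_def)
  have "s = 1"
  proof (rule ccontr)
    assume "s \<noteq> 1"
    then have s1: "s < 1" using s01 by simp
    have "\<exists>\<sigma>>0. s + \<sigma> \<le> 1 \<and> bounded_by_arc (s + \<sigma>)"
    proof (cases "\<gamma> s \<in> support V")
      case True
      then interpret touching_varifold \<gamma> c C K m V R s
        by unfold_locales (use bs s01 s1 TC dens in auto)
      show ?thesis using bounded_by_shorter_arc by metis
    next
      case False
      then show ?thesis using bounded_by_shorter_arc_off_support[OF bs s01(1) s1] by metis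
    qed
    then show False using maximal s01 by force
  qed
  then show ?thesis using bounded_by_end_point bs by simp
qed

end

theorem theorem8p1:
  fixes \<gamma> :: "real \<Rightarrow> real^'n"
  assumes "smooth_embedded_arc \<gamma>"
    and "total_curvature \<gamma> \<le> ereal (2 * pi)"
  shows "\<not> (\<exists>M :: 'n varifold.
            rectifiable_varifold2 M \<and> emeasure M UNIV \<noteq> 0 \<and> bounded (support M) \<and>
            (\<forall>p \<in> support M - path_image \<gamma>. \<exists>\<Theta>\<ge>1. has_density M p \<Theta>) \<and>
            strongly_stationary M \<gamma>)"
proof
  let ?c = "velocity \<gamma>"
  assume "\<exists>M :: 'n varifold.
            rectifiable_varifold2 M \<and> emeasure M UNIV \<noteq> 0 \<and> bounded (support M) \<and>
            (\<forall>p \<in> support M - path_image \<gamma>. \<exists>\<Theta>\<ge>1. has_density M p \<Theta>) \<and>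
            strongly_stationary M \<gamma>"
  then obtain M :: "'n varifold" where M: "varifold2 M" "emeasure M UNIV \<noteq> 0" "bounded (support M)"
      "\<And>p. p \<in> support M - path_image \<gamma> \<Longrightarrow> \<exists>\<Theta>\<ge>1. has_density M p \<Theta>" "strongly_stationary M \<gamma>"
    by (auto simp: rectifiable_varifold2_def)
  have sets: "sets M = sets borel" and planes: "AE z in M. snd z \<in> planes"
    and loc: "\<And>K. compact K \<Longrightarrow> emeasure M (K \<times> UNIV) < \<infinity>"
    using M(1) by (auto simp: varifold2_def case_prod_unfold)
  have space: "space M = UNIV" using sets_eq_imp_space_eq[OF sets] by simp
  obtain R where R: "\<And>x. x \<in> support M \<Longrightarrow> norm x \<le> R" using M(3) by (auto simp: bounded_iff)
  have bd: "AE z in M. norm (fst z) \<le> R" using AE_in_support[OF sets] by eventually_elim (rule R)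
  have "emeasure M UNIV \<le> emeasure M (cball 0 R \<times> UNIV)"
  proof (rule emeasure_mono_AE)
    show "AE x in M. x \<in> UNIV \<longrightarrow> x \<in> cball 0 R \<times> UNIV" using bd by eventually_elim (auto simp: mem_Times_iff)
    show "cball 0 R \<times> UNIV \<in> sets M" unfolding sets by (intro borel_closed closed_Times) auto
  qed
  also have "\<dots> < \<infinity>" by (rule loc[OF compact_cball])
  finally have fin: "emeasure M UNIV \<noteq> \<infinity>" by simp
  interpret fm: finite_measure M by (rule finite_measureI) (use fin in \<open>simp add: space\<close>)
  have pos: "measure M UNIV > 0" using M(2) fm.emeasure_eq_measure[of UNIV] by (simp add: zero_less_measure_iff)
  obtain C K m where "regular_arc \<gamma> ?c C K m" using regular_arc_exists[OF assms(1)] by blast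
  then interpret arc: regular_arc \<gamma> ?c C K m .
  interpret varifold_arc \<gamma> ?c C K m M R
    by unfold_locales (use sets planes bd in auto)
  have bba: "bounded_by_arc 0"
    unfolding bounded_by_arc_def
  proof (intro allI impI)
    fix X :: "real^'n \<Rightarrow> real^'n" assume X: "smooth X"
    have dm: "frechet_derivative (\<lambda>x. - X x) (at x) = (\<lambda>h. - frechet_derivative X (at x) h)" for x
      by (rule frechet_derivative_at[symmetric]) (intro has_derivative_minus smooth_has_derivative[OF X])
    have "tangential_div P (\<lambda>h. - A h) = - tangential_div P A" for P and A :: "real^'n \<Rightarrow> real^'n"
      by (simp add: tangential_div_def sum_negf)
    moreover have "parallelogram_area (- X x) v = parallelogram_area (X x) v" for x v
      by (simp add: parallelogram_area_def)
    ultimately have "0 \<le> - (\<integral>z. tangential_div (snd z) (frechet_derivative X (at (fst z))) \<partial>M)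
        + integral {0..1} (\<lambda>\<tau>. parallelogram_area (X (\<gamma> \<tau>)) (?c \<tau>))"
      using first_variation_nonneg[OF fm.finite_measure_axioms sets planes bd pos arc.deriv arc.c_cont M(5) smooth_minus[OF X]]
      by (simp add: dm)
    then show "(\<integral>z. tangential_div (snd z) (frechet_derivative X (at (fst z))) \<partial>M)
        \<le> (\<integral>\<tau>. parallelogram_area (X (\<gamma> \<tau>)) (?c \<tau>) \<partial>arc_measure 0 1)"
      unfolding integral_arc_measure_continuous[OF arc_area_cont[OF X]] by linarith
  qed
  have "polygon_curvature (map \<gamma> ts) \<le> 2 * pi" if ts: "sorted_wrt (<) ts" "set ts \<subseteq> {0..1}" for ts
  proof -
    have "inj_on \<gamma> (set ts)" unfolding inj_on_def using ts(2) arc.inj_gamma by blast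
    then have "distinct (map \<gamma> ts)" using ts(1) by (simp add: distinct_map strict_sorted_iff)
    then have "ereal (polygon_curvature (map \<gamma> ts)) \<le> total_curvature \<gamma>"
      unfolding total_curvature_def using ts by (intro SUP_upper) (simp add: distinct_imp_distinct_adj)
    then have "ereal (polygon_curvature (map \<gamma> ts)) \<le> ereal (2 * pi)" using assms(2) by (rule order_trans)
    then show ?thesis by simp
  qed
  then have "measure M UNIV = 0"
    by (rule varifold_vanishes[OF bba]) (use M(4) in \<open>auto simp: path_image_def\<close>)
  then show False using pos by simp
qed

end
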